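(* Let $(\nabla,\mathbb E,h)$ be a nonsingular radiant statistical structure with conjugate radiant statistical structure $(\bar\nabla,\mathbb E,h)$. Then $(\nabla,\mathbb E,h)$ and $(\bar\nabla,\mathbb E,h)$ are both conelike if and only if $\nabla$ and $\bar\nabla$ are both $\mathbb E$-invariant (equivalently, $\mathbb E^p\bar R_{pijk}=0$ and $\mathbb E^pR_{pijk}=0$). In this case, $(\nabla,\mathbb E,h)$ and $(\bar\nabla,\mathbb E,h)$ have the same planelike surfaces if and only if $\nabla=\bar\nabla$ is the Levi-Civita connection of $h$ (in which case $\mathbb E$ is a concurrent vector field).
   Context: Manifolds are smooth and connected. A radiant statistical structure is a triple $(\nabla,\mathbb E,h)$ of a torsion-free affine connection $\nabla$, a vector field $\mathbb E$, and a pseudo-Riemannian metric $h$ with $\nabla_i\mathbb E^j=\delta_i{}^j$, $\nabla_{[i}h_{j]k}=0$, and $\mathfrak L_{\mathbb E}h=2h$. It is nonsingular if $\mathbb E$ has no zeros. The conjugate radiant statistical structure is $(\bar\nabla,\mathbb E,h)$ where $\bar\nabla=\nabla+h^{kp}\nabla_ih_{jp}$ (it is again a radiant statistical structure). Curvature: $2\nabla_{[i}\nabla_{j]}X^k=R_{ijp}{}^kX^p$, $R_{ijkl}=R_{ijk}{}^ph_{pl}$; $\bar R_{ijkl}$ is defined likewise from $\bar\nabla$. $\mathbb E$-invariant means $\mathfrak L_{\mathbb E}\nabla=0$. An immersed surface is planelike for $(\nabla,\mathbb E)$ if it is $\nabla$-totally geodesic and everywhere tangent to $\mathbb E$. The structure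 is conelike if for every point $p$ and every two-dimensional subspace $L$ of the tangent space at $p$ containing $\mathbb E_p$ there is a smoothly immersed planelike surface through $p$ tangent to $L$ at $p$. Concurrent means $D_X\mathbb E=X$ for all vector fields $X$, where $D$ is the Levi-Civita connection of $h$.
   Formalization: The manifold is assumed not to be two-dimensional: in dimension 2 every radiant statistical structure is conelike, and on the punctured plane there are ones with non-invariant connection, and invariant ones with the same planelike surfaces but different conjugate, so the claim fails there. *)

theory Defs
  imports "HOL-Analysis.Analysis"
begin

section \<open>Smooth maps between open subsets of Euclidean spaces\<close>

fun higher_differentiable_on ::
    "nat \<Rightarrow> ('a::real_normed_vector \<Rightarrow> 'b::real_normed_vector) \<Rightarrow> 'a set \<Rightarrow> bool" where
  "higher_differentiable_on 0 f S \<longleftrightarrow> continuous_on S f"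
| "higher_differentiable_on (Suc k) f S \<longleftrightarrow>
     (\<forall>x\<in>S. f differentiable (at x)) \<and>
     (\<forall>v. higher_differentiable_on k (\<lambda>x. frechet_derivative f (at x) v) S)"

text \<open>Meant for open \<open>S\<close> only.\<close>

definition smooth_on :: "('a::real_normed_vector \<Rightarrow> 'b::real_normed_vector) \<Rightarrow> 'a set \<Rightarrow> bool" where
  "smooth_on f S \<longleftrightarrow> (\<forall>k. higher_differentiable_on k f S)"

definition pd :: "'n::finite \<Rightarrow> (real^'n \<Rightarrow> 'b::real_normed_vector) \<Rightarrow> real^'n \<Rightarrow> 'b" where
  "pd i f x = frechet_derivative f (at x) (axis i 1)"


section \<open>Smooth manifolds\<close>

text \<open>A chart is a pair \<open>(U, \<phi>)\<close>; only the values of \<open>\<phi>\<close> on \<open>U\<close> matter.\<close>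

type_synonym ('a, 'n) chart = "'a set \<times> ('a \<Rightarrow> real^'n)"

definition cdom :: "('a, 'n::finite) chart \<Rightarrow> (real^'n) set" where
  "cdom c = snd c ` fst c"

text \<open>The expression of a map \<open>f\<close> in the charts \<open>c\<close> (of the source) and \<open>d\<close> (of the target), and
  the set of coordinates where it is meaningful. For \<open>f = id\<close> it is the transition map
  from \<open>c\<close> to \<open>d\<close>.\<close>

definition local_rep ::
    "('a, 'm::finite) chart \<Rightarrow> ('b, 'n::finite) chart \<Rightarrow> ('a \<Rightarrow> 'b) \<Rightarrow> real^'m \<Rightarrow> real^'n" where
  "local_rep c d f = (\<lambda>x. snd d (f (inv_into (fst c) (snd c) x)))"

definition local_dom ::
    "('a, 'm::finite) chart \<Rightarrow> ('b, 'n::finite) chart \<Rightarrow> ('a \<Rightarrow> 'b) \<Rightarrow> (real^'m) set" where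
  "local_dom c d f = snd c ` {p \<in> fst c. f p \<in> fst d}"

text \<open>The atlas is not required to be maximal. As all objects below are given by components
  in the charts of the atlas, this makes no difference.\<close>

definition smooth_manifold :: "'a topology \<Rightarrow> ('a, 'n::finite) chart set \<Rightarrow> bool" where
  "smooth_manifold X A \<longleftrightarrow>
     Hausdorff_space X \<and> second_countable X \<and> connected_space X \<and>
     (\<Union>c\<in>A. fst c) = topspace X \<and>
     (\<forall>c\<in>A. openin X (fst c) \<and> open (cdom c) \<and>
        homeomorphic_map (subtopology X (fst c)) (top_of_set (cdom c)) (snd c)) \<and>
     (\<forall>c\<in>A. \<forall>d\<in>A. smooth_on (local_rep c d id) (local_dom c d id))"

definition smooth_map ::
    "'b topology \<Rightarrow> ('b, 'm::finite) chart set \<Rightarrow> 'a topology \<Rightarrow> ('a, 'n::finite) chart set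
      \<Rightarrow> ('b \<Rightarrow> 'a) \<Rightarrow> bool" where
  "smooth_map S B X A f \<longleftrightarrow> continuous_map S X f \<and>
     (\<forall>d\<in>B. \<forall>c\<in>A. smooth_on (local_rep d c f) (local_dom d c f))"


section \<open>Vector fields, metrics and connections\<close>

text \<open>A geometric object is given by its components in each chart, as functions of the
  coordinates of that chart, subject to the transformation law under the transition
  maps \<open>\<tau>\<close>. Component functions matter on \<open>cdom c\<close> only. The components of a connection are
  \<open>G c x $ i $ j $ k\<close> = $\Gamma_{ij}{}^k$, where
  $\nabla_{\partial_i}\partial_j = \Gamma_{ij}{}^k\partial_k$.\<close>

type_synonym ('a, 'n) vfield = "('a, 'n) chart \<Rightarrow> real^'n \<Rightarrow> real^'n"
type_synonym ('a, 'n) metric = "('a, 'n) chart \<Rightarrow> real^'n \<Rightarrow> real^'n^'n"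
type_synonym ('a, 'n) conn = "('a, 'n) chart \<Rightarrow> real^'n \<Rightarrow> real^'n^'n^'n"

definition vector_field :: "('a, 'n::finite) chart set \<Rightarrow> ('a, 'n) vfield \<Rightarrow> bool" where
  "vector_field A E \<longleftrightarrow>
     (\<forall>c\<in>A. smooth_on (E c) (cdom c)) \<and>
     (\<forall>c\<in>A. \<forall>d\<in>A. \<forall>x\<in>local_dom c d id.
        let \<tau> = local_rep c d id in E d (\<tau> x) = frechet_derivative \<tau> (at x) (E c x))"

definition pseudo_riemannian_metric ::
    "('a, 'n::finite) chart set \<Rightarrow> ('a, 'n) metric \<Rightarrow> bool" where
  "pseudo_riemannian_metric A h \<longleftrightarrow>
     (\<forall>c\<in>A. smooth_on (h c) (cdom c) \<and>
        (\<forall>x\<in>cdom c. transpose (h c x) = h c x \<and> invertible (h c x))) \<and>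
     (\<forall>c\<in>A. \<forall>d\<in>A. \<forall>x\<in>local_dom c d id. \<forall>u v.
        let \<tau> = local_rep c d id; D\<tau> = frechet_derivative \<tau> (at x)
        in D\<tau> u \<bullet> (h d (\<tau> x) *v D\<tau> v) = u \<bullet> (h c x *v v))"

definition chris :: "real^'n^'n^'n \<Rightarrow> real^'n \<Rightarrow> real^'n \<Rightarrow> real^'n" where
  "chris \<Gamma> u v = (\<chi> k. \<Sum>i\<in>UNIV. \<Sum>j\<in>UNIV. \<Gamma> $ i $ j $ k * u $ i * v $ j)"

definition affine_connection :: "('a, 'n::finite) chart set \<Rightarrow> ('a, 'n) conn \<Rightarrow> bool" where
  "affine_connection A G \<longleftrightarrow>
     (\<forall>c\<in>A. smooth_on (G c) (cdom c)) \<and>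
     (\<forall>c\<in>A. \<forall>d\<in>A. \<forall>x\<in>local_dom c d id. \<forall>u v.
        let \<tau> = local_rep c d id; D\<tau> = (\<lambda>y. frechet_derivative \<tau> (at y))
        in frechet_derivative (\<lambda>y. D\<tau> y v) (at x) u + chris (G d (\<tau> x)) (D\<tau> x u) (D\<tau> x v)
             = D\<tau> x (chris (G c x) u v))"

definition torsion_free :: "('a, 'n::finite) chart set \<Rightarrow> ('a, 'n) conn \<Rightarrow> bool" where
  "torsion_free A G \<longleftrightarrow>
     (\<forall>c\<in>A. \<forall>x\<in>cdom c. \<forall>i j k. G c x $ i $ j $ k = G c x $ j $ i $ k)"

definition conn_eq :: "('a, 'n::finite) chart set \<Rightarrow> ('a, 'n) conn \<Rightarrow> ('a, 'n) conn \<Rightarrow> bool" where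
  "conn_eq A G G' \<longleftrightarrow> (\<forall>c\<in>A. \<forall>x\<in>cdom c. G c x = G' c x)"

text \<open>Tensor calculus in a single chart: \<open>G\<close>, \<open>h\<close>, \<open>E\<close>, \<open>Y\<close> are component functions.
  Index order: $\nabla_jY^k$ is \<open>nabla_vec G Y x j k\<close>; $\nabla_i\nabla_jY^k$ is
  \<open>nabla2_vec G Y x i j k\<close>; $\nabla_ih_{jk}$ is \<open>nabla_metric G h x i j k\<close>.\<close>

definition nabla_vec ::
    "(real^'n \<Rightarrow> real^'n^'n^'n) \<Rightarrow> (real^'n \<Rightarrow> real^'n) \<Rightarrow> real^'n \<Rightarrow> 'n::finite \<Rightarrow> 'n \<Rightarrow> real" where
  "nabla_vec G Y x j k = pd j Y x $ k + (\<Sum>p\<in>UNIV. G x $ j $ p $ k * Y x $ p)"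

definition nabla2_vec ::
    "(real^'n \<Rightarrow> real^'n^'n^'n) \<Rightarrow> (real^'n \<Rightarrow> real^'n) \<Rightarrow> real^'n \<Rightarrow> 'n::finite \<Rightarrow> 'n \<Rightarrow> 'n \<Rightarrow> real"
    where
  "nabla2_vec G Y x i j k =
     pd i (\<lambda>y. nabla_vec G Y y j k) x
     - (\<Sum>p\<in>UNIV. G x $ i $ j $ p * nabla_vec G Y x p k)
     + (\<Sum>p\<in>UNIV. G x $ i $ p $ k * nabla_vec G Y x j p)"

definition nabla_metric ::
    "(real^'n \<Rightarrow> real^'n^'n^'n) \<Rightarrow> (real^'n \<Rightarrow> real^'n^'n) \<Rightarrow> real^'n \<Rightarrow> 'n::finite \<Rightarrow> 'n \<Rightarrow> 'n \<Rightarrow> real"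
    where
  "nabla_metric G h x i j k =
     pd i h x $ j $ k
     - (\<Sum>p\<in>UNIV. G x $ i $ j $ p * h x $ p $ k)
     - (\<Sum>p\<in>UNIV. G x $ i $ k $ p * h x $ j $ p)"

definition lie_metric ::
    "(real^'n \<Rightarrow> real^'n) \<Rightarrow> (real^'n \<Rightarrow> real^'n^'n) \<Rightarrow> real^'n \<Rightarrow> 'n::finite \<Rightarrow> 'n \<Rightarrow> real" where
  "lie_metric E h x i j =
     (\<Sum>p\<in>UNIV. E x $ p * pd p h x $ i $ j)
     + (\<Sum>p\<in>UNIV. h x $ p $ j * pd i E x $ p)
     + (\<Sum>p\<in>UNIV. h x $ i $ p * pd j E x $ p)"

text \<open>\<open>riem G x i j p k\<close> is $R_{ijp}{}^k$, i.e. $2\nabla_{[i}\nabla_{j]}Y^k$ for the coordinate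
  field $Y = \partial_p$; this determines the tensor, as $2\nabla_{[i}\nabla_{j]}$ is linear over
  functions for torsion-free connections. \<open>riem_low G h x i j k l\<close> is
  $R_{ijkl} = R_{ijk}{}^ph_{pl}$.\<close>

definition riem ::
    "(real^'n \<Rightarrow> real^'n^'n^'n) \<Rightarrow> real^'n \<Rightarrow> 'n::finite \<Rightarrow> 'n \<Rightarrow> 'n \<Rightarrow> 'n \<Rightarrow> real" where
  "riem G x i j p k =
     nabla2_vec G (\<lambda>_. axis p 1) x i j k - nabla2_vec G (\<lambda>_. axis p 1) x j i k"

definition riem_low ::
    "(real^'n \<Rightarrow> real^'n^'n^'n) \<Rightarrow> (real^'n \<Rightarrow> real^'n^'n) \<Rightarrow> real^'n
      \<Rightarrow> 'n::finite \<Rightarrow> 'n \<Rightarrow> 'n \<Rightarrow> 'n \<Rightarrow> real" where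
  "riem_low G h x i j k l = (\<Sum>p\<in>UNIV. riem G x i j k p * h x $ p $ l)"

definition cov :: "(real^'n \<Rightarrow> real^'n^'n^'n) \<Rightarrow> (real^'n \<Rightarrow> real^'n) \<Rightarrow> (real^'n \<Rightarrow> real^'n)
      \<Rightarrow> real^'n \<Rightarrow> real^'n" where
  "cov G X Y = (\<lambda>x. frechet_derivative Y (at x) (X x) + chris (G x) (X x) (Y x))"

definition lie_bracket ::
    "(real^'n \<Rightarrow> real^'n) \<Rightarrow> (real^'n \<Rightarrow> real^'n) \<Rightarrow> real^'n \<Rightarrow> real^'n" where
  "lie_bracket X Y =
     (\<lambda>x. frechet_derivative Y (at x) (X x) - frechet_derivative X (at x) (Y x))"

text \<open>$(\mathfrak L_E\nabla)(X,Y)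
  = [E,\nabla_XY] - \nabla_{[E,X]}Y - \nabla_X[E,Y]$, which is tensorial in \<open>X\<close> and \<open>Y\<close>.\<close>

definition lie_conn :: "(real^'n \<Rightarrow> real^'n) \<Rightarrow> (real^'n \<Rightarrow> real^'n^'n^'n)
      \<Rightarrow> (real^'n \<Rightarrow> real^'n) \<Rightarrow> (real^'n \<Rightarrow> real^'n) \<Rightarrow> real^'n \<Rightarrow> real^'n" where
  "lie_conn E G X Y = (\<lambda>x.
     lie_bracket E (cov G X Y) x - cov G (lie_bracket E X) Y x - cov G X (lie_bracket E Y) x)"

definition levi_civita ::
    "('a, 'n::finite) chart set \<Rightarrow> ('a, 'n) metric \<Rightarrow> ('a, 'n) conn \<Rightarrow> bool" where
  "levi_civita A h D \<longleftrightarrow> affine_connection A D \<and> torsion_free A D \<and>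
     (\<forall>c\<in>A. \<forall>x\<in>cdom c. \<forall>i j k. nabla_metric (D c) (h c) x i j k = 0)"


section \<open>Radiant statistical structures\<close>

definition radiant_statistical :: "('a, 'n::finite) chart set \<Rightarrow> ('a, 'n) conn \<Rightarrow>
      ('a, 'n) vfield \<Rightarrow> ('a, 'n) metric \<Rightarrow> bool" where
  "radiant_statistical A G E h \<longleftrightarrow>
     affine_connection A G \<and> torsion_free A G \<and> vector_field A E \<and>
     pseudo_riemannian_metric A h \<and>
     (\<forall>c\<in>A. \<forall>x\<in>cdom c. \<forall>i j. nabla_vec (G c) (E c) x i j = (if i = j then 1 else 0)) \<and>
     (\<forall>c\<in>A. \<forall>x\<in>cdom c. \<forall>i j k.
        nabla_metric (G c) (h c) x i j k = nabla_metric (G c) (h c) x j i k) \<and>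
     (\<forall>c\<in>A. \<forall>x\<in>cdom c. \<forall>i j. lie_metric (E c) (h c) x i j = 2 * h c x $ i $ j)"

definition nonsingular :: "('a, 'n::finite) chart set \<Rightarrow> ('a, 'n) vfield \<Rightarrow> bool" where
  "nonsingular A E \<longleftrightarrow> (\<forall>c\<in>A. \<forall>x\<in>cdom c. E c x \<noteq> 0)"

definition conjugate ::
    "('a, 'n::finite) metric \<Rightarrow> ('a, 'n) conn \<Rightarrow> ('a, 'n) conn" where
  "conjugate h G = (\<lambda>c x. \<chi> i j k.
     G c x $ i $ j $ k
     + (\<Sum>p\<in>UNIV. matrix_inv (h c x) $ k $ p * nabla_metric (G c) (h c) x i j p))"

definition invariant_conn ::
    "('a, 'n::finite) chart set \<Rightarrow> ('a, 'n) vfield \<Rightarrow> ('a, 'n) conn \<Rightarrow> bool" where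
  "invariant_conn A E G \<longleftrightarrow>
     (\<forall>c\<in>A. \<forall>x\<in>cdom c. \<forall>i j.
        lie_conn (E c) (G c) (\<lambda>_. axis i 1) (\<lambda>_. axis j 1) x = 0)"

text \<open>$E^pR_{pijk} = 0$.\<close>

definition radial_curvature_zero :: "('a, 'n::finite) chart set \<Rightarrow> ('a, 'n) vfield \<Rightarrow>
      ('a, 'n) metric \<Rightarrow> ('a, 'n) conn \<Rightarrow> bool" where
  "radial_curvature_zero A E h G \<longleftrightarrow>
     (\<forall>c\<in>A. \<forall>x\<in>cdom c. \<forall>i j k.
        (\<Sum>p\<in>UNIV. E c x $ p * riem_low (G c) (h c) x p i j k) = 0)"

definition concurrent ::
    "('a, 'n::finite) chart set \<Rightarrow> ('a, 'n) metric \<Rightarrow> ('a, 'n) vfield \<Rightarrow> bool" where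
  "concurrent A h E \<longleftrightarrow>
     (\<exists>D. levi_civita A h D \<and>
        (\<forall>c\<in>A. \<forall>x\<in>cdom c. \<forall>i j. nabla_vec (D c) (E c) x i j = (if i = j then 1 else 0)))"


section \<open>Planelike surfaces\<close>

text \<open>The points of an abstract surface are taken from the type \<open>real^2\<close>, which is used merely as
  a set of the cardinality of the continuum: the topology \<open>S\<close> and the atlas \<open>B\<close> are arbitrary, so up
  to diffeomorphism every connected 2-manifold occurs.\<close>

definition immersed_surface :: "'a topology \<Rightarrow> ('a, 'n::finite) chart set \<Rightarrow>
      (real^2) topology \<Rightarrow> (real^2, 2) chart set \<Rightarrow> (real^2 \<Rightarrow> 'a) \<Rightarrow> bool" where
  "immersed_surface X A S B f \<longleftrightarrow>
     smooth_manifold S B \<and> smooth_map S B X A f \<and>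
     (\<forall>d\<in>B. \<forall>c\<in>A. \<forall>s\<in>local_dom d c f. inj (frechet_derivative (local_rep d c f) (at s)))"

text \<open>With \<open>F\<close> the expression of the immersion in charts, the covariant derivative along \<open>F\<close>, in the
  direction \<open>v\<close>, of the tangent field \<open>dF(w)\<close> (\<open>w\<close> constant) is \<open>\<partial>\<^sub>v(dF(w)) + \<Gamma>(dF(v), dF(w))\<close>.
  The immersion is totally geodesic if these are tangent, i.e. \<open>\<nabla>\<^sub>VW\<close> is tangent
  for all tangent \<open>V, W\<close>.\<close>

definition totally_geodesic :: "('a, 'n::finite) chart set \<Rightarrow> ('a, 'n) conn \<Rightarrow>
      (real^2, 2) chart set \<Rightarrow> (real^2 \<Rightarrow> 'a) \<Rightarrow> bool" where
  "totally_geodesic A G B f \<longleftrightarrow>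
     (\<forall>d\<in>B. \<forall>c\<in>A. \<forall>s\<in>local_dom d c f. \<forall>v w.
        let F = local_rep d c f; DF = (\<lambda>t. frechet_derivative F (at t))
        in frechet_derivative (\<lambda>t. DF t w) (at s) v + chris (G c (F s)) (DF s v) (DF s w)
             \<in> range (DF s))"

definition tangent_to :: "('a, 'n::finite) chart set \<Rightarrow> ('a, 'n) vfield \<Rightarrow>
      (real^2, 2) chart set \<Rightarrow> (real^2 \<Rightarrow> 'a) \<Rightarrow> bool" where
  "tangent_to A E B f \<longleftrightarrow>
     (\<forall>d\<in>B. \<forall>c\<in>A. \<forall>s\<in>local_dom d c f.
        let F = local_rep d c f in E c (F s) \<in> range (frechet_derivative F (at s)))"

definition planelike :: "('a, 'n::finite) chart set \<Rightarrow> ('a, 'n) conn \<Rightarrow> ('a, 'n) vfield \<Rightarrow>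
      (real^2, 2) chart set \<Rightarrow> (real^2 \<Rightarrow> 'a) \<Rightarrow> bool" where
  "planelike A G E B f \<longleftrightarrow> totally_geodesic A G B f \<and> tangent_to A E B f"

text \<open>The tangent space at \<open>p\<close> is identified with \<open>real^'n\<close> by means of a chart \<open>c\<close> around \<open>p\<close>;
  \<open>q\<close> is a point of the surface over \<open>p\<close>, and \<open>d\<close> a chart of the surface around \<open>q\<close>.\<close>

definition conelike :: "'a topology \<Rightarrow> ('a, 'n::finite) chart set \<Rightarrow> ('a, 'n) conn \<Rightarrow>
      ('a, 'n) vfield \<Rightarrow> bool" where
  "conelike X A G E \<longleftrightarrow>
     (\<forall>c\<in>A. \<forall>p\<in>fst c. \<forall>L. subspace L \<and> dim L = 2 \<and> E c (snd c p) \<in> L \<longrightarrow>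
        (\<exists>S B f. immersed_surface X A S B f \<and> planelike A G E B f \<and>
           (\<exists>d\<in>B. \<exists>q\<in>fst d. f q = p \<and>
              range (frechet_derivative (local_rep d c f) (at (snd d q))) = L)))"

definition same_planelike_surfaces :: "'a topology \<Rightarrow> ('a, 'n::finite) chart set \<Rightarrow>
      ('a, 'n) conn \<Rightarrow> ('a, 'n) conn \<Rightarrow> ('a, 'n) vfield \<Rightarrow> bool" where
  "same_planelike_surfaces X A G G' E \<longleftrightarrow>
     (\<forall>S B f. immersed_surface X A S B f \<longrightarrow> (planelike A G E B f \<longleftrightarrow> planelike A G' E B f))"

end

theory Submission imports Defs begin

text \<open>For the radial curvature \<open>T(u,v) = R(E,u)v\<close> one finds that \<open>T\<close> equals the Lie derivative of the
  connection along \<open>E\<close>, that \<open>T(E,\<cdot>) = 0\<close>, and that \<open>h(T(u,v),w)\<close> is totally symmetric and changes sign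
  under conjugation. The Gauss equation on planelike surfaces gives \<open>T(v,v) \<in> span {E, v}\<close>, and
  a symmetric cubic form with these properties vanishes wherever \<open>h(E,E) \<noteq> 0\<close>, hence, as this
  set is dense, everywhere. The difference of the two connections has the same
  algebraic properties when the planelike surfaces agree. Conversely, if \<open>E\<close> is affine, its flow maps
  geodesics to geodesics, and flowing a geodesic along \<open>E\<close> sweeps out a planelike surface.
  On the tangent bundle this means that the geodesic spray commutes with the lift of \<open>E\<close>.\<close>

section \<open>Calculus of smooth maps\<close>

text \<open>\<open>CARD('n) \<noteq> 2\<close> is where the geometry enters: in dimension 2 the only
  plane is the whole tangent space, so being conelike says nothing, and the complement of
  \<open>E\<close> is a line without a pair of orthogonal vectors to compare. In dimension 1 that
  complement is zero. As \<open>h\<close> may be indefinite, splitting off \<open>E\<close> fails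
  where \<open>E\<close> is null; this is why the pointwise algebra is followed by a continuity
  argument, and why vectors \<open>X\<close> that are null themselves are reached from non-null
  ones. Since the curvatures of the two connections are adjoint up to sign, conelikeness of one of
  the two structures already makes both radially flat. For the converse, affinity of
  \<open>E\<close> enters only through the commutator of spray and lift, which is vertical and
  equals \<open>R(E,P)P\<close> up to sign. The two parameters of the surface are the times of these
  commuting fields, so the surface is differentiable in both at once. Its smoothness follows from
  the differential equations themselves, which express the derivatives of position and velocity by
  position and velocity.\<close>

abbreviation dd :: "('a::real_normed_vector \<Rightarrow> 'b::real_normed_vector) \<Rightarrow> 'a \<Rightarrow> 'a \<Rightarrow> 'b" where
  "dd f x \<equiv> frechet_derivative f (at x)"

lemma has_derivative_dd: "f differentiable at x \<Longrightarrow> (f has_derivative dd f x) (at x)"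
  by (simp add: frechet_derivative_works)

lemma dd_eqI: "(f has_derivative f') (at x) \<Longrightarrow> dd f x = f'"
  by (metis frechet_derivative_at)

lemma has_derivative_cong_open:
  assumes "open S" "x \<in> S" "\<And>y. y \<in> S \<Longrightarrow> f y = g y"
  shows "(f has_derivative f') (at x) \<longleftrightarrow> (g has_derivative f') (at x)"
  using assms has_derivative_transform_within_open[of f f' x UNIV S g]
    has_derivative_transform_within_open[of g f' x UNIV S f] by auto

lemma dd_cong_open:
  assumes "open S" "x \<in> S" "\<And>y. y \<in> S \<Longrightarrow> f y = g y"
  shows "dd f x = dd g x"
  unfolding frechet_derivative_def using has_derivative_cong_open[OF assms] by simp

lemma differentiable_cong_open:
  assumes "open S" "x \<in> S" "\<And>y. y \<in> S \<Longrightarrow> f y = g y"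
  shows "f differentiable at x \<longleftrightarrow> g differentiable at x"
  unfolding differentiable_def using has_derivative_cong_open[OF assms] by simp

lemma higher_differentiable_on_cong:
  assumes "open S" "\<And>y. y \<in> S \<Longrightarrow> f y = g y"
  shows "higher_differentiable_on k f S \<longleftrightarrow> higher_differentiable_on k g S"
  using assms(2)
proof (induction k arbitrary: f g)
  case 0
  then show ?case by (simp cong: continuous_on_cong)
next
  case (Suc k)
  have "higher_differentiable_on k (\<lambda>x. dd f x v) S \<longleftrightarrow> higher_differentiable_on k (\<lambda>x. dd g x v) S" for v
    by (rule Suc.IH) (use dd_cong_open[OF assms(1) _ Suc.prems] in simp)
  then show ?case
    using differentiable_cong_open[OF assms(1) _ Suc.prems] by simp
qed

section \<open>Stability of k-fold differentiability under algebra and composition\<close>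

lemma higher_differentiable_on_subset:
  "higher_differentiable_on k f S \<Longrightarrow> T \<subseteq> S \<Longrightarrow> higher_differentiable_on k f T"
  by (induction k arbitrary: f) (auto intro: continuous_on_subset)

lemma pointwise_differentiable_imp_continuous_on:
  assumes "\<forall>x\<in>S. f differentiable (at x)"
  shows "continuous_on S f"
  using assms by (meson continuous_at_imp_continuous_on differentiable_imp_continuous_within)

lemma higher_differentiable_on_SucD:
  "higher_differentiable_on (Suc k) f S \<Longrightarrow> higher_differentiable_on k f S"
  by (induction k arbitrary: f) (auto intro: pointwise_differentiable_imp_continuous_on)

lemma higher_differentiable_on_const: "open S \<Longrightarrow> higher_differentiable_on k (\<lambda>x. c) S"
  by (induction k arbitrary: c) auto

lemma higher_differentiable_on_linear:
  assumes "bounded_linear L" "open S" "higher_differentiable_on k f S"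
  shows "higher_differentiable_on k (\<lambda>x. L (f x)) S"
  using assms(3)
proof (induction k arbitrary: f)
  case 0
  then show ?case by (simp add: bounded_linear.continuous_on[OF assms(1)])
next
  case (Suc k)
  have hd: "((\<lambda>x. L (f x)) has_derivative (\<lambda>v. L (dd f x v))) (at x)" if "x \<in> S" for x
    using Suc.prems that by (intro bounded_linear.has_derivative[OF assms(1)] has_derivative_dd) auto
  have "higher_differentiable_on k (\<lambda>x. dd (\<lambda>x. L (f x)) x v) S" for v
  proof -
    have "higher_differentiable_on k (\<lambda>x. L (dd f x v)) S"
      using Suc by auto
    then show ?thesis
      by (subst higher_differentiable_on_cong[OF assms(2)]) (auto simp: dd_eqI[OF hd])
  qed
  then show ?case using hd by (auto simp: differentiable_def)
qed

lemma higher_differentiable_on_add: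
  assumes "open S" "higher_differentiable_on k f S" "higher_differentiable_on k g S"
  shows "higher_differentiable_on k (\<lambda>x. f x + g x) S"
  using assms(2,3)
proof (induction k arbitrary: f g)
  case 0
  then show ?case by (simp add: continuous_on_add)
next
  case (Suc k)
  have hd: "((\<lambda>x. f x + g x) has_derivative (\<lambda>v. dd f x v + dd g x v)) (at x)" if "x \<in> S" for x
    using Suc.prems that by (intro has_derivative_add has_derivative_dd) auto
  have "higher_differentiable_on k (\<lambda>x. dd (\<lambda>x. f x + g x) x v) S" for v
  proof -
    have "higher_differentiable_on k (\<lambda>x. dd f x v + dd g x v) S"
      using Suc by auto
    then show ?thesis
      by (subst higher_differentiable_on_cong[OF assms(1)]) (auto simp: dd_eqI[OF hd])
  qed
  then show ?case using hd by (auto simp: differentiable_def)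
qed

lemma higher_differentiable_on_bilinear:
  assumes "bounded_bilinear B" "open S" "higher_differentiable_on k f S" "higher_differentiable_on k g S"
  shows "higher_differentiable_on k (\<lambda>x. B (f x) (g x)) S"
  using assms(3,4)
proof (induction k arbitrary: f g)
  case 0
  then show ?case by (simp add: bounded_bilinear.continuous_on[OF assms(1)])
next
  case (Suc k)
  have hd: "((\<lambda>x. B (f x) (g x)) has_derivative (\<lambda>v. B (f x) (dd g x v) + B (dd f x v) (g x))) (at x)"
    if "x \<in> S" for x
    using Suc.prems that by (intro bounded_bilinear.FDERIV[OF assms(1)] has_derivative_dd) auto
  have "higher_differentiable_on k (\<lambda>x. dd (\<lambda>x. B (f x) (g x)) x v) S" for v
  proof -
    \<comment> \<open>In each summand one factor is left undifferentiated; it has one derivative to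
      spare and is lowered to order \<open>k\<close>.\<close>
    have "higher_differentiable_on k (\<lambda>x. B (f x) (dd g x v) + B (dd f x v) (g x)) S"
      using Suc higher_differentiable_on_SucD[OF Suc.prems(1)] higher_differentiable_on_SucD[OF Suc.prems(2)]
      by (intro higher_differentiable_on_add assms(2) Suc.IH) auto
    then show ?thesis
      by (subst higher_differentiable_on_cong[OF assms(2)]) (auto simp: dd_eqI[OF hd])
  qed
  then show ?case using hd by (auto simp: differentiable_def)
qed

lemma higher_differentiable_on_sum:
  assumes "open S" "\<And>i. i \<in> I \<Longrightarrow> higher_differentiable_on k (f i) S"
  shows "higher_differentiable_on k (\<lambda>x. \<Sum>i\<in>I. f i x) S"
  using assms(2)
  by (induction I rule: infinite_finite_induct)
    (auto intro: higher_differentiable_on_const higher_differentiable_on_add assms(1))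

text \<open>\<open>smooth_on\<close> controls derivatives in fixed directions only. A direction that
  moves with the point is reduced to finitely many fixed ones with scalar coefficients; hence the
  Euclidean domain.\<close>

lemma dd_eq_sum_Basis:
  fixes f :: "'a::euclidean_space \<Rightarrow> 'b::real_normed_vector"
  assumes "f differentiable at x"
  shows "dd f x v = (\<Sum>b\<in>Basis. (v \<bullet> b) *\<^sub>R dd f x b)"
proof -
  interpret linear "dd f x" by (rule linear_frechet_derivative[OF assms])
  have "dd f x v = dd f x (\<Sum>b\<in>Basis. (v \<bullet> b) *\<^sub>R b)" by (simp add: euclidean_representation)
  then show ?thesis by (simp add: sum scaleR)
qed

text \<open>The chain rule differentiates \<open>g\<close> in the moving direction
  \<open>dd f x v\<close>. Expanded along \<open>Basis\<close>, this is a sum of scalar functions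
  times derivatives of \<open>g\<close> in fixed directions composed with \<open>f\<close>, and to
  these the induction hypothesis applies, since it is general in \<open>g\<close>.\<close>

lemma higher_differentiable_on_compose:
  fixes g :: "'b::euclidean_space \<Rightarrow> 'c::real_normed_vector"
    and f :: "'a::real_normed_vector \<Rightarrow> 'b"
  assumes "open S" "open T" "f ` S \<subseteq> T"
    and "higher_differentiable_on k g T" "higher_differentiable_on k f S"
  shows "higher_differentiable_on k (\<lambda>x. g (f x)) S"
  using assms(4,5)
proof (induction k arbitrary: g)
  case 0
  then show ?case using assms(3) by (auto intro: continuous_on_compose2)
next
  case (Suc k)
  have fT: "f x \<in> T" if "x \<in> S" for x using that assms(3) by auto
  have hd: "((\<lambda>x. g (f x)) has_derivative (\<lambda>v. dd g (f x) (dd f x v))) (at x)" if "x \<in> S" for x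
    using Suc.prems that fT[OF that]
    by (intro has_derivative_compose[where g = g and f = f] has_derivative_dd) auto
  have "higher_differentiable_on k (\<lambda>x. dd (\<lambda>x. g (f x)) x v) S" for v
  proof -
    have 1: "higher_differentiable_on k (\<lambda>x. (dd f x v \<bullet> b) *\<^sub>R dd g (f x) b) S" for b
      using Suc.prems
      by (intro higher_differentiable_on_bilinear[OF bounded_bilinear_scaleR assms(1)]
          higher_differentiable_on_linear[OF bounded_linear_inner_left assms(1)] Suc.IH
          higher_differentiable_on_SucD[OF Suc.prems(2)]) auto
    have 2: "higher_differentiable_on k (\<lambda>x. \<Sum>b\<in>Basis. (dd f x v \<bullet> b) *\<^sub>R dd g (f x) b) S"
      by (rule higher_differentiable_on_sum[OF assms(1) 1])
    have 3: "dd (\<lambda>x. g (f x)) x v = (\<Sum>b\<in>Basis. (dd f x v \<bullet> b) *\<^sub>R dd g (f x) b)" if "x \<in> S" for x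
    proof -
      have "g differentiable at (f x)" using Suc.prems fT[OF that] by auto
      from dd_eq_sum_Basis[OF this] show ?thesis
        unfolding dd_eqI[OF hd[OF that]] .
    qed
    show ?thesis
      using 2 by (subst higher_differentiable_on_cong[OF assms(1) 3])
  qed
  then show ?case using hd by (auto simp: differentiable_def)
qed

text \<open>The derivative of the inverse is a polynomial in the inverse, so the induction feeds on
  itself.\<close>

lemma higher_differentiable_on_inverse:
  assumes "open S" "0 \<notin> S"
  shows "higher_differentiable_on k (inverse :: real \<Rightarrow> real) S"
proof (induction k)
  case 0
  then show ?case using assms(2) by (auto intro!: continuous_intros)
next
  case (Suc k)
  have hd: "((inverse::real\<Rightarrow>real) has_derivative (\<lambda>v. - (inverse x * v * inverse x))) (at x)"
    if "x \<in> S" for x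
    using that assms(2) by (auto intro!: derivative_eq_intros)
  have "higher_differentiable_on k (\<lambda>x. dd (inverse::real\<Rightarrow>real) x v) S" for v
  proof -
    have "higher_differentiable_on k (\<lambda>x. (-v) *\<^sub>R (inverse x * inverse x)) S"
      by (intro higher_differentiable_on_linear[OF bounded_linear_scaleR_right]
          higher_differentiable_on_bilinear[OF bounded_bilinear_mult] Suc assms(1))
    then show ?thesis
      by (subst higher_differentiable_on_cong[OF assms(1)]) (auto simp: dd_eqI[OF hd] ac_simps)
  qed
  then show ?case using hd by (auto simp: differentiable_def)
qed

section \<open>Calculus rules for smooth maps\<close>

lemma smooth_on_cong:
  "open S \<Longrightarrow> (\<And>y. y \<in> S \<Longrightarrow> f y = g y) \<Longrightarrow> smooth_on f S \<longleftrightarrow> smooth_on g S"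
  unfolding smooth_on_def using higher_differentiable_on_cong by blast

lemma smooth_on_subset: "smooth_on f S \<Longrightarrow> T \<subseteq> S \<Longrightarrow> smooth_on f T"
  unfolding smooth_on_def using higher_differentiable_on_subset by blast

lemma smooth_on_differentiable: "smooth_on f S \<Longrightarrow> x \<in> S \<Longrightarrow> f differentiable at x"
  unfolding smooth_on_def by (metis higher_differentiable_on.simps(2))

lemma smooth_on_has_derivative: "smooth_on f S \<Longrightarrow> x \<in> S \<Longrightarrow> (f has_derivative dd f x) (at x)"
  by (intro has_derivative_dd smooth_on_differentiable)

lemma smooth_on_continuous_on: "smooth_on f S \<Longrightarrow> continuous_on S f"
  unfolding smooth_on_def by (metis higher_differentiable_on.simps(1))

lemma smooth_on_dd: "smooth_on f S \<Longrightarrow> smooth_on (\<lambda>x. dd f x v) S"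
  unfolding smooth_on_def by (metis higher_differentiable_on.simps(2))

lemma smooth_on_linear_dd: "smooth_on f S \<Longrightarrow> x \<in> S \<Longrightarrow> linear (dd f x)"
  by (intro linear_frechet_derivative smooth_on_differentiable)

lemma smooth_on_const [simp]: "open S \<Longrightarrow> smooth_on (\<lambda>x. c) S"
  unfolding smooth_on_def using higher_differentiable_on_const by blast

lemma smooth_on_linear:
  "bounded_linear L \<Longrightarrow> open S \<Longrightarrow> smooth_on f S \<Longrightarrow> smooth_on (\<lambda>x. L (f x)) S"
  unfolding smooth_on_def using higher_differentiable_on_linear by blast

lemma smooth_on_add: "open S \<Longrightarrow> smooth_on f S \<Longrightarrow> smooth_on g S \<Longrightarrow> smooth_on (\<lambda>x. f x + g x) S"
  unfolding smooth_on_def using higher_differentiable_on_add by blast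

lemma smooth_on_minus: "open S \<Longrightarrow> smooth_on f S \<Longrightarrow> smooth_on (\<lambda>x. - f x) S"
  by (rule smooth_on_linear[OF bounded_linear_minus[OF bounded_linear_ident]])

lemma smooth_on_diff: "open S \<Longrightarrow> smooth_on f S \<Longrightarrow> smooth_on g S \<Longrightarrow> smooth_on (\<lambda>x. f x - g x) S"
  using smooth_on_add[of S f "\<lambda>x. - g x"] smooth_on_minus[of S g] by simp

lemma smooth_on_bilinear:
  "bounded_bilinear B \<Longrightarrow> open S \<Longrightarrow> smooth_on f S \<Longrightarrow> smooth_on g S \<Longrightarrow> smooth_on (\<lambda>x. B (f x) (g x)) S"
  unfolding smooth_on_def using higher_differentiable_on_bilinear by blast

lemma smooth_on_sum:
  "open S \<Longrightarrow> (\<And>i. i \<in> I \<Longrightarrow> smooth_on (f i) S) \<Longrightarrow> smooth_on (\<lambda>x. \<Sum>i\<in>I. f i x) S"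
  unfolding smooth_on_def by (intro allI higher_differentiable_on_sum) auto

lemma smooth_on_compose:
  fixes g :: "'b::euclidean_space \<Rightarrow> 'c::real_normed_vector"
  shows "open S \<Longrightarrow> open T \<Longrightarrow> f ` S \<subseteq> T \<Longrightarrow> smooth_on g T \<Longrightarrow> smooth_on f S \<Longrightarrow> smooth_on (\<lambda>x. g (f x)) S"
  unfolding smooth_on_def using higher_differentiable_on_compose by blast

lemma smooth_on_ident: "open S \<Longrightarrow> smooth_on (\<lambda>x. x) S"
  unfolding smooth_on_def
proof
  fix k assume "open S"
  then show "higher_differentiable_on k (\<lambda>x. x) S"
    by (cases k) (auto intro: higher_differentiable_on_const continuous_on_id)
qed

lemma smooth_on_bounded_linear: "bounded_linear L \<Longrightarrow> open S \<Longrightarrow> smooth_on L S"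
  using smooth_on_linear[of L S "\<lambda>x. x"] smooth_on_ident by auto

lemma smooth_on_prod:
  fixes f :: "'i \<Rightarrow> 'a::real_normed_vector \<Rightarrow> real"
  assumes "open S" "\<And>i. i \<in> I \<Longrightarrow> smooth_on (f i) S"
  shows "smooth_on (\<lambda>x. \<Prod>i\<in>I. f i x) S"
  using assms(2)
  by (induction I rule: infinite_finite_induct)
    (auto intro!: smooth_on_const smooth_on_bilinear[OF bounded_bilinear_mult] assms(1))

lemma smooth_on_inverse:
  fixes f :: "'a::real_normed_vector \<Rightarrow> real"
  assumes "open S" "smooth_on f S" "\<And>x. x \<in> S \<Longrightarrow> f x \<noteq> 0"
  shows "smooth_on (\<lambda>x. inverse (f x)) S"
proof (rule smooth_on_compose[where T = "- {0}" and f = f and g = inverse])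
  show "smooth_on inverse (- {0::real})"
    unfolding smooth_on_def by (auto intro!: higher_differentiable_on_inverse)
qed (use assms in auto)

section \<open>Vector- and matrix-valued smooth maps\<close>

lemma bounded_linear_axis: "bounded_linear (axis i :: 'b::real_normed_vector \<Rightarrow> 'b^'n::finite)"
proof (rule bounded_linear_intro[where K = 1])
  show "norm (axis i x) \<le> norm x * 1" for x :: 'b
    using L2_set_le_sum[of UNIV "\<lambda>j. norm (axis i x $ j)"]
    by (simp add: norm_vec_def axis_def if_distrib[of norm] cong: if_cong)
qed (simp_all add: vec_eq_iff axis_def)

lemma smooth_on_vec_lambda:
  fixes f :: "'n::finite \<Rightarrow> 'a::real_normed_vector \<Rightarrow> 'b::real_normed_vector"
  assumes "open S" "\<And>i. smooth_on (f i) S"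
  shows "smooth_on (\<lambda>x. \<chi> i. f i x) S"
proof -
  have "smooth_on (\<lambda>x. \<Sum>i\<in>UNIV. axis i (f i x)) S"
    by (intro smooth_on_sum smooth_on_linear[OF bounded_linear_axis] assms)
  also have "(\<lambda>x. \<Sum>i\<in>UNIV. axis i (f i x)) = (\<lambda>x. \<chi> i. f i x)"
    by (auto simp: vec_eq_iff fun_eq_iff axis_def if_distrib cong: if_cong)
  finally show ?thesis .
qed

lemma smooth_on_vec_nth:
  "open S \<Longrightarrow> smooth_on f S \<Longrightarrow> smooth_on (\<lambda>x. f x $ i) S"
  by (rule smooth_on_linear[OF bounded_linear_vec_nth])

lemma smooth_on_det:
  fixes f :: "'a::real_normed_vector \<Rightarrow> real^'n^'n"
  assumes "open S" "\<And>i j. smooth_on (\<lambda>x. f x $ i $ j) S"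
  shows "smooth_on (\<lambda>x. det (f x)) S"
  unfolding det_def
  by (intro smooth_on_sum smooth_on_linear[OF bounded_linear_mult_right] smooth_on_prod assms)

lemma matrix_inv_mult_vec:
  fixes M :: "real^'n^'n"
  assumes "invertible M"
  shows "M *v (matrix_inv M *v b) = b" "matrix_inv M *v (M *v b) = b"
  using assms someI_ex[of "\<lambda>A'. M ** A' = mat 1 \<and> A' ** M = mat 1"]
  by (auto simp: invertible_def matrix_inv_def matrix_vector_mul_assoc)

text \<open>Cramer's rule for \<open>M y = axis p 1\<close>, whose solution is column
  \<open>p\<close> of the inverse: each entry is a quotient of two determinants, hence of
  polynomials in the entries of \<open>f x\<close>.\<close>

lemma smooth_on_matrix_inv:
  fixes f :: "'a::real_normed_vector \<Rightarrow> real^'n^'n"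
  assumes "open S" "smooth_on f S" "\<And>x. x \<in> S \<Longrightarrow> invertible (f x)"
  shows "smooth_on (\<lambda>x. matrix_inv (f x) $ k $ p) S"
proof -
  have d: "det (f x) \<noteq> 0" if "x \<in> S" for x
    using assms(3)[OF that] by (simp add: invertible_det_nz)
  let ?g = "\<lambda>x. det (\<chi> i j. if j = k then (axis p 1 :: real^'n) $ i else f x $ i $ j)"
  have eq: "matrix_inv (f x) $ k $ p = ?g x * inverse (det (f x))" if "x \<in> S" for x
  proof -
    have "f x *v (matrix_inv (f x) *v axis p 1) = axis p 1"
      using matrix_inv_mult_vec assms(3)[OF that] by blast
    then have "matrix_inv (f x) *v axis p 1 =
        (\<chi> k. det (\<chi> i j. if j = k then (axis p 1 :: real^'n) $ i else f x $ i $ j) / det (f x))"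
      using cramer[OF d[OF that]] by blast
    then have "(matrix_inv (f x) *v axis p 1) $ k = ?g x / det (f x)"
      by simp
    then show ?thesis by (simp add: matrix_vector_mult_basis column_def field_simps)
  qed
  have c: "smooth_on (\<lambda>x. f x $ i $ j) S" for i j
    by (intro smooth_on_vec_nth assms)
  have m: "smooth_on (\<lambda>x. if j = k then (axis p 1 :: real^'n) $ i else f x $ i $ j) S" for i j
    using c assms(1) by (cases "j = k") simp_all
  have g: "smooth_on ?g S"
    by (intro smooth_on_det[OF assms(1)]) (simp only: vec_lambda_beta m)
  have "smooth_on (\<lambda>x. ?g x * inverse (det (f x))) S"
    by (rule smooth_on_bilinear[OF bounded_bilinear_mult assms(1) g])
      (intro smooth_on_inverse smooth_on_det c d assms)
  then show ?thesis by (subst smooth_on_cong[OF assms(1) eq])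
qed

subsection \<open>Symmetry of second derivatives\<close>

text \<open>Mean value theorem twice: along \<open>u\<close> for the increment of \<open>f\<close>
  in direction \<open>v\<close>, then along \<open>v\<close> for the derivative of \<open>f\<close>
  in direction \<open>u\<close>. The second difference is symmetric in \<open>u\<close> and
  \<open>v\<close> while its expression by a derivative is not; this is the source of the symmetry
  of second derivatives.\<close>

lemma mixed_difference:
  fixes f :: "'a::real_normed_vector \<Rightarrow> real"
  assumes U: "\<And>\<sigma> \<tau>. 0 \<le> \<sigma> \<Longrightarrow> \<sigma> \<le> s \<Longrightarrow> 0 \<le> \<tau> \<Longrightarrow> \<tau> \<le> s \<Longrightarrow> x + \<sigma> *\<^sub>R u + \<tau> *\<^sub>R v \<in> U"
    and f: "\<And>y. y \<in> U \<Longrightarrow> f differentiable at y"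
    and fu: "\<And>y. y \<in> U \<Longrightarrow> (\<lambda>y. dd f y u) differentiable at y"
    and s: "s > 0"
  obtains \<sigma> \<tau> where "0 < \<sigma>" "\<sigma> < s" "0 < \<tau>" "\<tau> < s"
    "f (x + s *\<^sub>R u + s *\<^sub>R v) - f (x + s *\<^sub>R u) - f (x + s *\<^sub>R v) + f x
      = s * s * dd (\<lambda>y. dd f y u) (x + \<sigma> *\<^sub>R u + \<tau> *\<^sub>R v) v"
proof -
  let ?\<phi> = "\<lambda>\<sigma>. f (x + \<sigma> *\<^sub>R u + s *\<^sub>R v) - f (x + \<sigma> *\<^sub>R u)"
  have in1: "x + \<sigma> *\<^sub>R u + s *\<^sub>R v \<in> U" "x + \<sigma> *\<^sub>R u \<in> U" if "0 \<le> \<sigma>" "\<sigma> \<le> s" for \<sigma>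
    using U[of \<sigma> s] U[of \<sigma> 0] that s by auto
  have lin: "linear (dd f y)" if "y \<in> U" for y by (rule linear_frechet_derivative[OF f[OF that]])
  have 1: "(?\<phi> has_derivative (\<lambda>r. r * (dd f (x + \<sigma> *\<^sub>R u + s *\<^sub>R v) u - dd f (x + \<sigma> *\<^sub>R u) u))) (at \<sigma>)"
    if "0 \<le> \<sigma>" "\<sigma> \<le> s" for \<sigma>
  proof -
    have "((\<lambda>\<sigma>. f (x + \<sigma> *\<^sub>R u + s *\<^sub>R v)) has_derivative (\<lambda>r. dd f (x + \<sigma> *\<^sub>R u + s *\<^sub>R v) (r *\<^sub>R u))) (at \<sigma>)"
      by (rule has_derivative_compose[where g = f and f = "\<lambda>\<sigma>. x + \<sigma> *\<^sub>R u + s *\<^sub>R v"])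
        (auto intro!: derivative_eq_intros has_derivative_dd f in1 that)
    moreover have "((\<lambda>\<sigma>. f (x + \<sigma> *\<^sub>R u)) has_derivative (\<lambda>r. dd f (x + \<sigma> *\<^sub>R u) (r *\<^sub>R u))) (at \<sigma>)"
      by (rule has_derivative_compose[where g = f and f = "\<lambda>\<sigma>. x + \<sigma> *\<^sub>R u"])
        (auto intro!: derivative_eq_intros has_derivative_dd f in1 that)
    ultimately show ?thesis
      using lin[OF in1(1)[OF that]] lin[OF in1(2)[OF that]]
      by (auto intro!: derivative_eq_intros simp: linear_cmul algebra_simps)
  qed
  obtain \<sigma> where \<sigma>: "0 < \<sigma>" "\<sigma> < s"
    "?\<phi> s - ?\<phi> 0 = (s - 0) * (dd f (x + \<sigma> *\<^sub>R u + s *\<^sub>R v) u - dd f (x + \<sigma> *\<^sub>R u) u)"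
  proof -
    have "\<exists>\<sigma>\<in>{0<..<s}. ?\<phi> s - ?\<phi> 0 = (s - 0) * (dd f (x + \<sigma> *\<^sub>R u + s *\<^sub>R v) u - dd f (x + \<sigma> *\<^sub>R u) u)"
      by (rule mvt_simple[OF s, of ?\<phi> "\<lambda>\<sigma> r. r * (dd f (x + \<sigma> *\<^sub>R u + s *\<^sub>R v) u - dd f (x + \<sigma> *\<^sub>R u) u)"])
        (rule has_derivative_at_withinI[OF 1])
    then show ?thesis by (elim bexE) (rule that, auto)
  qed
  let ?\<psi> = "\<lambda>\<tau>. dd f (x + \<sigma> *\<^sub>R u + \<tau> *\<^sub>R v) u"
  have in2: "x + \<sigma> *\<^sub>R u + \<tau> *\<^sub>R v \<in> U" if "0 \<le> \<tau>" "\<tau> \<le> s" for \<tau>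
    using U[of \<sigma> \<tau>] that \<sigma> by auto
  have 2: "(?\<psi> has_derivative (\<lambda>r. r * dd (\<lambda>y. dd f y u) (x + \<sigma> *\<^sub>R u + \<tau> *\<^sub>R v) v)) (at \<tau>)"
    if "0 \<le> \<tau>" "\<tau> \<le> s" for \<tau>
  proof -
    have "(?\<psi> has_derivative (\<lambda>r. dd (\<lambda>y. dd f y u) (x + \<sigma> *\<^sub>R u + \<tau> *\<^sub>R v) (r *\<^sub>R v))) (at \<tau>)"
      by (rule has_derivative_compose[where g = "\<lambda>y. dd f y u" and f = "\<lambda>\<tau>. x + \<sigma> *\<^sub>R u + \<tau> *\<^sub>R v"])
        (auto intro!: derivative_eq_intros has_derivative_dd fu in2 that)
    then show ?thesis
      using linear_cmul[OF linear_frechet_derivative[OF fu[OF in2[OF that]]]] by simp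
  qed
  obtain \<tau> where \<tau>: "0 < \<tau>" "\<tau> < s" "?\<psi> s - ?\<psi> 0 = (s - 0) * dd (\<lambda>y. dd f y u) (x + \<sigma> *\<^sub>R u + \<tau> *\<^sub>R v) v"
  proof -
    have "\<exists>\<tau>\<in>{0<..<s}. ?\<psi> s - ?\<psi> 0 = (s - 0) * dd (\<lambda>y. dd f y u) (x + \<sigma> *\<^sub>R u + \<tau> *\<^sub>R v) v"
      by (rule mvt_simple[OF s, of ?\<psi> "\<lambda>\<tau> r. r * dd (\<lambda>y. dd f y u) (x + \<sigma> *\<^sub>R u + \<tau> *\<^sub>R v) v"])
        (rule has_derivative_at_withinI[OF 2])
    then show ?thesis by (elim bexE) (rule that, auto)
  qed
  show ?thesis
    by (rule that[OF \<sigma>(1,2) \<tau>(1,2)]) (use \<sigma>(3) \<tau>(3) in simp)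
qed

lemma second_derivative_symmetric_real:
  fixes f :: "'a::real_normed_vector \<Rightarrow> real"
  assumes "open S" "x \<in> S" "smooth_on f S"
  shows "dd (\<lambda>y. dd f y u) x v = dd (\<lambda>y. dd f y v) x u"
proof (rule ccontr)
  let ?A = "\<lambda>y. dd (\<lambda>y. dd f y u) y v" and ?B = "\<lambda>y. dd (\<lambda>y. dd f y v) y u"
  assume ne: "?A x \<noteq> ?B x"
  \<comment> \<open>Half the gap: the \<open>e\<close>-neighbourhoods of the two values are
    disjoint, while the mean value points below force a common value.\<close>
  define e where "e = \<bar>?A x - ?B x\<bar> / 2"
  have e: "e > 0" using ne by (simp add: e_def)
  have "continuous_on S ?A" "continuous_on S ?B"
    using assms(3) by (auto intro: smooth_on_continuous_on smooth_on_dd)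
  then have "continuous (at x) ?A" "continuous (at x) ?B"
    using assms(1,2) continuous_on_eq_continuous_at by blast+
  then have "\<forall>\<^sub>F y in at x. dist (?A y) (?A x) < e" "\<forall>\<^sub>F y in at x. dist (?B y) (?B x) < e"
    using e by (auto simp: continuous_at tendsto_iff)
  then have "\<forall>\<^sub>F y in nhds x. dist (?A y) (?A x) < e" "\<forall>\<^sub>F y in nhds x. dist (?B y) (?B x) < e"
    using e by (simp_all add: eventually_nhds_conv_at)
  moreover have "\<forall>\<^sub>F y in nhds x. y \<in> S" using assms by (simp add: eventually_nhds_in_open)
  ultimately have "\<forall>\<^sub>F y in nhds x. dist (?A y) (?A x) < e \<and> dist (?B y) (?B x) < e \<and> y \<in> S"
    by eventually_elim auto
  then obtain d where d: "d > 0"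
    "\<And>y. dist y x < d \<Longrightarrow> dist (?A y) (?A x) < e \<and> dist (?B y) (?B x) < e \<and> y \<in> S"
    by (auto simp: eventually_nhds_metric)
  \<comment> \<open>Small enough that the parallelogram with sides \<open>s u\<close> and
    \<open>s v\<close> lies in the ball of radius \<open>d\<close>; the summand 1 covers
    \<open>u = v = 0\<close>.\<close>
  define s where "s = d / (2 * (norm u + norm v + 1))"
  have pos: "norm u + norm v + 1 > 0" by (smt (verit) norm_ge_zero)
  have s: "s > 0" using d pos by (simp add: s_def)
  have U: "x + \<sigma> *\<^sub>R u + \<tau> *\<^sub>R v \<in> ball x d" if "0 \<le> \<sigma>" "\<sigma> \<le> s" "0 \<le> \<tau>" "\<tau> \<le> s" for \<sigma> \<tau>
  proof -
    have "norm (\<sigma> *\<^sub>R u + \<tau> *\<^sub>R v) \<le> \<sigma> * norm u + \<tau> * norm v"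
      using that by (intro norm_triangle_le) auto
    also have "\<dots> \<le> s * norm u + s * norm v"
      using that by (intro add_mono mult_right_mono) auto
    also have "\<dots> < 2 * s * (norm u + norm v + 1)" using s pos
      using mult_nonneg_nonneg[of s "norm u"] mult_nonneg_nonneg[of s "norm v"]
      by (simp add: algebra_simps add_nonneg_pos)
    also have "\<dots> = d" using pos unfolding s_def by (simp add: field_simps)
    finally show ?thesis
      by (metis add.assoc add_diff_cancel_left' dist_commute dist_norm mem_ball)
  qed
  have U': "x + \<sigma> *\<^sub>R v + \<tau> *\<^sub>R u \<in> ball x d" if "0 \<le> \<sigma>" "\<sigma> \<le> s" "0 \<le> \<tau>" "\<tau> \<le> s" for \<sigma> \<tau>
    using U[of \<tau> \<sigma>] that by (simp add: algebra_simps)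
  have sub: "f differentiable at y" "(\<lambda>y. dd f y w) differentiable at y" if "y \<in> ball x d" for y w
  proof -
    have "y \<in> S" using that d by (auto simp: dist_commute)
    then show "f differentiable at y" "(\<lambda>y. dd f y w) differentiable at y"
      using assms(3) smooth_on_dd smooth_on_differentiable by blast+
  qed
  obtain \<sigma> \<tau> where 1: "0 < \<sigma>" "\<sigma> < s" "0 < \<tau>" "\<tau> < s"
    "f (x + s *\<^sub>R u + s *\<^sub>R v) - f (x + s *\<^sub>R u) - f (x + s *\<^sub>R v) + f x
      = s * s * ?A (x + \<sigma> *\<^sub>R u + \<tau> *\<^sub>R v)"
    by (rule mixed_difference[OF U sub(1) sub(2) s])
  obtain \<sigma>' \<tau>' where 2: "0 < \<sigma>'" "\<sigma>' < s" "0 < \<tau>'" "\<tau>' < s"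
    "f (x + s *\<^sub>R v + s *\<^sub>R u) - f (x + s *\<^sub>R v) - f (x + s *\<^sub>R u) + f x
      = s * s * ?B (x + \<sigma>' *\<^sub>R v + \<tau>' *\<^sub>R u)"
    by (rule mixed_difference[OF U' sub(1) sub(2) s])
  have "s * s * ?A (x + \<sigma> *\<^sub>R u + \<tau> *\<^sub>R v) = s * s * ?B (x + \<sigma>' *\<^sub>R v + \<tau>' *\<^sub>R u)"
  proof -
    have "x + s *\<^sub>R u + s *\<^sub>R v = x + s *\<^sub>R v + s *\<^sub>R u" by simp
    then show ?thesis using 1(5) 2(5) by (smt (verit))
  qed
  then have eq: "?A (x + \<sigma> *\<^sub>R u + \<tau> *\<^sub>R v) = ?B (x + \<sigma>' *\<^sub>R v + \<tau>' *\<^sub>R u)" using s by simp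
  have "dist (?A (x + \<sigma> *\<^sub>R u + \<tau> *\<^sub>R v)) (?A x) < e"
    using d(2)[of "x + \<sigma> *\<^sub>R u + \<tau> *\<^sub>R v"] U[of \<sigma> \<tau>] 1 by (simp add: dist_commute)
  moreover have "dist (?B (x + \<sigma>' *\<^sub>R v + \<tau>' *\<^sub>R u)) (?B x) < e"
    using d(2)[of "x + \<sigma>' *\<^sub>R v + \<tau>' *\<^sub>R u"] U'[of \<sigma>' \<tau>'] 2 by (simp add: dist_commute)
  ultimately show False using eq unfolding e_def dist_real_def by (smt (verit) field_sum_of_halves)
qed

lemma dd_linear:
  assumes "bounded_linear L" "f differentiable at x"
  shows "dd (\<lambda>y. L (f y)) x v = L (dd f x v)"
  using bounded_linear.has_derivative[OF assms(1) has_derivative_dd[OF assms(2)]]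
  by (simp add: dd_eqI)

theorem second_derivative_symmetric:
  fixes f :: "'a::real_normed_vector \<Rightarrow> 'b::euclidean_space"
  assumes "open S" "x \<in> S" "smooth_on f S"
  shows "dd (\<lambda>y. dd f y u) x v = dd (\<lambda>y. dd f y v) x u"
proof (rule euclidean_eqI)
  fix b :: 'b assume "b \<in> Basis"
  have L: "bounded_linear (\<lambda>z. z \<bullet> b)" by (rule bounded_linear_inner_left)
  have 1: "dd (\<lambda>y. dd f y w \<bullet> b) x z = dd (\<lambda>y. dd f y w) x z \<bullet> b" for w z
    by (rule dd_linear[OF L]) (use assms smooth_on_dd smooth_on_differentiable in blast)
  have 2: "dd (\<lambda>y. dd (\<lambda>y. f y \<bullet> b) y w) x = dd (\<lambda>y. dd f y w \<bullet> b) x" for w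
    by (rule dd_cong_open[OF assms(1,2)]) (rule dd_linear[OF L smooth_on_differentiable[OF assms(3)]])
  show "dd (\<lambda>y. dd f y u) x v \<bullet> b = dd (\<lambda>y. dd f y v) x u \<bullet> b"
    using second_derivative_symmetric_real[OF assms(1,2) smooth_on_linear[OF L assms(1,3)], of u v]
    unfolding 1[symmetric] 2[symmetric] .
qed

section \<open>Joint flow of two commuting vector fields\<close>

lemma smooth_on_lipschitz:
  fixes f :: "'a::euclidean_space \<Rightarrow> 'b::real_normed_vector"
  assumes "smooth_on f S" "K \<subseteq> S" "compact K" "convex K"
  obtains L where "L \<ge> 0" "\<And>a b. a \<in> K \<Longrightarrow> b \<in> K \<Longrightarrow> norm (f b - f a) \<le> L * norm (b - a)"
proof -
  have "\<exists>B. \<forall>x\<in>K. norm (dd f x b) \<le> B" for b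
  proof -
    have "continuous_on K (\<lambda>x. dd f x b)"
      using continuous_on_subset[OF smooth_on_continuous_on[OF smooth_on_dd[OF assms(1)]] assms(2)] .
    then have "bounded ((\<lambda>x. dd f x b) ` K)"
      using assms(3) by (intro compact_imp_bounded compact_continuous_image)
    then show ?thesis by (auto simp: bounded_iff)
  qed
  then obtain B where B: "\<And>b x. x \<in> K \<Longrightarrow> norm (dd f x b) \<le> B b" by metis
  \<comment> \<open>The operator norm is at most the sum of the norms on \<open>Basis\<close>, so
    boundedness of finitely many directional derivatives suffices.\<close>
  define L where "L = (\<Sum>b\<in>Basis. \<bar>B b\<bar>)"
  have L: "onorm (dd f x) \<le> L" if "x \<in> K" for x
  proof (rule onorm_le)
    fix v
    have "dd f x v = (\<Sum>b\<in>Basis. (v \<bullet> b) *\<^sub>R dd f x b)"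
      using that assms smooth_on_differentiable by (intro dd_eq_sum_Basis) blast
    then have "norm (dd f x v) \<le> (\<Sum>b\<in>Basis. norm ((v \<bullet> b) *\<^sub>R dd f x b))"
      by (simp only: norm_sum)
    also have "\<dots> \<le> (\<Sum>b\<in>Basis. norm v * \<bar>B b\<bar>)"
      using order_trans[OF B[OF that] abs_ge_self] by (intro sum_mono) (auto intro!: mult_mono Basis_le_norm)
    finally show "norm (dd f x v) \<le> L * norm v"
      by (simp add: L_def sum_distrib_left mult.commute)
  qed
  show ?thesis
  proof (rule that)
    show "L \<ge> 0" by (simp add: L_def sum_nonneg)
    show "norm (f b - f a) \<le> L * norm (b - a)" if "a \<in> K" "b \<in> K" for a b
      by (rule differentiable_bound[OF assms(4) _ L that(2,1)])
        (use assms smooth_on_has_derivative in \<open>blast intro: has_derivative_at_withinI\<close>)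
  qed
qed

lemma smooth_on_quadratic_bound:
  fixes f :: "'a::euclidean_space \<Rightarrow> 'b::real_normed_vector"
  assumes "smooth_on f S" "K \<subseteq> S" "compact K" "convex K"
  obtains C where "C \<ge> 0"
    "\<And>a b. a \<in> K \<Longrightarrow> b \<in> K \<Longrightarrow> norm (f b - f a - dd f a (b - a)) \<le> C * (norm (b - a))\<^sup>2"
proof -
  have "\<exists>L. L \<ge> 0 \<and> (\<forall>x\<in>K. \<forall>y\<in>K. norm (dd f y b - dd f x b) \<le> L * norm (y - x))" for b
    using smooth_on_lipschitz[OF smooth_on_dd[OF assms(1)] assms(2-4)] by metis
  then obtain L where L: "\<And>b. L b \<ge> 0"
    "\<And>b x y. x \<in> K \<Longrightarrow> y \<in> K \<Longrightarrow> norm (dd f y b - dd f x b) \<le> L b * norm (y - x)" by metis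
  define C where "C = (\<Sum>b\<in>Basis. L b)"
  have C0: "C \<ge> 0" by (simp add: C_def sum_nonneg L)
  have bd: "onorm (\<lambda>v. dd f y v - dd f x v) \<le> C * norm (y - x)" if "x \<in> K" "y \<in> K" for x y
  proof (rule onorm_le)
    fix v
    have "f differentiable at x" "f differentiable at y"
      using that assms smooth_on_differentiable by blast+
    then have "dd f y v - dd f x v = (\<Sum>b\<in>Basis. (v \<bullet> b) *\<^sub>R (dd f y b - dd f x b))"
      using dd_eq_sum_Basis[of f x v] dd_eq_sum_Basis[of f y v]
      by (simp add: scaleR_diff_right sum_subtractf)
    then have "norm (dd f y v - dd f x v) \<le> (\<Sum>b\<in>Basis. norm ((v \<bullet> b) *\<^sub>R (dd f y b - dd f x b)))"
      by (simp only: norm_sum)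
    also have "\<dots> \<le> (\<Sum>b\<in>Basis. norm v * (L b * norm (y - x)))"
      using L(2)[OF that] by (intro sum_mono) (auto intro!: mult_mono Basis_le_norm)
    also have "\<dots> = C * norm (y - x) * norm v"
      unfolding C_def sum_distrib_right by (intro sum.cong) auto
    finally show "norm (dd f y v - dd f x v) \<le> C * norm (y - x) * norm v" .
  qed
  show ?thesis
  proof (rule that[OF C0])
    fix a b assume ab: "a \<in> K" "b \<in> K"
    \<comment> \<open>The mean value bound is applied to \<open>f\<close> minus its linearization at
      \<open>a\<close>. On this part of \<open>K\<close>, still convex, the derivative of that
      difference is at most \<open>C\<close> times the distance of \<open>a\<close> and
      \<open>b\<close>, which yields the square.\<close>
    let ?K = "K \<inter> cball a (norm (b - a))"
    have bl: "bounded_linear (dd f a)"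
      using ab assms smooth_on_has_derivative has_derivative_bounded_linear by blast
    have "norm ((f b - dd f a b) - (f a - dd f a a)) \<le> (C * norm (b - a)) * norm (b - a)"
    proof (rule differentiable_bound[where S = ?K])
      show "convex ?K" using assms(4) by (simp add: convex_Int)
      show "((\<lambda>x. f x - dd f a x) has_derivative (\<lambda>v. dd f x v - dd f a v)) (at x within ?K)" if "x \<in> ?K" for x
      proof (intro has_derivative_diff)
        show "(f has_derivative dd f x) (at x within ?K)"
          using that assms smooth_on_has_derivative by (blast intro: has_derivative_at_withinI)
        show "(dd f a has_derivative dd f a) (at x within ?K)"
          using bounded_linear.has_derivative[OF bl has_derivative_ident] by simp
      qed
      show "onorm (\<lambda>v. dd f x v - dd f a v) \<le> C * norm (b - a)" if "x \<in> ?K" for x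
        using bd[of a x] that ab C0
        by (auto simp: dist_norm norm_minus_commute intro: order_trans mult_left_mono)
    qed (use ab in \<open>auto simp: dist_norm norm_minus_commute\<close>)
    moreover have "(f b - dd f a b) - (f a - dd f a a) = f b - f a - dd f a (b - a)"
      by (simp add: linear_diff[OF bounded_linear.linear[OF bl]])
    ultimately show "norm (f b - f a - dd f a (b - a)) \<le> C * (norm (b - a))\<^sup>2"
      by (simp add: power2_eq_square mult.assoc)
  qed
qed

section \<open>Ordinary differential equations on a short interval\<close>

lemma vector_derivative_bound:
  fixes f :: "real \<Rightarrow> 'a::real_normed_vector"
  assumes "\<And>t. t \<in> {a..b} \<Longrightarrow> (f has_vector_derivative f' t) (at t within {a..b})"
    and "\<And>t. t \<in> {a..b} \<Longrightarrow> norm (f' t) \<le> B" and "s \<in> {a..b}" "t \<in> {a..b}"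
  shows "norm (f t - f s) \<le> B * \<bar>t - s\<bar>"
proof -
  have "norm (f t - f s) \<le> B * norm (t - s)"
  proof (rule differentiable_bound[where S = "{a..b}" and f' = "\<lambda>t h. h *\<^sub>R f' t"])
    show "onorm (\<lambda>h. h *\<^sub>R f' t) \<le> B" if "t \<in> {a..b}" for t
      using assms(2)[OF that] by (intro onorm_le) (simp add: mult.commute[of B] mult_left_mono)
  qed (use assms in \<open>auto simp: has_vector_derivative_def\<close>)
  then show ?thesis by simp
qed

text \<open>Picard iteration. As \<open>W\<close> is bounded and Lipschitz on the whole space, no
  solution has to be confined to a domain, and the iteration acts on the complete space of bounded
  continuous functions; \<open>L * \<delta> \<le> 1/2\<close> makes it a contraction.\<close>

lemma ode_solution_exists:
  fixes W :: "'a::euclidean_space \<Rightarrow> 'a" and \<delta> :: real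
  assumes L: "L \<ge> 0" "\<And>x y. norm (W y - W x) \<le> L * norm (y - x)"
    and M: "\<And>x. norm (W x) \<le> M" and \<delta>: "\<delta> > 0" "L * \<delta> \<le> 1/2"
  obtains y where "y 0 = x0"
    "\<And>t. t \<in> {-\<delta>..\<delta>} \<Longrightarrow> (y has_vector_derivative W (y t)) (at t within {-\<delta>..\<delta>})"
proof -
  let ?I = "{-\<delta>..\<delta>}"
  have Wc: "continuous_on UNIV W"
  proof (rule continuous_onI)
    fix x :: 'a and e :: real assume e: "0 < e"
    show "\<exists>d>0. \<forall>x'\<in>UNIV. dist x' x < d \<longrightarrow> dist (W x') (W x) \<le> e"
    proof (intro exI conjI ballI impI)
      show "e / (L + 1) > 0" using e L(1) by simp
      fix x' assume "dist x' x < e / (L + 1)"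
      then have "(L + 1) * norm (x' - x) \<le> e" using L(1) by (simp add: field_simps dist_norm)
      moreover have "L * norm (x' - x) \<le> (L + 1) * norm (x' - x)" by (simp add: algebra_simps)
      ultimately show "dist (W x') (W x) \<le> e" using L(2)[of x' x] by (simp add: dist_norm)
    qed
  qed
  \<comment> \<open>The integral starts at the left end of the interval, as the fundamental theorem
    requires; subtracting \<open>J y 0\<close> in \<open>P\<close> moves the initial time to
    0.\<close>
  define J where "J = (\<lambda>(y :: real \<Rightarrow>\<^sub>C 'a) t. integral {-\<delta>..t} (\<lambda>r. W (y r)))"
  have J: "(J y has_vector_derivative W (y t)) (at t within ?I)" if "t \<in> ?I" for y t
    unfolding J_def
    by (rule integral_has_vector_derivative[OF _ that])
      (rule continuous_on_compose2[OF Wc], auto)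
  \<comment> \<open>Clamps time to the interval, so that \<open>P y\<close> is bounded and
    continuous on the whole line.\<close>
  define cl where "cl = (\<lambda>t. max (-\<delta>) (min \<delta> t))"
  have cl: "cl t \<in> ?I" "\<bar>cl t\<bar> \<le> \<delta>" for t using \<delta> by (auto simp: cl_def)
  have cl_id: "cl t = t" if "t \<in> ?I" for t using that by (auto simp: cl_def)
  have 0: "0 \<in> ?I" using \<delta> by simp
  define P where "P = (\<lambda>y t. x0 + (J y (cl t) - J y 0))"
  have PC: "P y \<in> bcontfun" for y
  proof (rule bcontfun_normI)
    have "continuous_on ?I (J y)"
      unfolding continuous_on_eq_continuous_within using J has_vector_derivative_continuous by blast
    then show "continuous_on UNIV (P y)"
      unfolding P_def by (intro continuous_intros continuous_on_compose2[of ?I "J y" UNIV cl])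
        (use cl in \<open>auto simp: cl_def intro!: continuous_intros\<close>)
    show "norm (P y t) \<le> norm x0 + M * \<delta>" for t
    proof -
      have "M \<ge> 0" using M[of 0] norm_ge_zero order_trans by blast
      have "norm (J y (cl t) - J y 0) \<le> M * \<bar>cl t - 0\<bar>"
        by (rule vector_derivative_bound[OF J M 0 cl(1)])
      also have "\<dots> \<le> M * \<delta>" using cl(2) \<open>M \<ge> 0\<close> by (simp add: mult_left_mono)
      finally show ?thesis unfolding P_def by (intro norm_triangle_le) simp
    qed
  qed
  define Q where "Q = (\<lambda>y. Bcontfun (P y))"
  have Q: "apply_bcontfun (Q y) = P y" for y
    unfolding Q_def using PC by (simp add: Bcontfun_inverse)
  have "\<exists>!y. Q y = y"
  proof (rule banach_fix_type[of "1/2"])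
    show "\<forall>y z. dist (Q y) (Q z) \<le> 1/2 * dist y z"
    proof (intro allI)
      fix y z :: "real \<Rightarrow>\<^sub>C 'a"
      show "dist (Q y) (Q z) \<le> 1/2 * dist y z"
      proof (rule dist_bound)
        fix t
        have "norm ((J y (cl t) - J z (cl t)) - (J y 0 - J z 0)) \<le> (L * dist y z) * \<bar>cl t - 0\<bar>"
        proof (rule vector_derivative_bound[OF _ _ 0 cl(1)])
          show "((\<lambda>t. J y t - J z t) has_vector_derivative (W (y t) - W (z t))) (at t within ?I)"
            if "t \<in> ?I" for t
            by (intro has_vector_derivative_diff J that)
          show "norm (W (y t) - W (z t)) \<le> L * dist y z" for t
            using L(2)[of "y t" "z t"] mult_left_mono[OF dist_bounded[of y t z] L(1)]
            by (simp add: dist_norm)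
        qed
        also have "\<dots> \<le> (L * dist y z) * \<delta>"
          using cl(2)[of t] L(1) by (intro mult_left_mono) auto
        also have "\<dots> \<le> 1/2 * dist y z"
          using mult_right_mono[OF \<delta>(2), of "dist y z"] by (simp add: mult_ac)
        finally show "dist (Q y t) (Q z t) \<le> 1/2 * dist y z"
          by (simp add: Q P_def dist_norm algebra_simps)
      qed
    qed
  qed auto
  then obtain y where y: "Q y = y" by blast
  have eq: "y t = x0 + (J y t - J y 0)" if "t \<in> ?I" for t
    using arg_cong[OF y, of "\<lambda>f. apply_bcontfun f t"] cl_id[OF that] by (simp add: Q P_def)
  show ?thesis
  proof (rule that)
    show "apply_bcontfun y 0 = x0" using eq[OF 0] by simp
    show "(apply_bcontfun y has_vector_derivative W (y t)) (at t within ?I)" if "t \<in> ?I" for t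
    proof (rule has_vector_derivative_transform[OF that])
      show "((\<lambda>t. x0 + (J y t - J y 0)) has_vector_derivative W (y t)) (at t within ?I)"
        using J[OF that] by (auto intro!: derivative_eq_intros)
    qed (use eq in auto)
  qed
qed

text \<open>On a time interval short compared with the Lipschitz constant, a maximum argument replaces
  Gronwall's inequality.\<close>

lemma ode_stability:
  fixes y z :: "real \<Rightarrow> 'a::real_normed_vector"
  assumes \<delta>: "\<delta> > 0" "L * \<delta> \<le> 1/2" and L: "L \<ge> 0"
    and y: "\<And>t. t \<in> {-\<delta>..\<delta>} \<Longrightarrow> (y has_vector_derivative y' t) (at t within {-\<delta>..\<delta>})"
    and z: "\<And>t. t \<in> {-\<delta>..\<delta>} \<Longrightarrow> (z has_vector_derivative z' t) (at t within {-\<delta>..\<delta>})"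
    and yz: "\<And>t. t \<in> {-\<delta>..\<delta>} \<Longrightarrow> norm (z' t - y' t) \<le> L * norm (z t - y t) + C"
    and t: "t \<in> {-\<delta>..\<delta>}"
  shows "norm (z t - y t) \<le> 2 * (norm (z 0 - y 0) + \<delta> * C)"
proof -
  let ?I = "{-\<delta>..\<delta>}"
  have w: "((\<lambda>t. z t - y t) has_vector_derivative (z' t - y' t)) (at t within ?I)" if "t \<in> ?I" for t
    by (intro has_vector_derivative_diff y z that)
  then have "continuous_on ?I (\<lambda>t. z t - y t)"
    unfolding continuous_on_eq_continuous_within using has_vector_derivative_continuous by blast
  then have "continuous_on ?I (\<lambda>t. norm (z t - y t))" by (rule continuous_on_norm)
  then obtain t0 where t0: "t0 \<in> ?I" "\<And>t. t \<in> ?I \<Longrightarrow> norm (z t - y t) \<le> norm (z t0 - y t0)"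
    using continuous_attains_sup[of ?I "\<lambda>t. norm (z t - y t)"] \<delta>(1) by auto
  define m where "m = norm (z t0 - y t0)"
  have 0: "0 \<in> ?I" using \<delta> by simp
  have bd: "norm (z' t - y' t) \<le> L * m + C" if "t \<in> ?I" for t
    using yz[OF that] mult_left_mono[OF t0(2)[OF that] L] by (simp add: m_def)
  have "L * m + C \<ge> 0" using bd[OF 0] norm_ge_zero order_trans by blast
  have "norm ((z t0 - y t0) - (z 0 - y 0)) \<le> (L * m + C) * \<bar>t0 - 0\<bar>"
    by (rule vector_derivative_bound[OF w bd 0 t0(1)])
  also have "\<dots> \<le> (L * m + C) * \<delta>"
    using t0(1) \<open>L * m + C \<ge> 0\<close> by (intro mult_left_mono) auto
  \<comment> \<open>Half of the maximum is absorbed into the left-hand side, whence the factor 2 of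
    the conclusion.\<close>
  also have "\<dots> \<le> m / 2 + \<delta> * C"
    using mult_right_mono[OF \<delta>(2), of m] by (simp add: m_def algebra_simps)
  finally have "m \<le> norm (z 0 - y 0) + (m / 2 + \<delta> * C)"
    using norm_triangle_sub[of "z t0 - y t0" "z 0 - y 0"] by (simp add: m_def)
  then show ?thesis using t0(2)[OF t] by (simp add: m_def)
qed

text \<open>Let \<open>y(s,\<cdot>)\<close> be the integral curve of \<open>W\<close> starting on an integral curve of \<open>V\<close>. Because the fields
  commute, \<open>y(s,\<cdot>) + \<epsilon> V(y(s,\<cdot>))\<close> solves the equation of \<open>W\<close> up to an error of order \<open>\<epsilon>\<^sup>2\<close>, so by stability
  it is that close to \<open>y(s + \<epsilon>,\<cdot>)\<close>. This yields \<open>\<partial>\<^sub>s y = V(y)\<close> without any theory of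
  differentiable dependence on initial values.\<close>

theorem commuting_flow:
  fixes V W :: "'a::euclidean_space \<Rightarrow> 'a"
  assumes \<Omega>: "open \<Omega>" "z0 \<in> \<Omega>" and V: "smooth_on V \<Omega>" and W: "smooth_on W \<Omega>"
    and comm: "\<And>z. z \<in> \<Omega> \<Longrightarrow> dd V z (W z) = dd W z (V z)"
  obtains \<delta> u where "\<delta> > 0" "u (0, 0) = z0"
    "\<And>s t. \<bar>s\<bar> < \<delta> \<Longrightarrow> \<bar>t\<bar> < \<delta> \<Longrightarrow> u (s, t) \<in> \<Omega>"
    "\<And>s t. \<bar>s\<bar> < \<delta> \<Longrightarrow> \<bar>t\<bar> < \<delta> \<Longrightarrow>
      (u has_derivative (\<lambda>p. fst p *\<^sub>R V (u (s, t)) + snd p *\<^sub>R W (u (s, t)))) (at (s, t))"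
proof -
  obtain r where r: "r > 0" "cball z0 r \<subseteq> \<Omega>" using \<Omega> open_contains_cball by blast
  define K where "K = cball z0 r"
  have K: "K \<subseteq> \<Omega>" "compact K" "convex K" "closed K" "K \<noteq> {}" "z0 \<in> K" using r by (auto simp: K_def)
  obtain LV where LV: "LV \<ge> 0" "\<And>a b. a \<in> K \<Longrightarrow> b \<in> K \<Longrightarrow> norm (V b - V a) \<le> LV * norm (b - a)"
    using smooth_on_lipschitz[OF V K(1-3)] by metis
  obtain LW where LW: "LW \<ge> 0" "\<And>a b. a \<in> K \<Longrightarrow> b \<in> K \<Longrightarrow> norm (W b - W a) \<le> LW * norm (b - a)"
    using smooth_on_lipschitz[OF W K(1-3)] by metis
  define L where "L = max LV LW"
  have L: "L \<ge> 0" "\<And>a b. a \<in> K \<Longrightarrow> b \<in> K \<Longrightarrow> norm (V b - V a) \<le> L * norm (b - a)"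
    "\<And>a b. a \<in> K \<Longrightarrow> b \<in> K \<Longrightarrow> norm (W b - W a) \<le> L * norm (b - a)"
  proof -
    show "L \<ge> 0" using LV by (simp add: L_def)
    fix a b assume ab: "a \<in> K" "b \<in> K"
    have "LV * norm (b - a) \<le> L * norm (b - a)" "LW * norm (b - a) \<le> L * norm (b - a)"
      by (simp_all add: L_def mult_right_mono)
    then show "norm (V b - V a) \<le> L * norm (b - a)" "norm (W b - W a) \<le> L * norm (b - a)"
      using LV(2)[OF ab] LW(2)[OF ab] by linarith+
  qed
  have "bounded (V ` K)" "bounded (W ` K)"
    using V W K(1,2) smooth_on_continuous_on
    by (auto intro!: compact_imp_bounded compact_continuous_image intro: continuous_on_subset)
  then obtain MV MW where "\<And>z. z \<in> K \<Longrightarrow> norm (V z) \<le> MV" "\<And>z. z \<in> K \<Longrightarrow> norm (W z) \<le> MW"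
    unfolding bounded_iff by blast
  then obtain M where M: "\<And>z. z \<in> K \<Longrightarrow> norm (V z) \<le> M" "\<And>z. z \<in> K \<Longrightarrow> norm (W z) \<le> M"
    using that[of "max MV MW"] by (meson max.coboundedI1 max.coboundedI2)
  have M0: "M \<ge> 0" using M(1)[OF K(6)] norm_ge_zero order_trans by blast
  obtain C where C: "C \<ge> 0"
    "\<And>a b. a \<in> K \<Longrightarrow> b \<in> K \<Longrightarrow> norm (W b - W a - dd W a (b - a)) \<le> C * (norm (b - a))\<^sup>2"
    using smooth_on_quadratic_bound[OF W K(1-3)] by metis
  \<comment> \<open>The first bound serves Picard iteration and stability. The second makes each of
    the two flow times move a point by at most \<open>r/4\<close>, so \<open>y s t\<close> stays
    within \<open>r/2\<close> of \<open>z0\<close> and leaves room for the perturbation by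
    \<open>\<epsilon> V\<close>.\<close>
  define \<delta> where "\<delta> = min (1 / (2 * (L + 1))) (r / (4 * (M + 1)))"
  have \<delta>: "\<delta> > 0" using L(1) M0 r(1) by (simp add: \<delta>_def)
  have L\<delta>: "L * \<delta> \<le> 1/2"
  proof -
    have "L * \<delta> \<le> L * (1 / (2 * (L + 1)))" using L(1) by (intro mult_left_mono) (auto simp: \<delta>_def)
    also have "\<dots> \<le> 1/2" using L(1) by (simp add: field_simps)
    finally show ?thesis .
  qed
  have M\<delta>: "M * \<delta> \<le> r/4"
  proof -
    have "M * \<delta> \<le> M * (r / (4 * (M + 1)))" using M0 by (intro mult_left_mono) (auto simp: \<delta>_def)
    also have "\<dots> \<le> r/4" using M0 r(1) by (simp add: field_simps)
    finally show ?thesis .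
  qed
  let ?I = "{-\<delta>..\<delta>}"
  have 0: "0 \<in> ?I" using \<delta> by simp
  \<comment> \<open>Composing with the projection to the convex set \<open>K\<close>, which is
    1-Lipschitz, extends the fields from \<open>K\<close> to bounded Lipschitz fields on the whole
    space. The solutions turn out to stay in \<open>K\<close>, where nothing has changed.\<close>
  let ?c = "closest_point K"
  have c: "?c z \<in> K" for z using closest_point_in_set K by blast
  have c_id: "?c z = z" if "z \<in> K" for z using closest_point_self that .
  have cL: "norm (?c y - ?c x) \<le> norm (y - x)" for x y
    using closest_point_lipschitz[OF K(3,4,5), of y x] by (simp add: dist_norm)
  have Lc: "norm (V (?c y) - V (?c x)) \<le> L * norm (y - x)" "norm (W (?c y) - W (?c x)) \<le> L * norm (y - x)" for x y
    using L(2,3)[OF c c, of y x] mult_left_mono[OF cL[of y x] L(1)] by linarith+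
  obtain \<gamma> where \<gamma>: "\<gamma> 0 = z0"
    "\<And>t. t \<in> ?I \<Longrightarrow> (\<gamma> has_vector_derivative V (?c (\<gamma> t))) (at t within ?I)"
    using ode_solution_exists[OF L(1) Lc(1) M(1)[OF c] \<delta> L\<delta>] by blast
  have "\<exists>y. y 0 = \<gamma> s \<and> (\<forall>t\<in>?I. (y has_vector_derivative W (?c (y t))) (at t within ?I))" for s
    using ode_solution_exists[OF L(1) Lc(2) M(2)[OF c] \<delta> L\<delta>] by metis
  then obtain y where y: "\<And>s. y s 0 = \<gamma> s"
    "\<And>s t. t \<in> ?I \<Longrightarrow> (y s has_vector_derivative W (?c (y s t))) (at t within ?I)" by metis
  have \<gamma>M: "norm (\<gamma> s' - \<gamma> s) \<le> M * \<bar>s' - s\<bar>" if "s \<in> ?I" "s' \<in> ?I" for s s'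
    by (rule vector_derivative_bound[OF \<gamma>(2) M(1)[OF c] that])
  have yM: "norm (y s t' - y s t) \<le> M * \<bar>t' - t\<bar>" if "t \<in> ?I" "t' \<in> ?I" for s t t'
    by (rule vector_derivative_bound[OF y(2) M(2)[OF c] that])
  have small: "M * \<bar>s\<bar> \<le> r/4" if "s \<in> ?I" for s
  proof -
    have "M * \<bar>s\<bar> \<le> M * \<delta>" using that M0 by (intro mult_left_mono) auto
    then show ?thesis using M\<delta> by linarith
  qed
  have \<gamma>r: "norm (\<gamma> s - z0) \<le> r/4" if "s \<in> ?I" for s
    using \<gamma>M[OF 0 that] small[OF that] \<gamma>(1) by simp
  have yr: "norm (y s t - z0) \<le> r/2" if "s \<in> ?I" "t \<in> ?I" for s t
    using norm_triangle_ineq[of "y s t - \<gamma> s" "\<gamma> s - z0"] \<gamma>r[OF that(1)] yM[OF 0 that(2), of s]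
      small[OF that(2)] y(1)[of s] by simp
  have \<gamma>K: "\<gamma> s \<in> K" if "s \<in> ?I" for s
    using \<gamma>r[OF that] r(1) by (simp add: K_def dist_norm norm_minus_commute)
  have yK: "y s t \<in> K" if "s \<in> ?I" "t \<in> ?I" for s t
    using yr[OF that] r(1) by (simp add: K_def dist_norm norm_minus_commute)
  have \<gamma>': "(\<gamma> has_vector_derivative V (\<gamma> s)) (at s within ?I)" if "s \<in> ?I" for s
    using \<gamma>(2)[OF that] c_id[OF \<gamma>K[OF that]] by simp
  have y': "(y s has_vector_derivative W (y s t)) (at t within ?I)" if "s \<in> ?I" "t \<in> ?I" for s t
    using y(2)[OF that(2), of s] c_id[OF yK[OF that]] by simp
  have key: "\<exists>d>0. \<forall>\<epsilon>. \<bar>\<epsilon>\<bar> < d \<longrightarrow> s + \<epsilon> \<in> ?I \<and>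
      (\<forall>t\<in>?I. norm (y (s + \<epsilon>) t - y s t - \<epsilon> *\<^sub>R V (y s t)) \<le> e * \<bar>\<epsilon>\<bar>)"
    if s: "\<bar>s\<bar> < \<delta>" and e: "e > 0" for s e
  proof -
    have sI: "s \<in> ?I" using s by auto
    have "(\<gamma> has_derivative (\<lambda>h. h *\<^sub>R V (\<gamma> s))) (at s within ?I)"
      using \<gamma>'[OF sI] by (simp add: has_vector_derivative_def)
    then obtain d1 where d1: "d1 > 0" "\<And>s'. s' \<in> ?I \<Longrightarrow> norm (s' - s) < d1 \<Longrightarrow>
        norm (\<gamma> s' - \<gamma> s - (s' - s) *\<^sub>R V (\<gamma> s)) \<le> e/4 * norm (s' - s)"
      unfolding has_derivative_within_alt using e by (metis (no_types, lifting) zero_less_divide_iff zero_less_numeral)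
    define B where "B = \<delta> * (C * M\<^sup>2)"
    have B: "B \<ge> 0" using \<delta> C(1) by (simp add: B_def)
    \<comment> \<open>In order: differentiability of \<open>\<gamma>\<close> at \<open>s\<close>;
      \<open>s + \<epsilon>\<close> stays in the interval; the perturbed curve stays in
      \<open>K\<close>; the quadratic error is at most \<open>e/4\<close> times the size of
      \<open>\<epsilon>\<close>. The factor 2 of \<open>ode_stability\<close> turns the two quarters
      into \<open>e\<close>.\<close>
    define d where "d = min (min d1 (\<delta> - \<bar>s\<bar>)) (min (r / (2 * (M + 1))) (e / (4 * (B + 1))))"
    have d: "d > 0" using d1(1) s r(1) M0 e B by (simp add: d_def)
    show ?thesis
    proof (intro exI[of _ d] conjI allI impI ballI)
      show "d > 0" by (rule d)
      fix \<epsilon> :: real assume \<epsilon>: "\<bar>\<epsilon>\<bar> < d"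
      then show s\<epsilon>: "s + \<epsilon> \<in> ?I" by (auto simp: d_def)
      have "\<bar>\<epsilon>\<bar> * M \<le> r / (2 * (M + 1)) * M" using \<epsilon> M0 by (intro mult_right_mono) (auto simp: d_def)
      also have "\<dots> \<le> r / 2" using M0 r(1) by (simp add: field_simps)
      finally have \<epsilon>M: "\<bar>\<epsilon>\<bar> * M \<le> r / 2" .
      have "\<bar>\<epsilon>\<bar> * B \<le> e / (4 * (B + 1)) * B" using \<epsilon> B by (intro mult_right_mono) (auto simp: d_def)
      also have "\<dots> \<le> e / 4" using B e by (simp add: field_simps)
      finally have \<epsilon>B: "\<bar>\<epsilon>\<bar> * B \<le> e / 4" .
      let ?z = "\<lambda>t. y s t + \<epsilon> *\<^sub>R V (y s t)"
      have zK: "?z t \<in> K" if t: "t \<in> ?I" for t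
      proof -
        have "norm (\<epsilon> *\<^sub>R V (y s t)) \<le> \<bar>\<epsilon>\<bar> * M"
          using M(1)[OF yK[OF sI t]] by (simp add: mult_left_mono)
        then have "norm (?z t - z0) \<le> r"
          using norm_triangle_ineq[of "y s t - z0" "\<epsilon> *\<^sub>R V (y s t)"] yr[OF sI t] \<epsilon>M
          by (simp add: algebra_simps)
        then show ?thesis by (simp add: K_def dist_norm norm_minus_commute)
      qed
      have z': "(?z has_vector_derivative W (y s t) + \<epsilon> *\<^sub>R dd V (y s t) (W (y s t))) (at t within ?I)"
        if t: "t \<in> ?I" for t
      proof -
        have Vd: "(V has_derivative dd V (y s t)) (at (y s t))"
          using smooth_on_has_derivative[OF V] yK[OF sI t] K(1) by blast
        have "((\<lambda>t. V (y s t)) has_derivative (\<lambda>h. dd V (y s t) (h *\<^sub>R W (y s t)))) (at t within ?I)"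
          using has_derivative_compose[OF y'[OF sI t, unfolded has_vector_derivative_def] Vd] .
        then have "((\<lambda>t. V (y s t)) has_vector_derivative dd V (y s t) (W (y s t))) (at t within ?I)"
          unfolding has_vector_derivative_def
          using linear_cmul[OF has_derivative_linear[OF Vd]] by simp
        then show ?thesis
          by (intro has_vector_derivative_add y'[OF sI t])
            (auto intro!: derivative_eq_intros)
      qed
      fix t assume t: "t \<in> ?I"
      have "norm (?z t - y (s + \<epsilon>) t) \<le> 2 * (norm (?z 0 - y (s + \<epsilon>) 0) + \<delta> * (C * (\<bar>\<epsilon>\<bar> * M)\<^sup>2))"
      proof (rule ode_stability[OF \<delta> L\<delta> L(1) y'[OF s\<epsilon>] z' _ t])
        fix t assume t: "t \<in> ?I"
        have yy: "y s t \<in> K" by (rule yK[OF sI t])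
        have Wl: "linear (dd W (y s t))" using smooth_on_linear_dd[OF W] yy K(1) by blast
        \<comment> \<open>Commutation enters here: the derivative of \<open>\<epsilon> V\<close>
          along the curve equals the first-order change of \<open>W\<close> under the displacement
          \<open>\<epsilon> V\<close>.\<close>
        have "dd V (y s t) (W (y s t)) = dd W (y s t) (V (y s t))" using comm yy K(1) by blast
        then have eq: "\<epsilon> *\<^sub>R dd V (y s t) (W (y s t)) = dd W (y s t) (?z t - y s t)"
          using linear_cmul[OF Wl] by simp
        have "norm (W (?z t) - W (y s t) - dd W (y s t) (?z t - y s t)) \<le> C * (norm (?z t - y s t))\<^sup>2"
          by (rule C(2)[OF yy zK[OF t]])
        also have "\<dots> \<le> C * (\<bar>\<epsilon>\<bar> * M)\<^sup>2"
          using C(1) M(1)[OF yy] by (intro mult_left_mono power_mono) (auto intro: mult_left_mono)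
        finally have 1: "norm (W (?z t) - W (y s t) - dd W (y s t) (?z t - y s t)) \<le> C * (\<bar>\<epsilon>\<bar> * M)\<^sup>2" .
        have 2: "norm (W (?z t) - W (y (s + \<epsilon>) t)) \<le> L * norm (?z t - y (s + \<epsilon>) t)"
          by (rule L(3)[OF yK[OF s\<epsilon> t] zK[OF t]])
        have "W (y s t) + \<epsilon> *\<^sub>R dd V (y s t) (W (y s t)) - W (y (s + \<epsilon>) t)
            = (W (?z t) - W (y (s + \<epsilon>) t)) - (W (?z t) - W (y s t) - dd W (y s t) (?z t - y s t))"
          unfolding eq by simp
        then show "norm (W (y s t) + \<epsilon> *\<^sub>R dd V (y s t) (W (y s t)) - W (y (s + \<epsilon>) t))
            \<le> L * norm (?z t - y (s + \<epsilon>) t) + C * (\<bar>\<epsilon>\<bar> * M)\<^sup>2"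
          using order_trans[OF norm_triangle_ineq4 add_mono[OF 2 1]] by (simp only:)
      qed
      also have "norm (?z 0 - y (s + \<epsilon>) 0) \<le> e / 4 * \<bar>\<epsilon>\<bar>"
        using d1(2)[OF s\<epsilon>] \<epsilon> by (simp add: y(1) d_def norm_minus_commute algebra_simps)
      also have "\<delta> * (C * (\<bar>\<epsilon>\<bar> * M)\<^sup>2) = (\<bar>\<epsilon>\<bar> * B) * \<bar>\<epsilon>\<bar>"
        by (simp add: B_def power2_eq_square algebra_simps)
      also have "\<dots> \<le> e / 4 * \<bar>\<epsilon>\<bar>" using \<epsilon>B by (intro mult_right_mono) auto
      finally show "norm (y (s + \<epsilon>) t - y s t - \<epsilon> *\<^sub>R V (y s t)) \<le> e * \<bar>\<epsilon>\<bar>"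
        by (simp add: norm_minus_commute algebra_simps)
    qed
  qed
  define u where "u = (\<lambda>p. y (fst p) (snd p))"
  show ?thesis
  proof (rule that[of \<delta> u])
    show "u (0, 0) = z0" by (simp add: u_def y \<gamma>)
    show "u (s, t) \<in> \<Omega>" if "\<bar>s\<bar> < \<delta>" "\<bar>t\<bar> < \<delta>" for s t
    proof -
      have "s \<in> ?I" "t \<in> ?I" using that by auto
      then show ?thesis using yK[of s t] K(1) by (auto simp: u_def)
    qed
    fix s t assume st: "\<bar>s\<bar> < \<delta>" "\<bar>t\<bar> < \<delta>"
    then have sI: "s \<in> ?I" and tI: "t \<in> ?I" by auto
    show "(u has_derivative (\<lambda>p. fst p *\<^sub>R V (u (s, t)) + snd p *\<^sub>R W (u (s, t)))) (at (s, t))"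
      unfolding has_derivative_at_alt
    proof (intro conjI allI impI)
      show "bounded_linear (\<lambda>p. fst p *\<^sub>R V (u (s, t)) + snd p *\<^sub>R W (u (s, t)))"
        by (intro bounded_linear_add bounded_linear_scaleR_const bounded_linear_fst bounded_linear_snd)
      fix e :: real assume e: "e > 0"
      obtain d1 where d1: "d1 > 0" "\<And>\<epsilon>. \<bar>\<epsilon>\<bar> < d1 \<Longrightarrow> s + \<epsilon> \<in> ?I \<and>
          (\<forall>t\<in>?I. norm (y (s + \<epsilon>) t - y s t - \<epsilon> *\<^sub>R V (y s t)) \<le> e/3 * \<bar>\<epsilon>\<bar>)"
        using key[OF st(1), of "e/3"] e by auto
      have "(y s has_derivative (\<lambda>h. h *\<^sub>R W (y s t))) (at t within ?I)"
        using y'[OF sI tI] by (simp add: has_vector_derivative_def)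
      then obtain d2 where d2: "d2 > 0" "\<And>t'. t' \<in> ?I \<Longrightarrow> norm (t' - t) < d2 \<Longrightarrow>
          norm (y s t' - y s t - (t' - t) *\<^sub>R W (y s t)) \<le> e/3 * norm (t' - t)"
        unfolding has_derivative_within_alt using e by (metis (no_types, lifting) zero_less_divide_iff zero_less_numeral)
      define d where "d = min (min d1 d2) (min (\<delta> - \<bar>t\<bar>) (e / (3 * (L * M + 1))))"
      have d: "d > 0" using d1(1) d2(1) st e L(1) M0 by (simp add: d_def add_nonneg_pos)
      show "\<exists>d>0. \<forall>p. norm (p - (s, t)) < d \<longrightarrow>
          norm (u p - u (s, t) - (fst (p - (s, t)) *\<^sub>R V (u (s, t)) + snd (p - (s, t)) *\<^sub>R W (u (s, t))))
            \<le> e * norm (p - (s, t))"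
      proof (intro exI[of _ d] conjI allI impI)
        show "d > 0" by (rule d)
        fix p :: "real \<times> real" assume p: "norm (p - (s, t)) < d"
        define \<epsilon> \<eta> where "\<epsilon> = fst p - s" and "\<eta> = snd p - t"
        have peq: "p = (s + \<epsilon>, t + \<eta>)" by (simp add: \<epsilon>_def \<eta>_def)
        have le: "\<bar>\<epsilon>\<bar> \<le> norm (p - (s, t))" "\<bar>\<eta>\<bar> \<le> norm (p - (s, t))"
          using norm_fst_le[of "fst p - s" "snd p - t"] norm_snd_le[of "snd p - t" "fst p - s"]
          by (simp_all add: \<epsilon>_def \<eta>_def minus_prod_def)
        have \<eta>I: "t + \<eta> \<in> ?I" using le(2) p by (auto simp: d_def)
        have A: "norm (y (s + \<epsilon>) (t + \<eta>) - y s (t + \<eta>) - \<epsilon> *\<^sub>R V (y s (t + \<eta>))) \<le> e/3 * \<bar>\<epsilon>\<bar>"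
          using d1(2)[of \<epsilon>] le(1) p \<eta>I by (simp add: d_def)
        have "norm (V (y s (t + \<eta>)) - V (y s t)) \<le> L * (M * \<bar>\<eta>\<bar>)"
          using L(2)[OF yK[OF sI tI] yK[OF sI \<eta>I]] mult_left_mono[OF yM[OF tI \<eta>I, of s] L(1)] by simp
        also have "\<dots> = L * M * \<bar>\<eta>\<bar>" by simp
        also have "\<dots> \<le> L * M * (e / (3 * (L * M + 1)))"
          using le(2) p L(1) M0 by (intro mult_left_mono) (auto simp: d_def)
        also have "\<dots> \<le> e/3"
        proof -
          have "0 \<le> L * M" using L(1) M0 by simp
          then show ?thesis using e by (simp add: field_simps)
        qed
        finally have "norm (V (y s (t + \<eta>)) - V (y s t)) \<le> e/3" .
        from mult_right_mono[OF this abs_ge_zero[of \<epsilon>]]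
        have B: "norm (\<epsilon> *\<^sub>R (V (y s (t + \<eta>)) - V (y s t))) \<le> e/3 * \<bar>\<epsilon>\<bar>"
          by (simp only: norm_scaleR mult.commute)
        have D: "norm (y s (t + \<eta>) - y s t - \<eta> *\<^sub>R W (y s t)) \<le> e/3 * \<bar>\<eta>\<bar>"
          using d2(2)[OF \<eta>I] le(2) p by (simp add: d_def)
        \<comment> \<open>First the \<open>s\<close>-increment at time \<open>t + \<eta>\<close>,
          then its base point is moved back to time \<open>t\<close>, then the
          \<open>t\<close>-increment. The bound \<open>key\<close> is uniform in time, which gives
          joint and not just partial differentiability.\<close>
        have "u p - u (s, t) - (fst (p - (s, t)) *\<^sub>R V (u (s, t)) + snd (p - (s, t)) *\<^sub>R W (u (s, t)))
          = (y (s + \<epsilon>) (t + \<eta>) - y s (t + \<eta>) - \<epsilon> *\<^sub>R V (y s (t + \<eta>)))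
            + \<epsilon> *\<^sub>R (V (y s (t + \<eta>)) - V (y s t)) + (y s (t + \<eta>) - y s t - \<eta> *\<^sub>R W (y s t))"
          by (simp add: u_def peq algebra_simps)
        then have "norm (u p - u (s, t) - (fst (p - (s, t)) *\<^sub>R V (u (s, t)) + snd (p - (s, t)) *\<^sub>R W (u (s, t))))
          \<le> e/3 * \<bar>\<epsilon>\<bar> + e/3 * \<bar>\<epsilon>\<bar> + e/3 * \<bar>\<eta>\<bar>"
          using A B D by (simp only:) (meson add_mono norm_triangle_ineq order_trans)
        also have "\<dots> \<le> e/3 * norm (p - (s, t)) + e/3 * norm (p - (s, t)) + e/3 * norm (p - (s, t))"
          using le e by (intro add_mono mult_left_mono) auto
        finally show "norm (u p - u (s, t) - (fst (p - (s, t)) *\<^sub>R V (u (s, t)) + snd (p - (s, t)) *\<^sub>R W (u (s, t))))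
            \<le> e * norm (p - (s, t))" by simp
      qed
    qed
  qed (rule \<delta>)
qed

section \<open>Connections and metrics in a chart as multilinear maps\<close>

lemma linear_eq_axis:
  fixes f g :: "real^'n::finite \<Rightarrow> 'b::real_vector"
  assumes "linear f" "linear g" "\<And>i. f (axis i 1) = g (axis i 1)"
  shows "f v = g v"
proof -
  have "f = g"
    by (rule linear_eq_stdbasis[OF assms(1,2)]) (use assms(3) in \<open>auto simp: Basis_vec_def\<close>)
  then show ?thesis by simp
qed

lemma trilinear_eq_axis:
  fixes f g :: "real^'n::finite \<Rightarrow> real^'n \<Rightarrow> real^'n \<Rightarrow> real"
  assumes f: "\<And>u v w. linear (\<lambda>u. f u v w)" "\<And>u v w. linear (\<lambda>v. f u v w)" "\<And>u v. linear (f u v)"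
    and g: "\<And>u v w. linear (\<lambda>u. g u v w)" "\<And>u v w. linear (\<lambda>v. g u v w)" "\<And>u v. linear (g u v)"
    and ax: "\<And>i j k. f (axis i 1) (axis j 1) (axis k 1) = g (axis i 1) (axis j 1) (axis k 1)"
  shows "f u v w = g u v w"
proof -
  have "f (axis i 1) (axis j 1) w = g (axis i 1) (axis j 1) w" for i j w
    by (rule linear_eq_axis[OF f(3) g(3) ax])
  then have "f (axis i 1) v w = g (axis i 1) v w" for i v w
    by (rule linear_eq_axis[OF f(2) g(2)])
  then show ?thesis
    by (rule linear_eq_axis[OF f(1) g(1)])
qed

lemma bilinear_eq_axis:
  fixes f g :: "real^'n::finite \<Rightarrow> real^'n \<Rightarrow> real"
  assumes f: "\<And>v. linear (\<lambda>u. f u v)" "\<And>u. linear (f u)"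
    and g: "\<And>v. linear (\<lambda>u. g u v)" "\<And>u. linear (g u)"
    and ax: "\<And>i j. f (axis i 1) (axis j 1) = g (axis i 1) (axis j 1)"
  shows "f u v = g u v"
proof -
  have "f (axis i 1) v = g (axis i 1) v" for i v
    by (rule linear_eq_axis[OF f(2) g(2) ax])
  then show ?thesis by (rule linear_eq_axis[OF f(1) g(1)])
qed

section \<open>Christoffel symbols as a bilinear operation\<close>

lemma chris_add_left: "chris \<Gamma> (u + u') v = chris \<Gamma> u v + chris \<Gamma> u' v"
  and chris_add_right: "chris \<Gamma> u (v + v') = chris \<Gamma> u v + chris \<Gamma> u v'"
  and chris_add_conn: "chris (\<Gamma> + \<Gamma>') u v = chris \<Gamma> u v + chris \<Gamma>' u v"
  by (simp_all add: chris_def vec_eq_iff algebra_simps sum.distrib)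

lemma chris_scale_left: "chris \<Gamma> (r *\<^sub>R u) v = r *\<^sub>R chris \<Gamma> u v"
  and chris_scale_right: "chris \<Gamma> u (r *\<^sub>R v) = r *\<^sub>R chris \<Gamma> u v"
  and chris_scale_conn: "chris (r *\<^sub>R \<Gamma>) u v = r *\<^sub>R chris \<Gamma> u v"
  by (simp_all add: chris_def vec_eq_iff algebra_simps sum_distrib_left)

lemma linear_chris_left: "linear (\<lambda>u. chris \<Gamma> u v)"
  and linear_chris_right: "linear (chris \<Gamma> u)"
  and linear_chris_conn: "linear (\<lambda>\<Gamma>. chris \<Gamma> u v)"
  by (auto intro!: linearI simp: chris_add_left chris_add_right chris_add_conn
      chris_scale_left chris_scale_right chris_scale_conn)

lemmas chris_linear =
  linear_add[OF linear_chris_left] linear_add[OF linear_chris_right] linear_add[OF linear_chris_conn]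
  linear_diff[OF linear_chris_left] linear_diff[OF linear_chris_right] linear_diff[OF linear_chris_conn]
  linear_neg[OF linear_chris_left] linear_neg[OF linear_chris_right] linear_neg[OF linear_chris_conn]
  linear_cmul[OF linear_chris_left] linear_cmul[OF linear_chris_right] linear_cmul[OF linear_chris_conn]
  linear_0[OF linear_chris_left] linear_0[OF linear_chris_right] linear_0[OF linear_chris_conn]

lemma chris_axis: "chris \<Gamma> (axis i 1) (axis j 1) = \<Gamma> $ i $ j"
  by (simp add: chris_def vec_eq_iff axis_def if_distrib[of "(*) _"] cong: if_cong)

lemma chris_axis_left: "chris \<Gamma> (axis i 1) v $ k = (\<Sum>j\<in>UNIV. \<Gamma> $ i $ j $ k * v $ j)"
proof -
  have "(\<Sum>j\<in>UNIV. \<Gamma> $ a $ j $ k * axis i 1 $ a * v $ j)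
      = (if a = i then (\<Sum>j\<in>UNIV. \<Gamma> $ i $ j $ k * v $ j) else 0)" for a
    by (simp add: axis_def)
  then show ?thesis by (simp add: chris_def)
qed

text \<open>Factors the trilinear \<open>chris\<close> into two bilinear operations, to which the
  product and smoothness rules for bilinear maps apply.\<close>

definition chris_mat :: "real^'n^'n^'n \<Rightarrow> real^'n \<Rightarrow> real^'n^'n::finite" where
  "chris_mat \<Gamma> u = (\<chi> k j. \<Sum>i\<in>UNIV. \<Gamma> $ i $ j $ k * u $ i)"

lemma chris_conv_mat: "chris \<Gamma> u v = chris_mat \<Gamma> u *v v"
proof -
  have "chris \<Gamma> u v $ k = (chris_mat \<Gamma> u *v v) $ k" for k
    unfolding chris_def chris_mat_def matrix_vector_mult_def
    by (simp add: sum_distrib_right) (rule sum.swap)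
  then show ?thesis by (simp add: vec_eq_iff)
qed

lemma bounded_bilinear_chris_mat: "bounded_bilinear chris_mat"
  unfolding bilinear_conv_bounded_bilinear[symmetric] bilinear_def
  by (auto intro!: linearI simp: chris_mat_def vec_eq_iff algebra_simps sum.distrib sum_distrib_left)

lemma bounded_bilinear_matrix_vector: "bounded_bilinear (\<lambda>(M::real^'n^'m) v. M *v v)"
  unfolding bilinear_conv_bounded_bilinear[symmetric] bilinear_def
  by (auto intro!: linearI simp: matrix_vector_mult_def vec_eq_iff algebra_simps sum.distrib sum_distrib_left)

lemma has_derivative_chris:
  assumes "(g has_derivative g') (at x within S)" "(a has_derivative a') (at x within S)"
    "(b has_derivative b') (at x within S)"
  shows "((\<lambda>x. chris (g x) (a x) (b x)) has_derivative
    (\<lambda>k. chris (g' k) (a x) (b x) + chris (g x) (a' k) (b x) + chris (g x) (a x) (b' k))) (at x within S)"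
  unfolding chris_conv_mat
  by (rule has_derivative_eq_rhs)
    (rule bounded_bilinear.FDERIV[OF bounded_bilinear_matrix_vector] assms
      bounded_bilinear.FDERIV[OF bounded_bilinear_chris_mat] |
      simp add: fun_eq_iff bounded_bilinear.add_left[OF bounded_bilinear_matrix_vector])+

lemma higher_differentiable_on_chris:
  "open S \<Longrightarrow> higher_differentiable_on k g S \<Longrightarrow> higher_differentiable_on k a S \<Longrightarrow>
    higher_differentiable_on k b S \<Longrightarrow> higher_differentiable_on k (\<lambda>x. chris (g x) (a x) (b x)) S"
  unfolding chris_conv_mat
  by (intro higher_differentiable_on_bilinear[OF bounded_bilinear_matrix_vector]
      higher_differentiable_on_bilinear[OF bounded_bilinear_chris_mat])

lemma smooth_on_chris:
  "open S \<Longrightarrow> smooth_on g S \<Longrightarrow> smooth_on a S \<Longrightarrow> smooth_on b S \<Longrightarrow> smooth_on (\<lambda>x. chris (g x) (a x) (b x)) S"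
  unfolding smooth_on_def using higher_differentiable_on_chris by blast

section \<open>The metric as a bilinear form\<close>

definition ip :: "real^'n^'n \<Rightarrow> real^'n \<Rightarrow> real^'n::finite \<Rightarrow> real" where
  "ip H u v = u \<bullet> (H *v v)"

lemma linear_ip_left: "linear (\<lambda>u. ip H u v)"
  and linear_ip_right: "linear (ip H u)"
  and linear_ip_form: "linear (\<lambda>H. ip H u v)"
  by (auto intro!: linearI simp: ip_def inner_add_left inner_add_right matrix_vector_right_distrib
      matrix_vector_mult_add_rdistrib scaleR_matrix_vector_assoc[symmetric] matrix_vector_mult_scaleR)

lemmas ip_linear =
  linear_add[OF linear_ip_left] linear_add[OF linear_ip_right] linear_add[OF linear_ip_form]
  linear_diff[OF linear_ip_left] linear_diff[OF linear_ip_right] linear_diff[OF linear_ip_form]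
  linear_neg[OF linear_ip_left] linear_neg[OF linear_ip_right] linear_neg[OF linear_ip_form]
  linear_cmul[OF linear_ip_left] linear_cmul[OF linear_ip_right] linear_cmul[OF linear_ip_form]
  linear_0[OF linear_ip_left] linear_0[OF linear_ip_right] linear_0[OF linear_ip_form]

lemma ip_axis: "ip H (axis i 1) (axis j 1) = H $ i $ j"
  by (simp add: ip_def matrix_vector_mult_basis column_def inner_axis')

lemma ip_axis_left: "ip H (axis i 1) v = (\<Sum>p\<in>UNIV. H $ i $ p * v $ p)"
  by (simp add: ip_def inner_axis' matrix_vector_mult_def)

lemma ip_axis_right: "ip H v (axis j 1) = (\<Sum>p\<in>UNIV. H $ p $ j * v $ p)"
  by (simp add: ip_def matrix_vector_mult_basis column_def inner_vec_def mult.commute)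

lemma has_derivative_ip:
  assumes "(g has_derivative g') (at x within S)" "(a has_derivative a') (at x within S)"
    "(b has_derivative b') (at x within S)"
  shows "((\<lambda>x. ip (g x) (a x) (b x)) has_derivative
    (\<lambda>k. ip (g' k) (a x) (b x) + ip (g x) (a' k) (b x) + ip (g x) (a x) (b' k))) (at x within S)"
  unfolding ip_def
  by (rule has_derivative_eq_rhs)
    (rule bounded_bilinear.FDERIV[OF bounded_bilinear_matrix_vector] assms
      has_derivative_inner |
      simp add: fun_eq_iff inner_add_right)+

lemma ip_commute: "transpose H = H \<Longrightarrow> ip H u v = ip H v u"
  unfolding ip_def by (metis dot_lmul_matrix inner_commute vector_transpose_matrix)

lemma ip_nondegenerate:
  assumes "invertible H" "transpose H = H" "\<And>v. ip H u v = 0"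
  shows "u = 0"
proof -
  have "u \<bullet> (H *v (matrix_inv H *v u)) = 0" using assms(3) by (simp add: ip_def)
  then show ?thesis using matrix_inv_mult_vec(1)[OF assms(1)] by simp
qed

section \<open>Symmetric cubic forms preserving the planes through a vector\<close>

text \<open>On the orthogonal complement of \<open>E\<close> such a \<open>T\<close> satisfies \<open>T(X,X) = a X\<close>. Testing \<open>X \<plusminus> Y\<close> for orthogonal
  non-null \<open>X\<close>, \<open>Y\<close> shows that the factors of \<open>X\<close> and \<open>Y\<close> are both equal and opposite.\<close>

lemma cubic_form_eq_0:
  fixes H :: "real^'n^'n" and E :: "real^'n" and T :: "real^'n \<Rightarrow> real^'n \<Rightarrow> real^'n"
  assumes card: "CARD('n) \<noteq> 2"
    and inv: "invertible H" and tr: "transpose H = H"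
    and lin: "\<And>u. linear (T u)" and sym: "\<And>u v. T u v = T v u"
    and cub: "\<And>u v w. ip H (T u v) w = ip H (T u w) v"
    and TE: "\<And>v. T E v = 0" and span: "\<And>v. T v v \<in> span {E, v}"
    and EE: "ip H E E \<noteq> 0"
  shows "T u v = 0"
proof -
  let ?b = "ip H"
  have comm: "?b u v = ?b v u" for u v using ip_commute[OF tr] .
  have lin': "linear (\<lambda>u. T u v)" for v using lin[of v] by (subst sym)
  note Tl = linear_add[OF lin] linear_add[OF lin'] linear_diff[OF lin] linear_diff[OF lin']
    linear_cmul[OF lin] linear_cmul[OF lin']
  have nd: "u = 0" if "\<And>v. ?b u v = 0" for u using ip_nondegenerate[OF inv tr that] .
  have TE': "T v E = 0" for v by (metis TE sym)
  define W where "W = {X. ?b X E = 0}"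
  have W_add: "X + Y \<in> W" "X - Y \<in> W" "r *\<^sub>R X \<in> W" if "X \<in> W" "Y \<in> W" for X Y r
    using that by (auto simp: W_def ip_linear)
  have eig: "\<exists>a. T X X = a *\<^sub>R X" if "X \<in> W" for X
  proof -
    obtain s r where sr: "T X X = r *\<^sub>R E + s *\<^sub>R X"
      using span[of X] by (auto simp: span_insert algebra_simps)
    \<comment> \<open>Pairing with \<open>E\<close> isolates the \<open>E\<close>-component, and
      cubic symmetry moves \<open>E\<close> into \<open>T\<close>, where it gives 0.\<close>
    have "?b (T X X) E = ?b (T X E) X" by (rule cub)
    then have "?b (T X X) E = 0" by (simp add: TE' ip_linear)
    then have "r * ?b E E = 0" using that by (simp add: sr ip_linear W_def)
    then show ?thesis using sr EE by auto
  qed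
  have pair: "T X X = 0"
    if XY: "X \<in> W" "Y \<in> W" "?b X X \<noteq> 0" "?b Y Y \<noteq> 0" "?b X Y = 0" for X Y
  proof -
    obtain a a' c d where *: "T X X = a *\<^sub>R X" "T Y Y = a' *\<^sub>R Y"
      "T (X + Y) (X + Y) = c *\<^sub>R (X + Y)" "T (X - Y) (X - Y) = d *\<^sub>R (X - Y)"
      using eig W_add XY(1,2) by metis
    have "?b Y X = 0" using comm XY(5) by simp
    have cXX: "?b (T X Y) X = 0"
      using cub[of X Y X] * XY(5) by (simp add: ip_linear)
    have cYY: "?b (T X Y) Y = 0"
      using cub[of Y X Y] * \<open>?b Y X = 0\<close> by (simp add: ip_linear sym[of X Y])
    have "?b (T (X + Y) (X + Y)) X = a * ?b X X" "?b (T (X + Y) (X + Y)) Y = a' * ?b Y Y"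
      "?b (T (X - Y) (X - Y)) X = a * ?b X X" "?b (T (X - Y) (X - Y)) Y = a' * ?b Y Y"
      using cXX cYY XY(5) \<open>?b Y X = 0\<close> by (simp_all only: Tl(1-4) sym[of Y X] *(1,2) ip_linear) simp_all
    then have "c = a" "c = a'" "d = a" "- d = a'"
      unfolding * using XY \<open>?b Y X = 0\<close> by (auto simp: ip_linear)
    then have "a = 0" by simp
    then show ?thesis using * by simp
  qed
  have nonnull: "T X X = 0" if X: "X \<in> W" "?b X X \<noteq> 0" for X
  proof -
    \<comment> \<open>Otherwise everything orthogonal to \<open>E\<close> and \<open>X\<close> is
      null, hence totally null by polarization, and a nonzero such \<open>Y\<close> is orthogonal to
      the whole space. For \<open>Y\<close> to exist the dimension must exceed 2; dimension 1 is
      impossible because there \<open>X\<close> is a multiple of \<open>E\<close> and orthogonal to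
      it, so null.\<close>
    have "\<exists>Y\<in>W. ?b X Y = 0 \<and> ?b Y Y \<noteq> 0"
    proof (rule ccontr)
      assume "\<not> ?thesis"
      then have null: "?b Y Y = 0" if "Y \<in> W" "?b X Y = 0" for Y using that by blast
      have 2: "CARD('n) > 2"
      proof -
        have "CARD('n) \<noteq> 1"
        proof
          assume "CARD('n) = 1"
          then obtain i :: 'n where i: "UNIV = {i}" by (auto simp: card_1_singleton_iff)
          then have one: "j = i" for j by blast
          have "E $ i \<noteq> 0"
          proof
            assume "E $ i = 0"
            then have "E $ j = 0" for j unfolding one[of j] .
            then have "E = 0" by (simp add: vec_eq_iff)
            then show False using EE by (simp add: ip_linear)
          qed
          define c where "c = X $ i / E $ i"
          have "X $ j = c * E $ j" for j
            unfolding one[of j] c_def using \<open>E $ i \<noteq> 0\<close> by simp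
          then have "X = c *\<^sub>R E" by (simp add: vec_eq_iff)
          then have "?b X X = ?b X (c *\<^sub>R E)" by (rule arg_cong)
          also have "\<dots> = 0" using X(1) by (simp only: ip_linear W_def) simp
          finally show False using X(2) by blast
        qed
        moreover have "CARD('n) \<noteq> 0" by simp
        ultimately show ?thesis using card by linarith
      qed
      have "dim {H *v E, H *v X} \<le> card {H *v E, H *v X}" by (simp add: dim_le_card')
      also have "\<dots> \<le> 2" by (simp add: card_insert_if)
      finally have "dim {H *v E, H *v X} < DIM(real^'n)" using 2 by simp
      then obtain Y where Y: "Y \<noteq> 0" "\<And>z. z \<in> span {H *v E, H *v X} \<Longrightarrow> orthogonal Y z"
        using orthogonal_to_subspace_exists by blast
      then have YE: "?b Y E = 0" and YX: "?b Y X = 0"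
        by (simp_all add: ip_def orthogonal_def span_base)
      have "?b Y v = 0" for v
      proof -
        define Z where "Z = v - (?b v E / ?b E E) *\<^sub>R E - (?b v X / ?b X X) *\<^sub>R X"
        have XE: "?b X E = 0" "?b E X = 0" using X comm by (auto simp: W_def)
        have ZE: "?b Z E = 0" and ZX: "?b Z X = 0"
          using EE X(2) XE by (simp_all add: Z_def ip_linear)
        have "?b (Y + Z) (Y + Z) = 0" "?b Y Y = 0" "?b Z Z = 0"
          using null[of "Y + Z"] null[of Y] null[of Z] YE YX ZE ZX comm[of X] by (auto simp: W_def ip_linear)
        then have "?b Y Z = 0" using comm[of Z Y] by (simp add: ip_linear)
        then show ?thesis using YE YX by (simp add: Z_def ip_linear)
      qed
      then show False using nd Y(1) by blast
    qed
    then show ?thesis using pair X by blast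
  qed
  have null: "T X X = 0" if X: "X \<in> W" for X
  proof (cases "?b X X = 0 \<and> X \<noteq> 0")
    case False
    then show ?thesis using nonnull[OF X] linear_0[OF lin] by auto
  next
    case True
    then obtain v where v: "?b X v \<noteq> 0" using nd by blast
    define Z0 where "Z0 = v - (?b v E / ?b E E) *\<^sub>R E"
    have Z0: "Z0 \<in> W" "?b X Z0 \<noteq> 0" using EE v X by (auto simp: Z0_def W_def ip_linear)
    \<comment> \<open>If \<open>Z0\<close> is null, \<open>X + Z0\<close> has square norm
      \<open>2 ?b X Z0\<close>, so one of the two is non-null. On the line through the null
      \<open>X\<close> in direction \<open>Z\<close>, \<open>T v v\<close> vanishes at each non-null
      vector \<open>v\<close>.\<close>
    define Z where "Z = (if ?b Z0 Z0 = 0 then X + Z0 else Z0)"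
    have Z: "Z \<in> W" "?b X Z \<noteq> 0" "?b Z Z \<noteq> 0"
      using Z0 True X comm[of Z0 X] W_add by (auto simp: Z_def ip_linear)
    have TZ: "T Z Z = 0" by (rule nonnull[OF Z(1,3)])
    have *: "T X X + (2 * t) *\<^sub>R T X Z = 0" if "2 * t * ?b X Z + t * t * ?b Z Z \<noteq> 0" for t
    proof -
      have "?b (X + t *\<^sub>R Z) (X + t *\<^sub>R Z) \<noteq> 0"
        using True that comm[of Z X] by (simp add: ip_linear algebra_simps)
      then have "T (X + t *\<^sub>R Z) (X + t *\<^sub>R Z) = 0"
        by (rule nonnull[OF W_add(1)[OF X W_add(3)[OF Z(1) Z(1)]]])
      moreover have "T (X + t *\<^sub>R Z) (X + t *\<^sub>R Z) = T X X + (t *\<^sub>R T X Z + t *\<^sub>R T X Z)"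
      proof -
        have "T (X + t *\<^sub>R Z) (X + t *\<^sub>R Z)
            = T X X + t *\<^sub>R T Z X + t *\<^sub>R (T X Z + t *\<^sub>R T Z Z)"
          unfolding linear_add[OF lin] linear_add[OF lin'] linear_cmul[OF lin] linear_cmul[OF lin']
          by (rule refl)
        then show ?thesis unfolding sym[of Z X] TZ by simp
      qed
      ultimately show ?thesis by (simp add: scaleR_add_left[symmetric])
    qed
    \<comment> \<open>At the parameters \<open>t\<close> and \<open>2 t\<close> the square norm is 3
      and 8 times \<open>(?b X Z)^2 / ?b Z Z\<close>, hence nonzero. The vanishing expression is
      affine in the parameter, so it also vanishes at 0, where it is \<open>T X X\<close>.\<close>
    define t where "t = ?b X Z / ?b Z Z"
    have "2 * t * ?b X Z + t * t * ?b Z Z \<noteq> 0" "2 * (2 * t) * ?b X Z + (2 * t) * (2 * t) * ?b Z Z \<noteq> 0"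
      using Z by (auto simp: t_def field_simps)
    from *[OF this(1)] *[OF this(2)] have 1: "T X X + P = 0" and 2: "T X X + (P + P) = 0"
      if "P = (2 * t) *\<^sub>R T X Z" for P
      using that by (simp_all add: scaleR_add_left[symmetric])
    have "(T X X + (P + P)) - (T X X + P) = P" for P by simp
    then show ?thesis using 1[OF refl] 2[OF refl] by (metis add.right_neutral diff_self)
  qed
  have quad: "T v v = 0" for v
  proof -
    \<comment> \<open>Off \<open>W\<close> the \<open>E\<close>-component is discarded, since
      \<open>T E\<close> vanishes; the rest is polarization.\<close>
    let ?k = "?b v E / ?b E E"
    have "v - ?k *\<^sub>R E \<in> W" using EE by (simp add: W_def ip_linear)
    from null[OF this] show ?thesis by (simp add: Tl TE TE')
  qed
  have "T (u + v) (u + v) = T u u + T v v + 2 *\<^sub>R T u v"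
    using sym[of u v] by (simp add: Tl(1,2) scaleR_2 algebra_simps)
  then show ?thesis using quad by simp
qed

section \<open>Radiant connections in a chart\<close>

text \<open>The curvature \<open>R(u,v)w\<close> in coordinates, for \<open>u\<close>,
  \<open>v\<close>, \<open>w\<close> extended as constant fields.\<close>

definition rcurv ::
  "(real^'n \<Rightarrow> real^'n^'n^'n) \<Rightarrow> real^'n \<Rightarrow> real^'n \<Rightarrow> real^'n \<Rightarrow> real^'n \<Rightarrow> real^'n::finite" where
  "rcurv G x u v w = chris (dd G x u) v w - chris (dd G x v) u w
    + chris (G x) u (chris (G x) v w) - chris (G x) v (chris (G x) u w)"

text \<open>The covariant derivative of the metric in direction \<open>u\<close>, evaluated on
  \<open>v\<close> and \<open>w\<close>.\<close>

definition nm ::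
  "(real^'n \<Rightarrow> real^'n^'n^'n) \<Rightarrow> (real^'n \<Rightarrow> real^'n^'n) \<Rightarrow> real^'n \<Rightarrow> real^'n \<Rightarrow> real^'n \<Rightarrow> real^'n::finite \<Rightarrow> real" where
  "nm G h x u v w = ip (dd h x u) v w - ip (h x) (chris (G x) u v) w - ip (h x) v (chris (G x) u w)"

lemma bounded_linear_chris_conn: "bounded_linear (\<lambda>\<Gamma>. chris \<Gamma> u v)"
  using linear_chris_conn linear_conv_bounded_linear by blast

lemma bounded_linear_ip_form: "bounded_linear (\<lambda>H. ip H u v)"
  using linear_ip_form linear_conv_bounded_linear by blast

lemma linear_rcurv3: "linear (rcurv G x u v)"
  by (rule linearI) (simp_all add: rcurv_def chris_linear algebra_simps)

lemma linear_rcurv2: "linear (dd G x) \<Longrightarrow> linear (\<lambda>v. rcurv G x u v w)"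
  by (rule linearI) (simp_all add: rcurv_def chris_linear linear_add linear_cmul algebra_simps)

lemma linear_rcurv1: "linear (dd G x) \<Longrightarrow> linear (\<lambda>u. rcurv G x u v w)"
  by (rule linearI) (simp_all add: rcurv_def chris_linear linear_add linear_cmul algebra_simps)

lemma linear_nm:
  assumes "linear (dd h x)"
  shows "linear (\<lambda>u. nm G h x u v w)" "linear (\<lambda>v. nm G h x u v w)" "linear (nm G h x u v)"
  by (rule linearI; simp add: nm_def chris_linear ip_linear linear_add[OF assms]
      linear_cmul[OF assms] algebra_simps)+

lemma nabla_vec_eq: "nabla_vec G Y x j k = (dd Y x (axis j 1) + chris (G x) (axis j 1) (Y x)) $ k"
  by (simp add: nabla_vec_def pd_def chris_axis_left)

lemma nabla_metric_eq: "nabla_metric G h x i j k = nm G h x (axis i 1) (axis j 1) (axis k 1)"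
  by (simp only: nabla_metric_def nm_def pd_def ip_axis)
    (simp add: ip_axis_left ip_axis_right chris_axis mult.commute)

lemma sum_axis_linear:
  fixes f :: "real^'n::finite \<Rightarrow> 'b::real_vector"
  assumes "linear f"
  shows "(\<Sum>p\<in>UNIV. v $ p *\<^sub>R f (axis p 1)) = f v"
  using linear_sum[OF assms, of "\<lambda>p. v $ p *\<^sub>R axis p 1" UNIV] basis_expansion[of v]
  by (simp add: linear_cmul[OF assms] scalar_mult_eq_scaleR)

lemma lie_metric_eq:
  assumes "h differentiable at x"
  shows "lie_metric E h x i j = ip (dd h x (E x)) (axis i 1) (axis j 1)
    + ip (h x) (dd E x (axis i 1)) (axis j 1) + ip (h x) (axis i 1) (dd E x (axis j 1))"
proof -
  have "dd h x (E x) = (\<Sum>p\<in>UNIV. E x $ p *\<^sub>R dd h x (axis p 1))"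
    by (rule sum_axis_linear[symmetric, OF linear_frechet_derivative[OF assms]])
  then have "dd h x (E x) $ i $ j = (\<Sum>p\<in>UNIV. E x $ p * dd h x (axis p 1) $ i $ j)"
    by simp
  then show ?thesis
    by (simp only: lie_metric_def pd_def ip_axis) (simp add: ip_axis_left ip_axis_right)
qed

text \<open>Only what a radiant connection shares with its conjugate, and no metric, so that every
  result here holds for both.\<close>

locale radiant_chart =
  fixes S :: "(real^'n::finite) set" and G :: "real^'n \<Rightarrow> real^'n^'n^'n" and E :: "real^'n \<Rightarrow> real^'n"
  assumes open_S: "open S" and smooth_G: "smooth_on G S" and smooth_E: "smooth_on E S"
    and chris_sym: "x \<in> S \<Longrightarrow> chris (G x) u v = chris (G x) v u"
    and radiance: "x \<in> S \<Longrightarrow> dd E x u + chris (G x) u (E x) = u"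
begin

lemma dd_E: "x \<in> S \<Longrightarrow> dd E x u = u - chris (G x) u (E x)"
  using radiance[of x u] by (simp add: algebra_simps)

lemma has_derivative_G: "x \<in> S \<Longrightarrow> (G has_derivative dd G x) (at x)"
  and has_derivative_E: "x \<in> S \<Longrightarrow> (E has_derivative dd E x) (at x)"
  using smooth_G smooth_E smooth_on_has_derivative by blast+

lemma linear_dd_G: "x \<in> S \<Longrightarrow> linear (dd G x)"
  using has_derivative_G has_derivative_linear by blast

lemma has_derivative_chris_const:
  "x \<in> S \<Longrightarrow> ((\<lambda>y. chris (G y) u v) has_derivative (\<lambda>w. chris (dd G x w) u v)) (at x)"
  by (rule bounded_linear.has_derivative[OF bounded_linear_chris_conn has_derivative_G])

lemma dd_chris_const: "x \<in> S \<Longrightarrow> dd (\<lambda>y. chris (G y) u v) x w = chris (dd G x w) u v"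
  using dd_eqI[OF has_derivative_chris_const] by simp

lemma dd_G_sym:
  assumes "x \<in> S"
  shows "chris (dd G x w) u v = chris (dd G x w) v u"
proof -
  have "dd (\<lambda>y. chris (G y) u v) x = dd (\<lambda>y. chris (G y) v u) x"
    by (rule dd_cong_open[OF open_S assms chris_sym])
  then show ?thesis by (metis dd_chris_const assms)
qed

lemma dd2_E:
  assumes x: "x \<in> S"
  shows "dd (\<lambda>y. dd E y v) x u = - chris (dd G x u) v (E x) - chris (G x) v (dd E x u)"
proof -
  have "((\<lambda>y. v - chris (G y) v (E y)) has_derivative
      (\<lambda>k. 0 - (chris (dd G x k) v (E x) + chris (G x) 0 (E x) + chris (G x) v (dd E x k)))) (at x)"
    by (intro has_derivative_diff has_derivative_chris has_derivative_const has_derivative_G has_derivative_E x)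
  from dd_eqI[OF this] have "dd (\<lambda>y. v - chris (G y) v (E y)) x u
      = - chris (dd G x u) v (E x) - chris (G x) v (dd E x u)"
    by (simp add: chris_linear)
  moreover have "dd (\<lambda>y. dd E y v) x = dd (\<lambda>y. v - chris (G y) v (E y)) x"
    by (rule dd_cong_open[OF open_S x dd_E])
  ultimately show ?thesis by simp
qed

lemma lie_conn_const:
  assumes x: "x \<in> S"
  shows "lie_conn E G (\<lambda>_. u) (\<lambda>_. v) x = chris (dd G x (E x)) u v - dd E x (chris (G x) u v)
    + chris (G x) (dd E x u) v + chris (G x) u (dd E x v) + dd (\<lambda>y. dd E y v) x u"
proof -
  have "dd (\<lambda>y. - dd E y v) x u = - dd (\<lambda>y. dd E y v) x u"
    by (simp add: dd_eqI[OF has_derivative_minus[OF smooth_on_has_derivative[OF smooth_on_dd[OF smooth_E] x]]])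
  then show ?thesis
    by (simp add: lie_conn_def lie_bracket_def cov_def dd_chris_const x chris_linear algebra_simps)
qed

text \<open>For a torsion-free connection the Lie derivative along \<open>E\<close> is the second
  covariant derivative of \<open>E\<close> plus \<open>R(E,u)v\<close>. Radiance makes the covariant
  derivative of \<open>E\<close> the identity, which is parallel, so only the curvature
  remains.\<close>

lemma lie_conn_eq_rcurv:
  assumes x: "x \<in> S"
  shows "lie_conn E G (\<lambda>_. u) (\<lambda>_. v) x = rcurv G x (E x) u v"
proof -
  let ?C = "chris (G x)"
  have "lie_conn E G (\<lambda>_. u) (\<lambda>_. v) x = chris (dd G x (E x)) u v - (?C u v - ?C (?C u v) (E x))
      + ?C (dd E x u) v + ?C u (v - ?C v (E x)) + (- chris (dd G x u) v (E x) - ?C v (dd E x u))"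
    unfolding lie_conn_const[OF x] dd2_E[OF x] dd_E[OF x, of v] dd_E[OF x, of "?C u v"] ..
  also have "\<dots> = rcurv G x (E x) u v"
    unfolding chris_sym[OF x, of "?C u v" "E x"] chris_sym[OF x, of "dd E x u" v]
      chris_sym[OF x, of v "E x"] dd_G_sym[OF x, of u v "E x"] rcurv_def
    by (simp add: chris_linear)
  finally show ?thesis .
qed

text \<open>Clear for the Lie derivative of a symmetric connection: in coordinates the only second
  derivatives are those of \<open>E\<close>, and these commute.\<close>

lemma rcurv_E_sym:
  assumes x: "x \<in> S"
  shows "rcurv G x (E x) u v = rcurv G x (E x) v u"
  unfolding lie_conn_eq_rcurv[OF x, symmetric] lie_conn_const[OF x]
    second_derivative_symmetric[OF open_S x smooth_E, of u v] chris_sym[OF x, of "dd E x u" v]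
    chris_sym[OF x, of "dd E x v" u] chris_sym[OF x, of u v] dd_G_sym[OF x, of "E x" u v]
  by simp

lemma rcurv_E_E: "rcurv G x (E x) (E x) v = 0"
  by (simp add: rcurv_def)

lemma continuous_on_rcurv: "continuous_on S (\<lambda>x. rcurv G x (E x) u v)"
proof -
  have "continuous_on S (\<lambda>x. chris (dd G x (E x)) u v - chris (dd G x u) (E x) v
    + chris (G x) (E x) (chris (G x) u v) - chris (G x) u (chris (G x) (E x) v))"
  proof (intro smooth_on_continuous_on smooth_on_add smooth_on_diff smooth_on_chris open_S
      smooth_on_const smooth_G smooth_E)
    have "smooth_on (\<lambda>x. \<Sum>b\<in>Basis. (E x \<bullet> b) *\<^sub>R dd G x b) S"
      by (intro smooth_on_sum open_S smooth_on_bilinear[OF bounded_bilinear_scaleR]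
          smooth_on_linear[OF bounded_linear_inner_left] smooth_E smooth_on_dd smooth_G)
    then show "smooth_on (\<lambda>x. dd G x (E x)) S"
      by (subst smooth_on_cong[OF open_S dd_eq_sum_Basis])
        (auto intro: smooth_on_differentiable[OF smooth_G])
  qed (rule smooth_on_dd[OF smooth_G])
  then show ?thesis by (simp only: rcurv_def)
qed

end

section \<open>Pairs of dual radiant connections\<close>

text \<open>Conjugacy is encoded by the duality \<open>dual\<close>, which avoids the inverse
  metric. The difference of the two connections, lowered by \<open>h\<close>, is then the covariant
  derivative of \<open>h\<close>, so the Codazzi equation is expressed by torsion-freeness of both
  connections, and the condition on the Lie derivative of \<open>h\<close> by their
  radiance.\<close>

locale dual_chart = A: radiant_chart S G E + B: radiant_chart S G' E
  for S :: "(real^'n::finite) set" and G G' E +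
  fixes h :: "real^'n \<Rightarrow> real^'n^'n"
  assumes smooth_h: "smooth_on h S"
    and transpose_h: "x \<in> S \<Longrightarrow> transpose (h x) = h x" and inv_h: "x \<in> S \<Longrightarrow> invertible (h x)"
    and dual: "x \<in> S \<Longrightarrow> ip (dd h x u) v w = ip (h x) (chris (G' x) u v) w + ip (h x) v (chris (G x) u w)"
begin

lemma ip_h_commute: "x \<in> S \<Longrightarrow> ip (h x) u v = ip (h x) v u"
  using ip_commute transpose_h by blast

lemma has_derivative_h: "x \<in> S \<Longrightarrow> (h has_derivative dd h x) (at x)"
  using smooth_h smooth_on_has_derivative by blast

text \<open>Differentiate \<open>dual\<close> once more and antisymmetrize in the two directions:
  the second derivatives of \<open>h\<close> cancel, and so do the products with one symbol of each
  connection.\<close>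

lemma rcurv_dual:
  assumes x: "x \<in> S"
  shows "ip (h x) (rcurv G' x a b v) w = - ip (h x) v (rcurv G x a b w)"
proof -
  have *: "ip (dd (\<lambda>y. dd h y a) x b) v w =
      ip (h x) (chris (G' x) b (chris (G' x) a v)) w + ip (h x) (chris (G' x) a v) (chris (G x) b w)
      + ip (h x) (chris (dd G' x b) a v) w + ip (h x) (chris (G' x) b v) (chris (G x) a w)
      + ip (h x) v (chris (G x) b (chris (G x) a w)) + ip (h x) v (chris (dd G x b) a w)" for a b
  proof -
    have "dd (\<lambda>y. ip (dd h y a) v w) x b = ip (dd (\<lambda>y. dd h y a) x b) v w"
      by (rule dd_linear[OF bounded_linear_ip_form])
        (use smooth_on_dd[OF smooth_h] smooth_on_differentiable x in blast)
    moreover have "dd (\<lambda>y. ip (dd h y a) v w) x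
        = dd (\<lambda>y. ip (h y) (chris (G' y) a v) w + ip (h y) v (chris (G y) a w)) x"
      by (rule dd_cong_open[OF A.open_S x dual])
    moreover have "((\<lambda>y. ip (h y) (chris (G' y) a v) w + ip (h y) v (chris (G y) a w)) has_derivative
        (\<lambda>k. (ip (dd h x k) (chris (G' x) a v) w + ip (h x) (chris (dd G' x k) a v) w + ip (h x) (chris (G' x) a v) 0)
          + (ip (dd h x k) v (chris (G x) a w) + ip (h x) 0 (chris (G x) a w) + ip (h x) v (chris (dd G x k) a w)))) (at x)"
      by (intro has_derivative_add has_derivative_ip has_derivative_h A.has_derivative_chris_const
          B.has_derivative_chris_const has_derivative_const x)
    ultimately show ?thesis by (simp add: dd_eqI dual[OF x] ip_linear)
  qed
  have "dd (\<lambda>y. dd h y a) x b = dd (\<lambda>y. dd h y b) x a"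
    by (rule second_derivative_symmetric[OF A.open_S x smooth_h])
  then show ?thesis using *[of a b] *[of b a] by (simp add: rcurv_def ip_linear)
qed

text \<open>Moving a vector across \<open>h\<close> turns \<open>T\<close> into \<open>-T'\<close>
  (\<open>rcurv_dual\<close>), so the symmetry of \<open>T'\<close> becomes a symmetry of
  \<open>h(T(u,v),w)\<close> in \<open>u\<close> and \<open>w\<close>. Together with the symmetry of
  \<open>T\<close> this generates all permutations.\<close>

lemma rcurv_cubic:
  assumes x: "x \<in> S"
  shows "ip (h x) (rcurv G x (E x) u v) w = ip (h x) (rcurv G x (E x) u w) v"
proof -
  let ?T = "rcurv G x (E x)" and ?T' = "rcurv G' x (E x)"
  have a: "ip (h x) (?T u v) w = - ip (h x) (?T' u w) v" for u v w
    using rcurv_dual[OF x, of "E x" u w v] ip_h_commute[OF x, of w "?T u v"] by simp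
  have b: "ip (h x) (?T u v) w = ip (h x) (?T w v) u" for u v w
    unfolding a B.rcurv_E_sym[OF x, of u w] ..
  have "ip (h x) (?T u v) w = ip (h x) (?T v w) u"
    unfolding b[of u v w] A.rcurv_E_sym[OF x, of w v] ..
  also have "\<dots> = ip (h x) (?T u w) v" by (rule b)
  finally show ?thesis .
qed

text \<open>By duality the derivative is \<open>h(\<nabla>'E, E) + h(E, \<nabla>E)\<close>, and both
  covariant derivatives of \<open>E\<close> are the identity.\<close>

lemma dd_norm_E:
  assumes x: "x \<in> S"
  shows "((\<lambda>y. ip (h y) (E y) (E y)) has_derivative (\<lambda>u. 2 * ip (h x) u (E x))) (at x)"
proof -
  have "((\<lambda>y. ip (h y) (E y) (E y)) has_derivative
      (\<lambda>u. ip (dd h x u) (E x) (E x) + ip (h x) (dd E x u) (E x) + ip (h x) (E x) (dd E x u))) (at x)"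
    by (intro has_derivative_ip has_derivative_h A.has_derivative_E x)
  moreover have "ip (dd h x u) (E x) (E x) + ip (h x) (dd E x u) (E x) + ip (h x) (E x) (dd E x u)
      = 2 * ip (h x) u (E x)" for u
  proof -
    have "ip (h x) (chris (G' x) u (E x) + dd E x u) (E x) = ip (h x) u (E x)"
      "ip (h x) (E x) (chris (G x) u (E x) + dd E x u) = ip (h x) (E x) u"
      using A.radiance[OF x, of u] B.radiance[OF x, of u] by (simp_all only: add.commute)
    then show ?thesis using ip_h_commute[OF x, of "E x" u] by (simp add: dual[OF x] ip_linear)
  qed
  ultimately show ?thesis by simp
qed

text \<open>The points where \<open>E\<close> is null are nowhere dense, because the differential of its square norm is
  twice the nowhere vanishing covector dual to \<open>E\<close>.\<close>

lemma cubic_eq_0: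
  fixes K :: "real^'n \<Rightarrow> real^'n \<Rightarrow> real^'n \<Rightarrow> real^'n"
  assumes card: "CARD('n) \<noteq> 2" and nz: "\<And>x. x \<in> S \<Longrightarrow> E x \<noteq> 0"
    and cont: "\<And>u v. continuous_on S (\<lambda>x. K x u v)"
    and lin: "\<And>x u. x \<in> S \<Longrightarrow> linear (K x u)"
    and sym: "\<And>x u v. x \<in> S \<Longrightarrow> K x u v = K x v u"
    and cub: "\<And>x u v w. x \<in> S \<Longrightarrow> ip (h x) (K x u v) w = ip (h x) (K x u w) v"
    and KE: "\<And>x v. x \<in> S \<Longrightarrow> K x (E x) v = 0"
    and span: "\<And>x v. x \<in> S \<Longrightarrow> K x v v \<in> span {E x, v}"
    and x: "x \<in> S"
  shows "K x u v = 0"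
proof (rule ccontr)
  assume ne: "K x u v \<noteq> 0"
  let ?U = "S \<inter> (\<lambda>x. K x u v) -` (- {0})"
  have U: "open ?U"
    by (rule continuous_open_preimage[OF cont A.open_S]) (simp add: open_Compl)
  have xU: "x \<in> ?U" using x ne by simp
  have null: "ip (h y) (E y) (E y) = 0" if "y \<in> ?U" for y
  proof (rule ccontr)
    assume "ip (h y) (E y) (E y) \<noteq> 0"
    then have "K y u v = 0"
      using that cubic_form_eq_0[OF card inv_h transpose_h lin sym cub KE span, of y] by blast
    then show False using that by simp
  qed
  have "dd (\<lambda>y. ip (h y) (E y) (E y)) x = dd (\<lambda>y. 0) x"
    by (rule dd_cong_open[OF U xU null])
  then have "(\<lambda>u. 2 * ip (h x) u (E x)) = (\<lambda>u. 0)"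
    using dd_eqI[OF dd_norm_E[OF x]] by simp
  then have "ip (h x) u (E x) = 0" for u by (simp add: fun_eq_iff)
  then have "ip (h x) (E x) u = 0" for u using ip_h_commute[OF x] by simp
  then show False using ip_nondegenerate[OF inv_h transpose_h] x nz by blast
qed

text \<open>The span condition concerns \<open>G\<close> alone; \<open>rcurv_dual\<close> carries
  the vanishing over to \<open>G'\<close>.\<close>

lemma rcurv_E_eq_0:
  assumes card: "CARD('n) \<noteq> 2" and nz: "\<And>x. x \<in> S \<Longrightarrow> E x \<noteq> 0"
    and span: "\<And>x v. x \<in> S \<Longrightarrow> rcurv G x (E x) v v \<in> span {E x, v}" and x: "x \<in> S"
  shows "rcurv G x (E x) u v = 0" "rcurv G' x (E x) u v = 0"
proof -
  show *: "rcurv G x (E x) u v = 0" for u v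
    by (rule cubic_eq_0[where K = "\<lambda>x. rcurv G x (E x)", OF card nz A.continuous_on_rcurv linear_rcurv3
          A.rcurv_E_sym rcurv_cubic A.rcurv_E_E span x])
  show "rcurv G' x (E x) u v = 0"
  proof (rule ip_nondegenerate[OF inv_h[OF x] transpose_h[OF x]])
    show "ip (h x) (rcurv G' x (E x) u v) w = 0" for w
      by (simp add: rcurv_dual[OF x] * ip_linear)
  qed
qed

text \<open>The difference of the connections meets the hypotheses of \<open>cubic_eq_0\<close>:
  lowered by \<open>h\<close> it is the covariant derivative of \<open>h\<close>, symmetric in its
  last two arguments; torsion-freeness of both gives symmetry in the first two, and radiance of both
  kills \<open>E\<close>.\<close>

lemma conn_diff_eq_0:
  assumes card: "CARD('n) \<noteq> 2" and nz: "\<And>x. x \<in> S \<Longrightarrow> E x \<noteq> 0"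
    and span: "\<And>x v. x \<in> S \<Longrightarrow> chris (G' x) v v - chris (G x) v v \<in> span {E x, v}" and x: "x \<in> S"
  shows "chris (G' x) u v = chris (G x) u v"
proof -
  let ?K = "\<lambda>x u v. chris (G' x) u v - chris (G x) u v"
  have "?K x u v = 0"
  proof (rule cubic_eq_0[where K = ?K, OF card nz _ _ _ _ _ span x])
    show "continuous_on S (\<lambda>x. ?K x u v)" for u v
      by (intro smooth_on_continuous_on smooth_on_diff smooth_on_chris A.open_S A.smooth_G B.smooth_G
          smooth_on_const)
    show "linear (?K x u)" for x u by (intro linear_compose_sub linear_chris_right)
    fix x assume x: "x \<in> S"
    show "?K x u v = ?K x v u" for u v using A.chris_sym[OF x] B.chris_sym[OF x] by metis
    show "ip (h x) (?K x u v) w = ip (h x) (?K x u w) v" for u v w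
    proof -
      have "ip (dd h x u) v w = ip (dd h x u) w v"
      proof -
        have "dd (\<lambda>y. ip (h y) v w) x = dd (\<lambda>y. ip (h y) w v) x"
          by (rule dd_cong_open[OF A.open_S x ip_h_commute])
        then show ?thesis
          using dd_linear[OF bounded_linear_ip_form has_derivative_h[OF x, THEN differentiableI]] by metis
      qed
      then show ?thesis
        using ip_h_commute[OF x, of v "chris (G x) u w"] ip_h_commute[OF x, of w "chris (G x) u v"]
        by (simp add: dual[OF x] ip_linear)
    qed
    show "?K x (E x) v = 0" for v
      using A.dd_E[OF x, of v] B.dd_E[OF x, of v] A.chris_sym[OF x, of v] B.chris_sym[OF x, of v] by simp
  qed
  then show ?thesis by simp
qed

end

section \<open>The conjugate connection in a chart\<close>

text \<open>The components of \<open>conjugate\<close> in one chart, detached from the atlas so that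
  they can be treated in a locale about a single chart.\<close>

definition conj_chart ::
  "(real^'n \<Rightarrow> real^'n^'n) \<Rightarrow> (real^'n \<Rightarrow> real^'n^'n^'n) \<Rightarrow> real^'n \<Rightarrow> real^'n^'n^'n::finite" where
  "conj_chart h G x = (\<chi> i j k.
    G x $ i $ j $ k + (\<Sum>p\<in>UNIV. matrix_inv (h x) $ k $ p * nabla_metric G h x i j p))"

locale statistical_chart = radiant_chart +
  fixes h :: "real^'n::finite \<Rightarrow> real^'n^'n"
  assumes smooth_h: "smooth_on h S"
    and transpose_h: "x \<in> S \<Longrightarrow> transpose (h x) = h x" and inv_h: "x \<in> S \<Longrightarrow> invertible (h x)"
    and codazzi: "x \<in> S \<Longrightarrow> nm G h x u v w = nm G h x v u w"
    and lie_h: "x \<in> S \<Longrightarrow> ip (dd h x (E x)) u v + ip (h x) (dd E x u) v + ip (h x) u (dd E x v)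
      = 2 * ip (h x) u v"
begin

abbreviation G' :: "real^'n \<Rightarrow> real^'n^'n^'n" where
  "G' \<equiv> conj_chart h G"

lemma has_derivative_h: "x \<in> S \<Longrightarrow> (h has_derivative dd h x) (at x)"
  using smooth_h smooth_on_has_derivative by blast

lemma linear_dd_h: "x \<in> S \<Longrightarrow> linear (dd h x)"
  using has_derivative_h has_derivative_linear by blast

text \<open>Pairing with \<open>h\<close> removes the inverse metric. As \<open>h\<close> is
  nondegenerate this determines \<open>G'\<close>, and it replaces the definition in all algebraic
  arguments.\<close>

lemma ip_G':
  assumes x: "x \<in> S"
  shows "ip (h x) (chris (G' x) u v) w = ip (h x) (chris (G x) u v) w + nm G h x u v w"
proof -
  let ?L = "\<lambda>u v w. ip (h x) (chris (G' x) u v) w"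
    and ?R = "\<lambda>u v w. ip (h x) (chris (G x) u v) w + nm G h x u v w"
  have ax: "?L (axis i 1) (axis j 1) (axis k 1) = ?R (axis i 1) (axis j 1) (axis k 1)" for i j k
  proof -
    let ?a = "\<chi> p. nabla_metric G h x i j p"
    have "chris (G' x) (axis i 1) (axis j 1) = chris (G x) (axis i 1) (axis j 1) + matrix_inv (h x) *v ?a"
      by (simp add: chris_axis conj_chart_def vec_eq_iff matrix_vector_mult_def)
    moreover have "ip (h x) (matrix_inv (h x) *v ?a) (axis k 1) = nabla_metric G h x i j k"
    proof -
      have "ip (h x) (matrix_inv (h x) *v ?a) (axis k 1) = ip (h x) (axis k 1) (matrix_inv (h x) *v ?a)"
        by (rule ip_commute[OF transpose_h[OF x]])
      also have "\<dots> = axis k 1 \<bullet> ?a"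
        unfolding ip_def matrix_inv_mult_vec(1)[OF inv_h[OF x]] ..
      finally show ?thesis by (simp add: inner_axis')
    qed
    ultimately show ?thesis by (simp add: ip_linear nabla_metric_eq)
  qed
  show ?thesis
  proof (rule trilinear_eq_axis[where f = ?L and g = ?R, OF _ _ _ _ _ _ ax])
    show "linear (\<lambda>u. ?L u v w)" "linear (\<lambda>v. ?L u v w)" "linear (?L u v)" for u v w
      by (rule linearI; simp add: chris_linear ip_linear)+
    show "linear (\<lambda>u. ?R u v w)" "linear (\<lambda>v. ?R u v w)" "linear (?R u v)" for u v w
      by (intro linear_compose_add linear_nm[OF linear_dd_h[OF x]]; rule linearI; simp add: chris_linear ip_linear)+
  qed
qed

text \<open>For a torsion-free radiant connection the Lie derivative of \<open>h\<close> along
  \<open>E\<close> is the covariant derivative along \<open>E\<close> plus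
  \<open>2 h\<close>.\<close>

lemma nm_E:
  assumes x: "x \<in> S"
  shows "nm G h x (E x) u v = 0"
proof -
  have "nm G h x (E x) u v = 2 * ip (h x) u v
      - (ip (h x) (dd E x u + chris (G x) u (E x)) v + ip (h x) u (dd E x v + chris (G x) v (E x)))"
    using lie_h[OF x, of u v] chris_sym[OF x, of "E x"] by (simp add: nm_def ip_linear)
  then show ?thesis by (simp add: radiance[OF x])
qed

lemma smooth_G': "smooth_on G' S"
  unfolding conj_chart_def[abs_def] nabla_metric_def pd_def
  by (intro smooth_on_vec_lambda smooth_on_add smooth_on_diff smooth_on_sum
      smooth_on_bilinear[OF bounded_bilinear_mult] smooth_on_matrix_inv smooth_on_vec_nth
      open_S smooth_G smooth_h smooth_on_dd inv_h)

text \<open>Torsion-freeness of the conjugate is the Codazzi equation, its radiance is the vanishing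
  of the covariant derivative of \<open>h\<close> along \<open>E\<close>, and duality is
  \<open>ip_G'\<close> rewritten.\<close>

lemma dual_chart_G': "dual_chart S G G' E h"
proof unfold_locales
  show "open S" "smooth_on G' S" "smooth_on E S" "smooth_on h S"
    by (rule open_S smooth_G' smooth_E smooth_h)+
  fix x assume x: "x \<in> S"
  show "transpose (h x) = h x" "invertible (h x)" by (rule transpose_h[OF x] inv_h[OF x])+
  have ext: "a = b" if "\<And>w. ip (h x) a w = ip (h x) b w" for a b
    using ip_nondegenerate[OF inv_h[OF x] transpose_h[OF x], of "a - b"] that by (simp add: ip_linear)
  show sym: "chris (G' x) u v = chris (G' x) v u" for u v
    by (rule ext) (simp add: ip_G'[OF x] codazzi[OF x, of u v] chris_sym[OF x, of u v])
  have "chris (G' x) (E x) u = chris (G x) (E x) u" for u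
    by (rule ext) (simp add: ip_G'[OF x] nm_E[OF x])
  then show "dd E x u + chris (G' x) u (E x) = u" for u
    using radiance[OF x, of u] sym[of u "E x"] chris_sym[OF x, of u "E x"] by simp
  show "ip (dd h x u) v w = ip (h x) (chris (G' x) u v) w + ip (h x) v (chris (G x) u w)" for u v w
    by (simp add: ip_G'[OF x] nm_def)
qed

end

section \<open>Two-dimensional spans\<close>

definition plane_map :: "'a::real_vector \<Rightarrow> 'a \<Rightarrow> real^2 \<Rightarrow> 'a" where
  "plane_map a b v = v $ 1 *\<^sub>R a + v $ 2 *\<^sub>R b"

lemma range_plane_map: "range (plane_map a b) = span {a, b}"
proof
  show "range (plane_map a b) \<subseteq> span {a, b}"
    unfolding plane_map_def by (intro image_subsetI span_add span_scale span_base) auto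
  show "span {a, b} \<subseteq> range (plane_map a b)"
  proof
    fix x assume "x \<in> span {a, b}"
    then obtain r s where "x = r *\<^sub>R a + s *\<^sub>R b"
      by (auto simp: span_insert algebra_simps)
    then have "x = plane_map a b (vector [r, s])" by (simp add: plane_map_def)
    then show "x \<in> range (plane_map a b)" by blast
  qed
qed

text \<open>The squared area of the parallelogram, nonzero exactly for independent vectors. Being
  polynomial, it makes independence an open condition and gives the coefficients of a vector in a
  moving frame by differentiable formulas.\<close>

definition gram :: "'a::real_inner \<Rightarrow> 'a \<Rightarrow> real" where
  "gram a b = (a \<bullet> a) * (b \<bullet> b) - (a \<bullet> b) * (a \<bullet> b)"

lemma gram_coords:
  assumes "z = r *\<^sub>R a + s *\<^sub>R b"
  shows "r * gram a b = (z \<bullet> a) * (b \<bullet> b) - (z \<bullet> b) * (a \<bullet> b)"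
    and "s * gram a b = (z \<bullet> b) * (a \<bullet> a) - (z \<bullet> a) * (a \<bullet> b)"
  using inner_commute[of b a] by (simp_all add: assms gram_def inner_add_left algebra_simps)

lemma inj_plane_map:
  assumes "gram a b \<noteq> 0"
  shows "inj (plane_map a b)"
proof (rule injI)
  fix v w assume "plane_map a b v = plane_map a b w"
  then have "0 = (v $ 1 - w $ 1) *\<^sub>R a + (v $ 2 - w $ 2) *\<^sub>R b"
    by (simp add: plane_map_def algebra_simps)
  from gram_coords[OF this] assms show "v = w" by (simp add: vec_eq_iff forall_2)
qed

lemma gram_nonzero:
  assumes "a \<noteq> 0" "b \<notin> span {a}"
  shows "gram a b \<noteq> 0"
proof
  assume g: "gram a b = 0"
  \<comment> \<open>The component of \<open>b\<close> orthogonal to \<open>a\<close>, scaled by the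
    square norm of \<open>a\<close> to avoid a division.\<close>
  let ?w = "(a \<bullet> a) *\<^sub>R b - (a \<bullet> b) *\<^sub>R a"
  have "?w \<bullet> ?w = (a \<bullet> a) * gram a b"
    using inner_commute[of b a] by (simp add: gram_def inner_diff_left inner_diff_right algebra_simps)
  then have "?w = 0" using g by simp
  then have "b = ((a \<bullet> b) / (a \<bullet> a)) *\<^sub>R a"
    using assms(1) by (simp add: field_simps eq_vector_fraction_iff vector_fraction_eq_iff)
  then show False using assms(2) by (metis span_base span_scale singletonI)
qed

lemma inj_gram_nonzero:
  fixes f :: "real^2 \<Rightarrow> 'a::real_inner"
  assumes "linear f" "inj f"
  shows "gram (f (axis 1 1)) (f (axis 2 1)) \<noteq> 0"
proof (rule gram_nonzero)
  show "f (axis 1 1) \<noteq> 0"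
    using assms by (metis axis_eq_0_iff linear_injective_0 zero_neq_one)
  show "f (axis 2 1) \<notin> span {f (axis 1 1)}"
  proof
    assume "f (axis 2 1) \<in> span {f (axis 1 1)}"
    then obtain r where "f (axis 2 1) = f (r *\<^sub>R axis 1 1)"
      by (auto simp: span_singleton linear_cmul[OF assms(1)])
    then have "axis 2 1 = r *\<^sub>R (axis 1 1 :: real^2)" using assms(2) by (simp add: inj_eq)
    then have "(axis 2 1 :: real^2) $ 2 = (r *\<^sub>R (axis 1 1 :: real^2)) $ 2" by simp
    then show False by (simp add: axis_def)
  qed
qed

lemma linear_eq_plane_map:
  assumes "linear f"
  shows "f v = plane_map (f (axis 1 1)) (f (axis 2 1)) v"
  using sum_axis_linear[OF assms, of v] by (simp add: UNIV_2 plane_map_def)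

lemma subspace_dim_2_eq_span:
  fixes L :: "'a::euclidean_space set"
  assumes "subspace L" "dim L = 2" "a \<in> L" "a \<noteq> 0"
  obtains b where "b \<in> L" "b \<notin> span {a}" "L = span {b, a}"
proof -
  have "\<not> L \<subseteq> span {a}"
  proof
    assume "L \<subseteq> span {a}"
    then have "dim L \<le> card {a}" by (rule dim_le_card) simp
    then show False using assms(2) by simp
  qed
  then obtain b where b: "b \<in> L" "b \<notin> span {a}" by blast
  have ind: "independent {b, a}"
    using b(2) assms(4) by (simp add: independent_insert)
  have "b \<noteq> a" using b(2) span_base by blast
  then have "card {b, a} = dim L" using assms(2) by simp
  then have "L \<subseteq> span {b, a}"
    using card_eq_dim[of "{b, a}" L] b(1) assms(3) ind by blast
  moreover have "span {b, a} \<subseteq> L" using b(1) assms(1,3) by (intro span_minimal) auto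
  ultimately show ?thesis using that b by blast
qed

lemma dim_span_pair:
  fixes a b :: "'a::euclidean_space"
  assumes "a \<noteq> 0" "b \<notin> span {a}"
  shows "dim (span {a, b}) = 2"
proof -
  have "independent {b, a}" using assms by (simp add: independent_insert)
  moreover have "b \<noteq> a" using assms(2) span_base by blast
  ultimately show ?thesis by (simp add: dim_span dim_eq_card_independent insert_commute)
qed

section \<open>Totally geodesic surfaces in a chart\<close>

text \<open>Total geodesy is stated for the frame fields \<open>dF(w)\<close> with \<open>w\<close>
  constant. A tangent field \<open>Z\<close> is a combination of two of them, and differentiating
  the coefficients only adds tangent vectors. The Gram formulas make the coefficients
  differentiable.\<close>

lemma tangent_covariant_derivative:
  fixes F :: "real^2 \<Rightarrow> real^'n::finite"
  assumes U: "open U" "s \<in> U" and F: "smooth_on F U" and inj: "\<And>t. t \<in> U \<Longrightarrow> inj (dd F t)"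
    and geo: "\<And>v w. dd (\<lambda>t. dd F t w) s v + chris \<Gamma> (dd F s v) (dd F s w) \<in> range (dd F s)"
    and Z: "Z differentiable at s" "\<And>t. t \<in> U \<Longrightarrow> Z t \<in> range (dd F t)"
  shows "dd Z s v + chris \<Gamma> (dd F s v) (Z s) \<in> range (dd F s)"
proof -
  define a b where "a t = dd F t (axis 1 1)" and "b t = dd F t (axis 2 1)" for t
  have lin: "linear (dd F t)" if "t \<in> U" for t using smooth_on_linear_dd[OF F that] .
  have g: "gram (a t) (b t) \<noteq> 0" if "t \<in> U" for t
    unfolding a_def b_def by (rule inj_gram_nonzero[OF lin[OF that] inj[OF that]])
  define r q where "r t = ((Z t \<bullet> a t) * (b t \<bullet> b t) - (Z t \<bullet> b t) * (a t \<bullet> b t)) / gram (a t) (b t)"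
    and "q t = ((Z t \<bullet> b t) * (a t \<bullet> a t) - (Z t \<bullet> a t) * (a t \<bullet> b t)) / gram (a t) (b t)" for t
  have eq: "Z t = r t *\<^sub>R a t + q t *\<^sub>R b t" if t: "t \<in> U" for t
  proof -
    obtain v where "Z t = dd F t v" using Z(2)[OF t] by blast
    then have *: "Z t = v $ 1 *\<^sub>R a t + v $ 2 *\<^sub>R b t"
      using linear_eq_plane_map[OF lin[OF t], of v] by (simp add: a_def b_def plane_map_def)
    from gram_coords[OF *] have "v $ 1 = r t" "v $ 2 = q t"
      using g[OF t] by (simp_all add: r_def q_def field_simps)
    then show ?thesis using * by simp
  qed
  have ab: "a differentiable at s" "b differentiable at s"
    unfolding a_def b_def using smooth_on_dd[OF F] smooth_on_differentiable U(2) by blast+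
  have in': "(\<lambda>t. f t \<bullet> g t) differentiable at s" if "f differentiable at s" "g differentiable at s"
    for f g :: "real^2 \<Rightarrow> real^'n"
    using has_derivative_inner[OF has_derivative_dd[OF that(1)] has_derivative_dd[OF that(2)]]
    by (rule differentiableI)
  have rq: "r differentiable at s" "q differentiable at s"
    unfolding r_def q_def using g[OF U(2)] unfolding gram_def
    by (intro differentiable_divide differentiable_diff differentiable_mult in' ab Z(1); simp)+
  have "((\<lambda>t. r t *\<^sub>R a t + q t *\<^sub>R b t) has_derivative
      (\<lambda>v. (r s *\<^sub>R dd a s v + dd r s v *\<^sub>R a s) + (q s *\<^sub>R dd b s v + dd q s v *\<^sub>R b s))) (at s)"
    by (intro has_derivative_add has_derivative_scaleR has_derivative_dd ab rq)
  then have "dd Z s v = (r s *\<^sub>R dd a s v + dd r s v *\<^sub>R a s) + (q s *\<^sub>R dd b s v + dd q s v *\<^sub>R b s)"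
    using dd_cong_open[OF U eq] by (simp add: dd_eqI)
  then have Zv: "dd Z s v + chris \<Gamma> (dd F s v) (Z s) = dd r s v *\<^sub>R a s + dd q s v *\<^sub>R b s
      + r s *\<^sub>R (dd a s v + chris \<Gamma> (dd F s v) (a s)) + q s *\<^sub>R (dd b s v + chris \<Gamma> (dd F s v) (b s))"
    unfolding eq[OF U(2)] by (simp add: chris_linear scaleR_add_right)
  have sub: "subspace (range (dd F s))"
    using linear_subspace_image[OF lin[OF U(2)] subspace_UNIV] .
  have "dd a s v + chris \<Gamma> (dd F s v) (a s) \<in> range (dd F s)"
    "dd b s v + chris \<Gamma> (dd F s v) (b s) \<in> range (dd F s)"
    unfolding a_def b_def by (rule geo)+
  moreover have "a s \<in> range (dd F s)" "b s \<in> range (dd F s)" by (simp_all add: a_def b_def)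
  ultimately show ?thesis
    unfolding Zv by - (assumption | rule subspace_add[OF sub] subspace_scale[OF sub])+
qed

text \<open>From the Gauss equation. \<open>N b c\<close> is the covariant derivative of
  \<open>dF(c)\<close> in direction \<open>b\<close>, itself a tangent field, so its covariant
  derivative is tangent again. Antisymmetrizing leaves the curvature, as the third derivatives of
  \<open>F\<close> cancel.\<close>

lemma rcurv_tangent:
  fixes F :: "real^2 \<Rightarrow> real^'n::finite"
  assumes S: "open S" "smooth_on G S" and U: "open U" "s \<in> U"
    and F: "smooth_on F U" "F ` U \<subseteq> S" and inj: "\<And>t. t \<in> U \<Longrightarrow> inj (dd F t)"
    and geo: "\<And>t v w. t \<in> U \<Longrightarrow>
      dd (\<lambda>t. dd F t w) t v + chris (G (F t)) (dd F t v) (dd F t w) \<in> range (dd F t)"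
  shows "rcurv G (F s) (dd F s a) (dd F s b) (dd F s c) \<in> range (dd F s)"
proof -
  have FS: "F s \<in> S" using F(2) U(2) by blast
  define N where "N b c t = dd (\<lambda>t. dd F t c) t b + chris (G (F t)) (dd F t b) (dd F t c)" for b c t
  have F2: "dd (\<lambda>t. dd F t b) s a = dd (\<lambda>t. dd F t a) s b" for a b
    by (rule second_derivative_symmetric[OF U F(1)])
  have dF: "((\<lambda>t. dd F t b) has_derivative dd (\<lambda>t. dd F t b) s) (at s)" for b
    by (rule smooth_on_has_derivative[OF smooth_on_dd[OF F(1)] U(2)])
  have N': "(N b c has_derivative (\<lambda>a. dd (\<lambda>t. dd (\<lambda>t. dd F t c) t b) s a +
      (chris (dd G (F s) (dd F s a)) (dd F s b) (dd F s c)
       + chris (G (F s)) (dd (\<lambda>t. dd F t b) s a) (dd F s c)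
       + chris (G (F s)) (dd F s b) (dd (\<lambda>t. dd F t c) s a)))) (at s)" for b c
    unfolding N_def
  proof (intro has_derivative_add has_derivative_chris dF)
    show "((\<lambda>t. dd (\<lambda>t. dd F t c) t b) has_derivative dd (\<lambda>t. dd (\<lambda>t. dd F t c) t b) s) (at s)"
      by (rule smooth_on_has_derivative[OF smooth_on_dd[OF smooth_on_dd[OF F(1)]] U(2)])
    show "((\<lambda>t. G (F t)) has_derivative (\<lambda>a. dd G (F s) (dd F s a))) (at s)"
      by (rule has_derivative_compose[OF smooth_on_has_derivative[OF F(1) U(2)] smooth_on_has_derivative[OF S(2) FS]])
  qed
  have tang: "dd (N b c) s a + chris (G (F s)) (dd F s a) (N b c s) \<in> range (dd F s)" for a b c
  proof (rule tangent_covariant_derivative[OF U F(1) inj geo[OF U(2)]])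
    show "N b c differentiable at s" using N' by (rule differentiableI)
    show "N b c t \<in> range (dd F t)" if "t \<in> U" for t unfolding N_def by (rule geo[OF that])
  qed
  have "dd (\<lambda>t. dd (\<lambda>t. dd F t c) t b) s a = dd (\<lambda>t. dd (\<lambda>t. dd F t c) t a) s b"
    by (rule second_derivative_symmetric[OF U smooth_on_dd[OF F(1)]])
  then have "rcurv G (F s) (dd F s a) (dd F s b) (dd F s c)
    = (dd (N b c) s a + chris (G (F s)) (dd F s a) (N b c s)) - (dd (N a c) s b + chris (G (F s)) (dd F s b) (N a c s))"
    using F2[of a b] by (simp add: dd_eqI[OF N'] rcurv_def N_def chris_linear)
  moreover have "subspace (range (dd F s))"
    using linear_subspace_image[OF smooth_on_linear_dd[OF F(1) U(2)] subspace_UNIV] .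
  ultimately show ?thesis using subspace_diff[OF _ tang tang] by simp
qed

section \<open>Existence of planelike surfaces in a chart\<close>

lemma smooth_on_Pair:
  assumes "open S" "smooth_on f S" "smooth_on g S"
  shows "smooth_on (\<lambda>x. (f x, g x)) S"
proof -
  have 1: "bounded_linear (\<lambda>a. (a, 0))" and 2: "bounded_linear (\<lambda>b. (0, b))"
    by (intro bounded_linear_Pair bounded_linear_ident bounded_linear_zero)+
  have "smooth_on (\<lambda>x. (f x, 0) + (0, g x)) S"
    by (rule smooth_on_add[OF assms(1) smooth_on_linear[OF 1 assms(1,2)] smooth_on_linear[OF 2 assms(1,3)]])
  then show ?thesis by simp
qed

context radiant_chart
begin

text \<open>The geodesic spray and the lift of \<open>E\<close> to the tangent bundle. They commute when \<open>E\<close> is affine.\<close>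

definition spray :: "(real^'n) \<times> (real^'n) \<Rightarrow> (real^'n) \<times> (real^'n)" where
  "spray z = (snd z, - chris (G (fst z)) (snd z) (snd z))"

definition lift :: "(real^'n) \<times> (real^'n) \<Rightarrow> (real^'n) \<times> (real^'n)" where
  "lift z = (E (fst z), snd z - chris (G (fst z)) (snd z) (E (fst z)))"

lemma smooth_G_fst: "smooth_on (\<lambda>z. G (fst z)) (S \<times> (UNIV :: (real^'n) set))"
  and smooth_E_fst: "smooth_on (\<lambda>z. E (fst z)) (S \<times> (UNIV :: (real^'n) set))"
  and smooth_snd: "smooth_on snd (S \<times> (UNIV :: (real^'n) set))"
proof -
  have o: "open (S \<times> (UNIV :: (real^'n) set))" using open_S by (intro open_Times) auto
  have f: "smooth_on fst (S \<times> (UNIV :: (real^'n) set))"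
    by (rule smooth_on_bounded_linear[OF bounded_linear_fst o])
  show "smooth_on snd (S \<times> (UNIV :: (real^'n) set))"
    by (rule smooth_on_bounded_linear[OF bounded_linear_snd o])
  show "smooth_on (\<lambda>z. G (fst z)) (S \<times> (UNIV :: (real^'n) set))"
    by (rule smooth_on_compose[where g = G and f = fst, OF o open_S _ smooth_G f]) auto
  show "smooth_on (\<lambda>z. E (fst z)) (S \<times> (UNIV :: (real^'n) set))"
    by (rule smooth_on_compose[where g = E and f = fst, OF o open_S _ smooth_E f]) auto
qed

lemma smooth_spray: "smooth_on spray (S \<times> UNIV)"
  and smooth_lift: "smooth_on lift (S \<times> UNIV)"
proof -
  have o: "open (S \<times> (UNIV :: (real^'n) set))" using open_S by (intro open_Times) auto
  show "smooth_on spray (S \<times> UNIV)"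
    unfolding spray_def[abs_def]
    by (intro smooth_on_Pair smooth_on_minus smooth_on_chris smooth_G_fst smooth_snd o)
  show "smooth_on lift (S \<times> UNIV)"
    unfolding lift_def[abs_def]
    by (intro smooth_on_Pair smooth_on_diff smooth_on_chris smooth_G_fst smooth_E_fst smooth_snd o)
qed

lemma has_derivative_spray:
  assumes x: "x \<in> S"
  shows "(spray has_derivative (\<lambda>k. (snd k, - (chris (dd G x (fst k)) P P + chris (G x) (snd k) P
    + chris (G x) P (snd k))))) (at (x, P))"
proof -
  have "((\<lambda>z. G (fst z)) has_derivative (\<lambda>k. dd G x (fst k))) (at (x, P))"
    by (rule has_derivative_compose[OF bounded_linear_imp_has_derivative[OF bounded_linear_fst]])
      (use has_derivative_G[OF x] in simp)
  then have "((\<lambda>z. (snd z, - chris (G (fst z)) (snd z) (snd z))) has_derivative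
    (\<lambda>k. (snd k, - (chris (dd G x (fst k)) (snd (x, P)) (snd (x, P)) + chris (G (fst (x, P))) (snd k) (snd (x, P))
    + chris (G (fst (x, P))) (snd (x, P)) (snd k))))) (at (x, P))"
    by (intro has_derivative_Pair has_derivative_minus has_derivative_chris
        bounded_linear_imp_has_derivative[OF bounded_linear_snd])
  then show ?thesis by (simp add: spray_def[abs_def])
qed

lemma has_derivative_lift:
  assumes x: "x \<in> S"
  shows "(lift has_derivative (\<lambda>k. (dd E x (fst k), snd k - (chris (dd G x (fst k)) P (E x)
    + chris (G x) (snd k) (E x) + chris (G x) P (dd E x (fst k)))))) (at (x, P))"
proof -
  have "((\<lambda>z. G (fst z)) has_derivative (\<lambda>k. dd G x (fst k))) (at (x, P))"
    by (rule has_derivative_compose[OF bounded_linear_imp_has_derivative[OF bounded_linear_fst]])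
      (use has_derivative_G[OF x] in simp)
  moreover have "((\<lambda>z. E (fst z)) has_derivative (\<lambda>k. dd E x (fst k))) (at (x, P))"
    by (rule has_derivative_compose[OF bounded_linear_imp_has_derivative[OF bounded_linear_fst]])
      (use has_derivative_E[OF x] in simp)
  ultimately have "((\<lambda>z. (E (fst z), snd z - chris (G (fst z)) (snd z) (E (fst z)))) has_derivative
    (\<lambda>k. (dd E x (fst k), snd k - (chris (dd G x (fst k)) (snd (x, P)) (E (fst (x, P)))
    + chris (G (fst (x, P))) (snd k) (E (fst (x, P))) + chris (G (fst (x, P))) (snd (x, P)) (dd E x (fst k)))))) (at (x, P))"
    by (intro has_derivative_Pair has_derivative_diff has_derivative_chris
        bounded_linear_imp_has_derivative[OF bounded_linear_snd])
  then show ?thesis by (simp add: lift_def[abs_def])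
qed

text \<open>The first components agree by radiance; the second ones differ, up to sign, by
  \<open>R(E,P)P\<close>.\<close>

lemma spray_lift_commute:
  assumes x: "x \<in> S" and R: "rcurv G x (E x) P P = 0"
  shows "dd spray (x, P) (lift (x, P)) = dd lift (x, P) (spray (x, P))"
proof -
  let ?C = "chris (G x)"
  have "dd E x P = P - ?C P (E x)" by (rule dd_E[OF x])
  moreover have "- (chris (dd G x (E x)) P P + ?C (P - ?C P (E x)) P + ?C P (P - ?C P (E x)))
      = - ?C P P - (chris (dd G x P) P (E x) + ?C (- ?C P P) (E x) + ?C P (P - ?C P (E x)))"
    using R unfolding rcurv_def chris_linear chris_sym[OF x, of "?C P P" "E x"]
      chris_sym[OF x, of "E x" P] dd_G_sym[OF x, of P "E x" P] chris_sym[OF x, of "?C P (E x)" P]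
    by (simp add: algebra_simps)
  ultimately show ?thesis
    by (simp add: dd_eqI[OF has_derivative_spray[OF x]] dd_eqI[OF has_derivative_lift[OF x]]
        spray_def lift_def)
qed

text \<open>With \<open>F\<close> and \<open>P\<close> the position and velocity of the joint flow,
  the tangent planes are spanned by \<open>P\<close> and \<open>E\<close>. The flow equations and
  radiance give the covariant derivatives: that of \<open>P\<close> is 0 along \<open>P\<close> and
  \<open>P\<close> along \<open>E\<close>, that of \<open>E\<close> is the identity. All lie in the
  span.\<close>

lemma planelike_patch:
  assumes x0: "x0 \<in> S" "E x0 \<noteq> 0" and R: "\<And>x u v. x \<in> S \<Longrightarrow> rcurv G x (E x) u v = 0"
    and L: "subspace L" "dim L = 2" "E x0 \<in> L"
  obtains U :: "(real^2) set" and F :: "real^2 \<Rightarrow> real^'n" where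
    "open U" "connected U" "0 \<in> U" "smooth_on F U" "F ` U \<subseteq> S" "F 0 = x0"
    "\<And>s. s \<in> U \<Longrightarrow> inj (dd F s)"
    "\<And>s v w. s \<in> U \<Longrightarrow>
      dd (\<lambda>t. dd F t w) s v + chris (G (F s)) (dd F s v) (dd F s w) \<in> range (dd F s)"
    "\<And>s. s \<in> U \<Longrightarrow> E (F s) \<in> range (dd F s)" "range (dd F 0) = L"
proof -
  obtain X where X: "X \<in> L" "X \<notin> span {E x0}" "L = span {X, E x0}"
    using subspace_dim_2_eq_span[OF L x0(2)] by blast
  have o: "open (S \<times> (UNIV :: (real^'n) set))" using open_S by (intro open_Times) auto
  have "dd spray z (lift z) = dd lift z (spray z)" if "z \<in> S \<times> UNIV" for z
    using spray_lift_commute[of "fst z" "snd z"] R that by auto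
  then obtain \<delta> u where \<delta>: "\<delta> > 0" and u0: "u (0, 0) = (x0, X)"
    and uS: "\<And>s t. \<bar>s\<bar> < \<delta> \<Longrightarrow> \<bar>t\<bar> < \<delta> \<Longrightarrow> u (s, t) \<in> S \<times> UNIV"
    and u': "\<And>s t. \<bar>s\<bar> < \<delta> \<Longrightarrow> \<bar>t\<bar> < \<delta> \<Longrightarrow>
      (u has_derivative (\<lambda>p. fst p *\<^sub>R spray (u (s, t)) + snd p *\<^sub>R lift (u (s, t)))) (at (s, t))"
    using commuting_flow[OF o _ smooth_spray smooth_lift, of "(x0, X)"] x0(1) by blast
  define F P where "F s = fst (u (s $ 1, s $ 2))" and "P s = snd (u (s $ 1, s $ 2))" for s :: "real^2"
  let ?B = "ball (0 :: real^2) \<delta>"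
  have comp: "\<bar>s $ 1\<bar> < \<delta>" "\<bar>s $ 2\<bar> < \<delta>" if "s \<in> ?B" for s :: "real^2"
    using that component_le_norm_cart[of s 1] component_le_norm_cart[of s 2] by auto
  have FS: "F s \<in> S" if "s \<in> ?B" for s using uS[OF comp[OF that]] by (auto simp: F_def)
  have F': "(F has_derivative plane_map (P s) (E (F s))) (at s)"
    and P': "(P has_derivative (\<lambda>v. v $ 1 *\<^sub>R (- chris (G (F s)) (P s) (P s))
      + v $ 2 *\<^sub>R (P s - chris (G (F s)) (P s) (E (F s))))) (at s)" if "s \<in> ?B" for s
  proof -
    have "((\<lambda>s. (s $ 1, s $ 2)) has_derivative (\<lambda>v. (v $ 1, v $ 2))) (at s)"
      by (intro has_derivative_Pair bounded_linear_imp_has_derivative bounded_linear_vec_nth)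
    from has_derivative_compose[OF this u'[OF comp[OF that]]]
    have *: "((\<lambda>s. u (s $ 1, s $ 2)) has_derivative
      (\<lambda>v. v $ 1 *\<^sub>R spray (u (s $ 1, s $ 2)) + v $ 2 *\<^sub>R lift (u (s $ 1, s $ 2)))) (at s)" by simp
    from has_derivative_fst[OF *] show "(F has_derivative plane_map (P s) (E (F s))) (at s)"
      by (simp add: F_def[abs_def] P_def[abs_def] spray_def lift_def plane_map_def[abs_def])
    from has_derivative_snd[OF *] show "(P has_derivative (\<lambda>v. v $ 1 *\<^sub>R (- chris (G (F s)) (P s) (P s))
      + v $ 2 *\<^sub>R (P s - chris (G (F s)) (P s) (E (F s))))) (at s)"
      by (simp add: F_def[abs_def] P_def[abs_def] spray_def lift_def)
  qed
  have dF: "\<forall>s\<in>?B. F differentiable at s" and dP: "\<forall>s\<in>?B. P differentiable at s"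
    by (rule ballI, erule differentiableI[OF F'], rule ballI, erule differentiableI[OF P'])
  \<comment> \<open>Bootstrapping: the derivatives of \<open>F\<close> and \<open>P\<close> are
    smooth expressions in \<open>F\<close> and \<open>P\<close>, so \<open>k\<close>-fold
    differentiability of both gives order \<open>Suc k\<close>.\<close>
  have hd: "higher_differentiable_on k F ?B \<and> higher_differentiable_on k P ?B" for k
  proof (induction k)
    case 0
    show ?case using dF dP by (simp add: pointwise_differentiable_imp_continuous_on)
  next
    case (Suc k)
    have GF: "higher_differentiable_on k (\<lambda>s. G (F s)) ?B" and EF: "higher_differentiable_on k (\<lambda>s. E (F s)) ?B"
      by (rule higher_differentiable_on_compose[OF open_ball open_S, where f = F];
          use Suc smooth_G smooth_E FS in \<open>auto simp: smooth_on_def\<close>)+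
    have sc: "higher_differentiable_on k (\<lambda>s. r *\<^sub>R f s) ?B" if "higher_differentiable_on k f ?B"
      for f :: "real^2 \<Rightarrow> real^'n" and r
      by (rule higher_differentiable_on_linear[OF bounded_linear_scaleR_right open_ball that])
    have "higher_differentiable_on k (\<lambda>s. v $ 1 *\<^sub>R P s + v $ 2 *\<^sub>R E (F s)) ?B" for v :: "real^2"
      using Suc EF by (intro higher_differentiable_on_add[OF open_ball] sc) auto
    moreover have "higher_differentiable_on k (\<lambda>s. v $ 1 *\<^sub>R ((-1) *\<^sub>R chris (G (F s)) (P s) (P s))
      + v $ 2 *\<^sub>R (P s + (-1) *\<^sub>R chris (G (F s)) (P s) (E (F s)))) ?B" for v :: "real^2"
      using Suc EF GF
      by (intro higher_differentiable_on_add[OF open_ball] sc higher_differentiable_on_chris[OF open_ball]) auto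
    ultimately have "higher_differentiable_on k (\<lambda>s. dd F s v) ?B" "higher_differentiable_on k (\<lambda>s. dd P s v) ?B" for v
      using higher_differentiable_on_cong[of ?B "\<lambda>s. dd F s v" "\<lambda>s. v $ 1 *\<^sub>R P s + v $ 2 *\<^sub>R E (F s)" k]
        higher_differentiable_on_cong[of ?B "\<lambda>s. dd P s v" "\<lambda>s. v $ 1 *\<^sub>R ((-1) *\<^sub>R chris (G (F s)) (P s) (P s))
      + v $ 2 *\<^sub>R (P s + (-1) *\<^sub>R chris (G (F s)) (P s) (E (F s)))" k]
      by (auto simp: dd_eqI[OF F'] dd_eqI[OF P'] plane_map_def)
    then show ?case using dF dP by simp
  qed
  have sF: "smooth_on F ?B" using hd by (simp add: smooth_on_def)
  have 0: "0 \<in> ?B" using \<delta> by simp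
  have F0: "F 0 = x0" "P 0 = X" using u0 by (simp_all add: F_def P_def)
  have cF: "continuous_on ?B F" "continuous_on ?B P"
    using hd[of 0] by simp_all
  then have cEF: "continuous_on ?B (\<lambda>s. E (F s))"
    using FS by (intro continuous_on_compose2[OF smooth_on_continuous_on[OF smooth_E]]) auto
  have "continuous_on ?B (\<lambda>s. gram (P s) (E (F s)))"
    unfolding gram_def by (intro continuous_intros cF cEF)
  then have "open (?B \<inter> (\<lambda>s. gram (P s) (E (F s))) -` (- {0}))"
    by (rule continuous_open_preimage[OF _ open_ball]) (simp add: open_Compl)
  moreover have "gram (P 0) (E (F 0)) \<noteq> 0"
  proof -
    have "gram (E x0) X \<noteq> 0" by (rule gram_nonzero[OF x0(2) X(2)])
    then show ?thesis by (simp add: F0 gram_def inner_commute mult.commute)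
  qed
  \<comment> \<open>At 0 the vectors are \<open>X\<close> and \<open>E x0\<close>, which are
    independent; on a smaller ball \<open>P\<close> and \<open>E\<close> stay independent and
    \<open>F\<close> is an immersion.\<close>
  ultimately obtain \<rho> where \<rho>: "\<rho> > 0" "ball 0 \<rho> \<subseteq> ?B \<inter> (\<lambda>s. gram (P s) (E (F s))) -` (- {0})"
    using 0 open_contains_ball by (metis (no_types, lifting) ComplI IntI singletonD vimageI)
  let ?U = "ball (0 :: real^2) \<rho>"
  have UB: "s \<in> ?B" if "s \<in> ?U" for s using \<rho>(2) that by blast
  have ddF: "dd F s = plane_map (P s) (E (F s))" if "s \<in> ?B" for s by (rule dd_eqI[OF F'[OF that]])
  have rangeF: "range (dd F s) = span {P s, E (F s)}" if "s \<in> ?B" for s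
    unfolding ddF[OF that] by (rule range_plane_map)
  show ?thesis
  proof (rule that[of ?U F])
    show "0 \<in> ?U" using \<rho> by simp
    show "smooth_on F ?U" by (rule smooth_on_subset[OF sF]) (use UB in blast)
    show "F ` ?U \<subseteq> S" using FS UB by blast
    show "F 0 = x0" by (rule F0)
    show "inj (dd F s)" if "s \<in> ?U" for s
    proof -
      have "gram (P s) (E (F s)) \<noteq> 0" using \<rho>(2) that by blast
      then show ?thesis unfolding ddF[OF UB[OF that]] by (rule inj_plane_map)
    qed
    show "E (F s) \<in> range (dd F s)" if "s \<in> ?U" for s
      unfolding rangeF[OF UB[OF that]] by (simp add: span_base)
    show "range (dd F 0) = L" unfolding rangeF[OF 0] F0 X(3) ..
    fix s :: "real^2" and v w :: "real^2" assume "s \<in> ?U"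
    then have sB: "s \<in> ?B" by (rule UB)
    let ?C = "chris (G (F s))" and ?P = "P s" and ?E = "E (F s)"
    note x = FS[OF sB]
    have "((\<lambda>t. w $ 1 *\<^sub>R P t + w $ 2 *\<^sub>R E (F t)) has_derivative
        (\<lambda>v. w $ 1 *\<^sub>R (v $ 1 *\<^sub>R (- ?C ?P ?P) + v $ 2 *\<^sub>R (?P - ?C ?P ?E))
          + w $ 2 *\<^sub>R dd E (F s) (plane_map ?P ?E v))) (at s)"
      by (intro has_derivative_add has_derivative_scaleR_right P'[OF sB]
          has_derivative_compose[OF F'[OF sB] has_derivative_E[OF x]])
    moreover have "dd (\<lambda>t. dd F t w) s = dd (\<lambda>t. w $ 1 *\<^sub>R P t + w $ 2 *\<^sub>R E (F t)) s"
      by (rule dd_cong_open[OF open_ball sB]) (simp add: ddF plane_map_def)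
    ultimately have "dd (\<lambda>t. dd F t w) s v = w $ 1 *\<^sub>R (v $ 1 *\<^sub>R (- ?C ?P ?P) + v $ 2 *\<^sub>R (?P - ?C ?P ?E))
          + w $ 2 *\<^sub>R dd E (F s) (plane_map ?P ?E v)"
      by (simp add: dd_eqI)
    moreover have "dd E (F s) (plane_map ?P ?E v) = (v $ 1 *\<^sub>R ?P + v $ 2 *\<^sub>R ?E) - (v $ 1 *\<^sub>R ?C ?P ?E + v $ 2 *\<^sub>R ?C ?E ?E)"
      by (simp add: dd_E[OF x] plane_map_def chris_linear)
    ultimately have "dd (\<lambda>t. dd F t w) s v + ?C (dd F s v) (dd F s w)
        = (w $ 1 * v $ 2 + w $ 2 * v $ 1) *\<^sub>R ?P + (w $ 2 * v $ 2) *\<^sub>R ?E"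
      unfolding ddF[OF sB] plane_map_def chris_linear chris_sym[OF x, of ?E ?P]
      by (simp add: algebra_simps)
    also have "\<dots> \<in> range (dd F s)"
      unfolding rangeF[OF sB] by (intro span_add span_scale span_base) auto
    finally show "dd (\<lambda>t. dd F t w) s v + ?C (dd F s v) (dd F s w) \<in> range (dd F s)" .
  qed auto
qed

end

section \<open>Charts and transition maps\<close>

text \<open>The second derivative of \<open>\<tau>\<close> appears because the base point moves
  along with the vector. It is the term that the transformation law of a connection
  compensates.\<close>

lemma has_derivative_dd_apply:
  fixes \<tau> :: "'a::euclidean_space \<Rightarrow> 'b::real_normed_vector" and F k :: "'c::real_normed_vector \<Rightarrow> 'a"
  assumes T: "open T" "smooth_on \<tau> T" "F s \<in> T"
    and F: "(F has_derivative F') (at s)" and k: "(k has_derivative k') (at s)"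
  shows "((\<lambda>t. dd \<tau> (F t) (k t)) has_derivative
    (\<lambda>v. dd (\<lambda>y. dd \<tau> y (k s)) (F s) (F' v) + dd \<tau> (F s) (k' v))) (at s)"
proof -
  have exp: "dd \<tau> y w = (\<Sum>b\<in>Basis. (w \<bullet> b) *\<^sub>R dd \<tau> y b)" if "y \<in> T" for y w
    by (rule dd_eq_sum_Basis[OF smooth_on_differentiable[OF T(2) that]])
  have dd2: "((\<lambda>y. dd \<tau> y b) has_derivative dd (\<lambda>y. dd \<tau> y b) (F s)) (at (F s))" for b
    by (rule smooth_on_has_derivative[OF smooth_on_dd[OF T(2)] T(3)])
  have "isCont F s" using F has_derivative_continuous by blast
  then have "\<exists>U. open U \<and> s \<in> U \<and> (\<forall>t\<in>U. F t \<in> T)"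
    using T(1,3) unfolding continuous_at_open by blast
  then obtain U where U: "open U" "s \<in> U" "\<And>t. t \<in> U \<Longrightarrow> F t \<in> T" by blast
  have sum': "((\<lambda>t. \<Sum>b\<in>Basis. (k t \<bullet> b) *\<^sub>R dd \<tau> (F t) b) has_derivative
    (\<lambda>v. \<Sum>b\<in>Basis. (k s \<bullet> b) *\<^sub>R dd (\<lambda>y. dd \<tau> y b) (F s) (F' v) + (k' v \<bullet> b) *\<^sub>R dd \<tau> (F s) b)) (at s)"
    by (intro has_derivative_sum has_derivative_scaleR has_derivative_compose[OF F dd2]
        bounded_linear.has_derivative[OF bounded_linear_inner_left k])
  have A: "dd (\<lambda>y. dd \<tau> y (k s)) (F s) z = (\<Sum>b\<in>Basis. (k s \<bullet> b) *\<^sub>R dd (\<lambda>y. dd \<tau> y b) (F s) z)" for z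
  proof -
    have "dd (\<lambda>y. dd \<tau> y (k s)) (F s) = dd (\<lambda>y. \<Sum>b\<in>Basis. (k s \<bullet> b) *\<^sub>R dd \<tau> y b) (F s)"
      by (rule dd_cong_open[OF T(1,3) exp])
    also have "\<dots> = (\<lambda>z. \<Sum>b\<in>Basis. (k s \<bullet> b) *\<^sub>R dd (\<lambda>y. dd \<tau> y b) (F s) z)"
      by (intro dd_eqI has_derivative_sum has_derivative_scaleR_right dd2)
    finally show ?thesis by simp
  qed
  have "((\<lambda>t. dd \<tau> (F t) (k t)) has_derivative
    (\<lambda>v. \<Sum>b\<in>Basis. (k s \<bullet> b) *\<^sub>R dd (\<lambda>y. dd \<tau> y b) (F s) (F' v) + (k' v \<bullet> b) *\<^sub>R dd \<tau> (F s) b)) (at s)"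
    by (rule has_derivative_transform_within_open[OF sum' U(1,2)]) (rule exp[OF U(3), symmetric])
  moreover have "(\<Sum>b\<in>Basis. (k s \<bullet> b) *\<^sub>R dd (\<lambda>y. dd \<tau> y b) (F s) (F' v) + (k' v \<bullet> b) *\<^sub>R dd \<tau> (F s) b)
      = dd (\<lambda>y. dd \<tau> y (k s)) (F s) (F' v) + dd \<tau> (F s) (k' v)" for v
    unfolding A exp[OF T(3), of "k' v"] by (rule sum.distrib)
  ultimately show ?thesis by simp
qed

lemma second_countable_euclidean: "second_countable (euclidean :: 'a::second_countable_topology topology)"
proof -
  obtain B :: "'a set set" where B: "countable B" "topological_basis B" using ex_countable_basis by blast
  have "\<exists>V\<in>B. x \<in> V \<and> V \<subseteq> U" if "open U" "x \<in> U" for U x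
    by (rule topological_basisE[OF B(2) that]) blast
  moreover have "open V" if "V \<in> B" for V using topological_basis_open[OF B(2) that] .
  ultimately show ?thesis
    unfolding second_countable_def open_openin[symmetric] using B(1) by blast
qed

locale manifold =
  fixes X :: "'a topology" and A :: "('a, 'n::finite) chart set"
  assumes smooth_manifold: "smooth_manifold X A"
begin

lemma openin_chart: "c \<in> A \<Longrightarrow> openin X (fst c)"
  and open_cdom: "c \<in> A \<Longrightarrow> open (cdom c)"
  and homeomorphic_chart:
    "c \<in> A \<Longrightarrow> homeomorphic_map (subtopology X (fst c)) (top_of_set (cdom c)) (snd c)"
  and smooth_transition:
    "c \<in> A \<Longrightarrow> d \<in> A \<Longrightarrow> smooth_on (local_rep c d id) (local_dom c d id)"
  using smooth_manifold unfolding smooth_manifold_def by blast+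

lemma topspace_chart: "c \<in> A \<Longrightarrow> topspace (subtopology X (fst c)) = fst c"
  using openin_subset[OF openin_chart, of c] by (simp add: inf_absorb2)

lemma inj_on_chart: "c \<in> A \<Longrightarrow> inj_on (snd c) (fst c)"
  using homeomorphic_imp_injective_map[OF homeomorphic_chart, of c] topspace_chart[of c] by metis

lemma chart_inv: "c \<in> A \<Longrightarrow> p \<in> fst c \<Longrightarrow> inv_into (fst c) (snd c) (snd c p) = p"
  using inv_into_f_f[OF inj_on_chart] .

lemma chart_inv_in: "x \<in> cdom c \<Longrightarrow> inv_into (fst c) (snd c) x \<in> fst c"
  and inv_chart: "x \<in> cdom c \<Longrightarrow> snd c (inv_into (fst c) (snd c) x) = x"
  unfolding cdom_def by (rule inv_into_into f_inv_into_f; assumption)+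

lemma cdomE: "x \<in> cdom c \<Longrightarrow> (\<And>p. p \<in> fst c \<Longrightarrow> x = snd c p \<Longrightarrow> thesis) \<Longrightarrow> thesis"
  by (auto simp: cdom_def)

lemma open_chart_image:
  assumes "c \<in> A" "openin X V"
  shows "open (snd c ` (fst c \<inter> V))"
proof -
  have "openin (subtopology X (fst c)) (fst c \<inter> V)"
    using assms(2) by (simp add: openin_subtopology_Int2)
  then have "openin (top_of_set (cdom c)) (snd c ` (fst c \<inter> V))"
    using homeomorphic_chart[OF assms(1)] homeomorphic_map_openness_eq by blast
  then show ?thesis using open_cdom[OF assms(1)] openin_open_trans by blast
qed

lemma local_dom_subset: "local_dom c d f \<subseteq> cdom c"
  by (auto simp: local_dom_def cdom_def)

lemma local_rep_chart: "c \<in> A \<Longrightarrow> p \<in> fst c \<Longrightarrow> local_rep c d f (snd c p) = snd d (f p)"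
  by (simp add: local_rep_def chart_inv)

lemma open_transition_dom: "c \<in> A \<Longrightarrow> d \<in> A \<Longrightarrow> open (local_dom c d id)"
  using open_chart_image[OF _ openin_chart, of c d]
  by (simp add: local_dom_def Int_def conj_commute)

lemma transition_in:
  assumes "c \<in> A" "d \<in> A" "x \<in> local_dom c d id"
  shows "local_rep c d id x \<in> local_dom d c id" "local_rep d c id (local_rep c d id x) = x"
proof -
  obtain p where p: "p \<in> fst c" "p \<in> fst d" "x = snd c p" using assms(3) by (auto simp: local_dom_def)
  have x: "local_rep c d id x = snd d p" using p by (simp add: local_rep_chart assms(1))
  show "local_rep c d id x \<in> local_dom d c id" unfolding x using p by (auto simp: local_dom_def)
  show "local_rep d c id (local_rep c d id x) = x"
    unfolding x using p by (simp add: local_rep_chart assms(2))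
qed

lemma transition_dd_inverse:
  assumes "c \<in> A" "d \<in> A" "x \<in> local_dom c d id"
  shows "dd (local_rep d c id) (local_rep c d id x) (dd (local_rep c d id) x v) = v"
proof -
  let ?\<tau> = "local_rep c d id" and ?\<sigma> = "local_rep d c id"
  have "((\<lambda>x. ?\<sigma> (?\<tau> x)) has_derivative (\<lambda>v. dd ?\<sigma> (?\<tau> x) (dd ?\<tau> x v))) (at x)"
    by (rule has_derivative_compose[OF smooth_on_has_derivative[OF smooth_transition[OF assms(1,2)] assms(3)]
          smooth_on_has_derivative[OF smooth_transition[OF assms(2,1)] transition_in(1)[OF assms]]])
  moreover have "dd (\<lambda>x. ?\<sigma> (?\<tau> x)) x = dd (\<lambda>x. x) x"
    by (rule dd_cong_open[OF open_transition_dom[OF assms(1,2)] assms(3) transition_in(2)[OF assms(1,2)]])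
  ultimately show ?thesis by (simp add: dd_eqI fun_eq_iff)
qed

lemma transition_dd_bij:
  assumes "c \<in> A" "d \<in> A" "x \<in> local_dom c d id"
  shows "inj (dd (local_rep c d id) x)" "surj (dd (local_rep c d id) x)"
proof -
  show i: "inj (dd (local_rep c d id) x)"
    using transition_dd_inverse[OF assms] by (metis injI)
  show "surj (dd (local_rep c d id) x)"
    using linear_injective_imp_surjective[OF smooth_on_linear_dd[OF smooth_transition[OF assms(1,2)] assms(3)] i]
    by simp
qed

lemma continuous_map_chart_inv:
  assumes "c \<in> A"
  shows "continuous_map (top_of_set (cdom c)) X (inv_into (fst c) (snd c))"
proof -
  obtain g where g: "homeomorphic_maps (subtopology X (fst c)) (top_of_set (cdom c)) (snd c) g"
    using homeomorphic_chart[OF assms] homeomorphic_map_maps by blast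
  have "continuous_map (top_of_set (cdom c)) X g"
    using g by (auto simp: homeomorphic_maps_def continuous_map_in_subtopology)
  moreover have "g x = inv_into (fst c) (snd c) x" if "x \<in> topspace (top_of_set (cdom c))" for x
  proof -
    have "x \<in> cdom c" using that by simp
    then obtain p where "p \<in> fst c" "x = snd c p" by (auto simp: cdom_def)
    then show ?thesis
      using g topspace_chart[OF assms] chart_inv[OF assms] by (auto simp: homeomorphic_maps_def)
  qed
  ultimately show ?thesis by (rule continuous_map_eq)
qed

end

lemma immersed_surface_local:
  assumes m: "smooth_manifold X A" and c: "c \<in> A" and im: "immersed_surface X A T B f" and d: "d \<in> B"
  shows "open (local_dom d c f)" "smooth_on (local_rep d c f) (local_dom d c f)"
    "local_rep d c f ` local_dom d c f \<subseteq> cdom c"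
    "\<And>s. s \<in> local_dom d c f \<Longrightarrow> inj (dd (local_rep d c f) s)"
    "\<And>q. q \<in> fst d \<Longrightarrow> local_rep d c f (snd d q) = snd c (f q)"
proof -
  interpret M: manifold X A by unfold_locales (rule m)
  interpret B: manifold T B by unfold_locales (use im in \<open>simp add: immersed_surface_def\<close>)
  have sm: "smooth_map T B X A f" using im by (simp add: immersed_surface_def)
  have "openin T {q \<in> topspace T. f q \<in> fst c}"
    using sm M.openin_chart[OF c] unfolding smooth_map_def continuous_map_def by blast
  then have "open (snd d ` (fst d \<inter> {q \<in> topspace T. f q \<in> fst c}))"
    by (rule B.open_chart_image[OF d])
  moreover have "fst d \<inter> {q \<in> topspace T. f q \<in> fst c} = {q \<in> fst d. f q \<in> fst c}"
    using openin_subset[OF B.openin_chart[OF d]] by auto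
  ultimately show "open (local_dom d c f)" by (simp add: local_dom_def)
  show "smooth_on (local_rep d c f) (local_dom d c f)" using sm c d by (simp add: smooth_map_def)
  show rep: "local_rep d c f (snd d q) = snd c (f q)" if "q \<in> fst d" for q
    by (rule B.local_rep_chart[OF d that])
  show "local_rep d c f ` local_dom d c f \<subseteq> cdom c"
    by (auto simp: local_dom_def rep cdom_def)
  show "inj (dd (local_rep d c f) s)" if "s \<in> local_dom d c f" for s
    using im c d that by (simp add: immersed_surface_def)
qed

section \<open>Radiant structures on manifolds\<close>

text \<open>Free of the metric, so that it can be interpreted for a connection and for its conjugate
  alike.\<close>

locale radiant_manifold = manifold X A
  for X :: "'a topology" and A :: "('a, 'n::finite) chart set" +
  fixes G :: "('a, 'n) conn" and E :: "('a, 'n) vfield"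
  assumes affine_connection: "affine_connection A G" and vector_field: "vector_field A E"
    and radiant: "c \<in> A \<Longrightarrow> radiant_chart (cdom c) (G c) (E c)"
    and nonsingular: "c \<in> A \<Longrightarrow> x \<in> cdom c \<Longrightarrow> E c x \<noteq> 0"
begin

text \<open>Invariance and vanishing radial curvature are compared with conelikeness through this
  condition, which has the last index raised and so makes sense for the connection alone.\<close>

definition radially_flat :: bool where
  "radially_flat \<longleftrightarrow> (\<forall>c\<in>A. \<forall>x\<in>cdom c. \<forall>u v. rcurv (G c) x (E c x) u v = 0)"

lemma bilinear_rcurv_eq_0:
  assumes c: "c \<in> A" and x: "x \<in> cdom c"
    and ax: "\<And>i j. rcurv (G c) x (E c x) (axis i 1) (axis j 1) = 0"
  shows "rcurv (G c) x (E c x) u v = 0"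
proof -
  interpret radiant_chart "cdom c" "G c" "E c" by (rule radiant[OF c])
  have "rcurv (G c) x (E c x) (axis i 1) v = 0" for i v
    by (rule linear_eq_axis[OF linear_rcurv3 linear_zero ax])
  then show ?thesis
    by (rule linear_eq_axis[OF linear_rcurv2[OF linear_dd_G[OF x]] linear_zero])
qed

lemma invariant_conn_iff: "invariant_conn A E G \<longleftrightarrow> radially_flat"
proof -
  have "lie_conn (E c) (G c) (\<lambda>_. u) (\<lambda>_. v) x = rcurv (G c) x (E c x) u v"
    if "c \<in> A" "x \<in> cdom c" for c x u v
    using radiant_chart.lie_conn_eq_rcurv[OF radiant[OF that(1)] that(2)] .
  then show ?thesis
    unfolding invariant_conn_def radially_flat_def using bilinear_rcurv_eq_0 by fastforce
qed

text \<open>\<open>nabla2_vec\<close> also differentiates the covariant index \<open>j\<close>,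
  which contributes a term with \<open>\<Gamma>_ij\<close>; it is symmetric by torsion-freeness and
  cancels in \<open>riem\<close>.\<close>

lemma riem_eq:
  assumes c: "c \<in> A" and x: "x \<in> cdom c"
  shows "riem (G c) x i j p k = rcurv (G c) x (axis i 1) (axis j 1) (axis p 1) $ k"
proof -
  interpret radiant_chart "cdom c" "G c" "E c" by (rule radiant[OF c])
  let ?G = "G c"
  have nv: "nabla_vec ?G (\<lambda>_. axis p 1) y j k = chris (?G y) (axis j 1) (axis p 1) $ k" for y j k
    by (simp add: nabla_vec_eq)
  have "pd i (\<lambda>y. chris (?G y) (axis j 1) (axis p 1) $ k) x
      = chris (dd ?G x (axis i 1)) (axis j 1) (axis p 1) $ k" for i j
    unfolding pd_def
    by (subst dd_linear[OF bounded_linear_vec_nth])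
      (use differentiableI[OF has_derivative_chris_const[OF x]] dd_chris_const[OF x] in auto)
  then have n2: "nabla2_vec ?G (\<lambda>_. axis p 1) x i j k = chris (dd ?G x (axis i 1)) (axis j 1) (axis p 1) $ k
      - (\<Sum>q\<in>UNIV. chris (?G x) (axis i 1) (axis j 1) $ q * nabla_vec ?G (\<lambda>_. axis p 1) x q k)
      + chris (?G x) (axis i 1) (chris (?G x) (axis j 1) (axis p 1)) $ k" for i j
    by (simp only: nabla2_vec_def nv chris_axis_left chris_axis)
  show ?thesis
    unfolding riem_def n2 rcurv_def using chris_sym[OF x, of "axis i 1" "axis j 1"] by simp
qed

lemma radial_curvature_zero_iff:
  assumes inv: "\<And>c x. c \<in> A \<Longrightarrow> x \<in> cdom c \<Longrightarrow> invertible (h c x)"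
    and tr: "\<And>c x. c \<in> A \<Longrightarrow> x \<in> cdom c \<Longrightarrow> transpose (h c x) = h c x"
  shows "radial_curvature_zero A E h G \<longleftrightarrow> radially_flat"
proof -
  have eq: "(\<Sum>p\<in>UNIV. E c x $ p * riem_low (G c) (h c) x p i j k)
      = ip (h c x) (rcurv (G c) x (E c x) (axis i 1) (axis j 1)) (axis k 1)"
    if c: "c \<in> A" and x: "x \<in> cdom c" for c x i j k
  proof -
    interpret radiant_chart "cdom c" "G c" "E c" by (rule radiant[OF c])
    have "rcurv (G c) x (E c x) (axis i 1) (axis j 1)
        = (\<Sum>p\<in>UNIV. E c x $ p *\<^sub>R rcurv (G c) x (axis p 1) (axis i 1) (axis j 1))"
      by (rule sum_axis_linear[symmetric, OF linear_rcurv1[OF linear_dd_G[OF x]]])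
    then have "ip (h c x) (rcurv (G c) x (E c x) (axis i 1) (axis j 1)) (axis k 1)
        = (\<Sum>p\<in>UNIV. ip (h c x) (E c x $ p *\<^sub>R rcurv (G c) x (axis p 1) (axis i 1) (axis j 1)) (axis k 1))"
      using linear_sum[OF linear_ip_left] by simp
    also have "\<dots> = (\<Sum>p\<in>UNIV. E c x $ p * riem_low (G c) (h c) x p i j k)"
      by (simp add: ip_linear riem_low_def riem_eq[OF c x] ip_axis_right sum_distrib_left mult_ac)
    finally show ?thesis by simp
  qed
  show ?thesis
  proof
    assume r: "radial_curvature_zero A E h G"
    show radially_flat
      unfolding radially_flat_def
    proof (intro ballI allI, rule bilinear_rcurv_eq_0)
      fix c x i j assume c: "c \<in> A" and x: "x \<in> cdom c"
      then show "c \<in> A" "x \<in> cdom c" by this+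
      let ?R = "rcurv (G c) x (E c x) (axis i 1) (axis j 1)"
      have "ip (h c x) ?R (axis k 1) = 0" for k
        using r c x by (simp add: radial_curvature_zero_def eq)
      then have "ip (h c x) ?R v = 0" for v
        using linear_eq_axis[OF linear_ip_right linear_zero] by blast
      then show "?R = 0" by (rule ip_nondegenerate[OF inv[OF c x] tr[OF c x]])
    qed
  next
    assume radially_flat
    then show "radial_curvature_zero A E h G"
      by (simp add: radial_curvature_zero_def eq radially_flat_def ip_linear)
  qed
qed

section \<open>Planelike surfaces and radial flatness\<close>

lemma conelike_surface:
  assumes cone: "conelike X A G E" and c: "c \<in> A" and x: "x \<in> cdom c" and v: "v \<notin> span {E c x}"
  obtains T B f d q where "immersed_surface X A T B f" "planelike A G E B f" "d \<in> B"
    "snd d q \<in> local_dom d c f" "local_rep d c f (snd d q) = x"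
    "range (dd (local_rep d c f) (snd d q)) = span {E c x, v}"
proof -
  obtain p where p: "p \<in> fst c" "x = snd c p" using cdomE[OF x] .
  have "dim (span {E c x, v}) = 2" by (rule dim_span_pair[OF nonsingular[OF c x] v])
  then obtain T B f d q where *: "immersed_surface X A T B f" "planelike A G E B f" "d \<in> B" "q \<in> fst d"
    "f q = p" "range (dd (local_rep d c f) (snd d q)) = span {E c x, v}"
    using cone c p unfolding conelike_def by (metis span_base insertI1 subspace_span)
  have "snd d q \<in> local_dom d c f" using * p by (auto simp: local_dom_def)
  moreover have "local_rep d c f (snd d q) = x"
    using immersed_surface_local(5)[OF smooth_manifold c *(1,3,4)] * p by simp
  ultimately show ?thesis using that * by blast
qed

text \<open>For \<open>v\<close> independent of \<open>E\<close>, apply \<open>rcurv_tangent\<close>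
  to a planelike surface whose tangent plane contains both. For \<open>v\<close> a multiple of
  \<open>E\<close> the term vanishes by antisymmetry of the curvature.\<close>

lemma conelike_imp_rcurv_in_span:
  assumes cone: "conelike X A G E" and c: "c \<in> A" and x: "x \<in> cdom c"
  shows "rcurv (G c) x (E c x) v v \<in> span {E c x, v}"
proof (cases "v \<in> span {E c x}")
  case True
  interpret radiant_chart "cdom c" "G c" "E c" by (rule radiant[OF c])
  obtain k where "v = k *\<^sub>R E c x" using True by (auto simp: span_singleton)
  then have "rcurv (G c) x (E c x) v v = 0"
    using linear_cmul[OF linear_rcurv2[OF linear_dd_G[OF x]]] by (simp add: rcurv_E_E)
  then show ?thesis by (simp add: span_zero)
next
  case False
  interpret radiant_chart "cdom c" "G c" "E c" by (rule radiant[OF c])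
  obtain T B f d q where *: "immersed_surface X A T B f" "planelike A G E B f" "d \<in> B"
    "snd d q \<in> local_dom d c f" "local_rep d c f (snd d q) = x"
    "range (dd (local_rep d c f) (snd d q)) = span {E c x, v}"
    using conelike_surface[OF cone c x False] .
  let ?F = "local_rep d c f" and ?s = "snd d q"
  note loc = immersed_surface_local[OF smooth_manifold c *(1,3)]
  have "E c x \<in> range (dd ?F ?s)" "v \<in> range (dd ?F ?s)" unfolding *(6) by (auto simp: span_base)
  then obtain a b where ab: "E c x = dd ?F ?s a" "v = dd ?F ?s b" by blast
  have "rcurv (G c) (?F ?s) (dd ?F ?s a) (dd ?F ?s b) (dd ?F ?s b) \<in> range (dd ?F ?s)"
  proof (rule rcurv_tangent[where F = ?F and G = "G c", OF open_S smooth_G loc(1) *(4) loc(2,3)])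
    show "inj (dd ?F t)" if "t \<in> local_dom d c f" for t using loc(4)[OF that] .
    show "dd (\<lambda>t. dd ?F t w) t v + chris (G c (?F t)) (dd ?F t v) (dd ?F t w) \<in> range (dd ?F t)"
      if "t \<in> local_dom d c f" for t v w
      using *(2,3) c that by (simp add: planelike_def totally_geodesic_def Let_def)
  qed
  then show ?thesis unfolding *(5,6) ab[symmetric] .
qed

text \<open>The surface is the patch found in the chart \<open>c\<close>, as a manifold with the
  single chart \<open>U\<close>. Immersion, tangency and total geodesy must hold in every chart of
  the atlas; the transition maps carry them there.\<close>

lemma radially_flat_imp_conelike:
  assumes flat: radially_flat
  shows "conelike X A G E"
  unfolding conelike_def
proof (intro ballI allI impI)
  fix c p L assume c: "c \<in> A" and p: "p \<in> fst c" and L: "subspace L \<and> dim L = 2 \<and> E c (snd c p) \<in> L"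
  interpret radiant_chart "cdom c" "G c" "E c" by (rule radiant[OF c])
  have x0: "snd c p \<in> cdom c" using p by (simp add: cdom_def)
  obtain U :: "(real^2) set" and F where U: "open U" "connected U" "0 \<in> U"
    and F: "smooth_on F U" "F ` U \<subseteq> cdom c" "F 0 = snd c p"
    and inj: "\<And>s. s \<in> U \<Longrightarrow> inj (dd F s)"
    and geo: "\<And>s v w. s \<in> U \<Longrightarrow>
      dd (\<lambda>t. dd F t w) s v + chris (G c (F s)) (dd F s v) (dd F s w) \<in> range (dd F s)"
    and tan: "\<And>s. s \<in> U \<Longrightarrow> E c (F s) \<in> range (dd F s)" and L': "range (dd F 0) = L"
  proof (rule planelike_patch[OF x0 nonsingular[OF c x0], of L])
    show "rcurv (G c) x (E c x) u v = 0" if "x \<in> cdom c" for x u v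
      using flat c that by (simp add: radially_flat_def)
  qed (use L in \<open>simp_all\<close>)
  define T B where "T = top_of_set U" and "B = {(U, id :: real^2 \<Rightarrow> real^2)}"
  define f where "f = (\<lambda>s. inv_into (fst c) (snd c) (F s))"
  have FU: "F s \<in> cdom c" if "s \<in> U" for s using F(2) that by blast
  have inv_id: "inv_into U id s = s" if "s \<in> U" for s using inv_into_f_f[of id U s] that by simp
  have T: "smooth_manifold T B"
    unfolding smooth_manifold_def
  proof (intro conjI ballI)
    show "Hausdorff_space T" by (simp add: T_def Hausdorff_space_subtopology)
    show "second_countable T"
      unfolding T_def by (intro second_countable_subtopology second_countable_euclidean)
    show "connected_space T" using U(2) by (simp add: T_def connected_space_subtopology)
    show "\<Union> (fst ` B) = topspace T" by (simp add: B_def T_def)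
    fix d assume d: "d \<in> B"
    then have dd: "fst d = U" "snd d = id" "cdom d = U" by (auto simp: B_def cdom_def)
    show "openin T (fst d)" "open (cdom d)" using U(1) by (simp_all add: dd T_def)
    show "homeomorphic_map (subtopology T (fst d)) (top_of_set (cdom d)) (snd d)"
      by (simp add: dd T_def subtopology_subtopology)
    fix e assume "e \<in> B"
    then have e: "snd e = id" "fst e = U" by (auto simp: B_def)
    have "local_dom d e id = U" by (auto simp: local_dom_def dd e)
    moreover have "smooth_on (local_rep d e id) U \<longleftrightarrow> smooth_on (\<lambda>x. x) U"
      by (rule smooth_on_cong[OF U(1)]) (simp add: local_rep_def dd e inv_id)
    ultimately show "smooth_on (local_rep d e id) (local_dom d e id)"
      using smooth_on_ident[OF U(1)] by simp
  qed
  let ?d = "(U, id :: real^2 \<Rightarrow> real^2)"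
  have dom: "local_dom ?d c' f = {s \<in> U. f s \<in> fst c'}" for c'
    by (auto simp: local_dom_def)
  have fs: "f s \<in> fst c" "snd c (f s) = F s" if "s \<in> U" for s
    using chart_inv_in[OF FU[OF that]] inv_chart[OF FU[OF that]] by (simp_all add: f_def)
  have rep: "local_rep ?d c' f s = local_rep c c' id (F s)" if "s \<in> U" for c' s
    using that by (simp add: local_rep_def inv_id f_def)
  have mem: "F s \<in> local_dom c c' id" if s: "s \<in> local_dom ?d c' f" for s c'
  proof -
    have "f s \<in> fst c \<and> f s \<in> fst c'" "F s = snd c (f s)" using s fs by (auto simp: dom)
    then show ?thesis unfolding local_dom_def by auto
  qed
  have mem': "s \<in> local_dom ?d c' f" if s: "s \<in> U" "F s \<in> local_dom c c' id" for s c'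
  proof -
    obtain q where "q \<in> fst c" "q \<in> fst c'" "F s = snd c q" using s(2) by (auto simp: local_dom_def)
    then have "f s \<in> fst c'" using chart_inv[OF c, of q] by (simp add: f_def)
    then show ?thesis using s(1) by (simp add: dom)
  qed
  have od: "open (local_dom ?d c' f)" if c': "c' \<in> A" for c'
  proof -
    have "s \<in> local_dom ?d c' f \<longleftrightarrow> s \<in> U \<and> F s \<in> local_dom c c' id" for s
      using mem[of s c'] mem'[of s c'] dom[of c'] by blast
    then have "local_dom ?d c' f = U \<inter> F -` local_dom c c' id" by blast
    then show ?thesis
      using continuous_open_preimage[OF smooth_on_continuous_on[OF F(1)] U(1) open_transition_dom[OF c c']]
      by simp
  qed
  have subU: "s \<in> U" if "s \<in> local_dom ?d c' f" for s c' using that by (simp add: dom)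
  have F': "(F has_derivative dd F s) (at s)" if "s \<in> U" for s
    by (rule smooth_on_has_derivative[OF F(1) that])
  have dd_rep: "dd (local_rep ?d c' f) s v = dd (local_rep c c' id) (F s) (dd F s v)"
    if c': "c' \<in> A" and s: "s \<in> local_dom ?d c' f" for c' s v
  proof -
    have "dd (local_rep ?d c' f) s = dd (\<lambda>s. local_rep c c' id (F s)) s"
      by (rule dd_cong_open[OF od[OF c'] s rep[OF subU]])
    also have "\<dots> = (\<lambda>v. dd (local_rep c c' id) (F s) (dd F s v))"
      by (rule dd_eqI[OF has_derivative_compose[OF F'[OF subU[OF s]]
              smooth_on_has_derivative[OF smooth_transition[OF c c'] mem[OF s]]]])
    finally show ?thesis by simp
  qed
  have range_rep: "range (dd (local_rep ?d c' f) s) = dd (local_rep c c' id) (F s) ` range (dd F s)"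
    if "c' \<in> A" "s \<in> local_dom ?d c' f" for c' s
    using dd_rep[OF that] by (auto simp: image_def)
  have im: "immersed_surface X A T B f"
    unfolding immersed_surface_def smooth_map_def
  proof (intro conjI ballI T)
    have "continuous_map T (top_of_set (cdom c)) F"
      unfolding T_def using smooth_on_continuous_on[OF F(1)] F(2) by auto
    from continuous_map_compose[OF this continuous_map_chart_inv[OF c]]
    show "continuous_map T X f" by (simp add: f_def comp_def)
    fix d c' assume d: "d \<in> B" and c': "c' \<in> A"
    have d_eq: "d = ?d" using d by (simp add: B_def)
    have "smooth_on (\<lambda>s. local_rep c c' id (F s)) (local_dom ?d c' f)"
      by (rule smooth_on_compose[where g = "local_rep c c' id" and f = F, OF od[OF c'] open_transition_dom[OF c c'] _ smooth_transition[OF c c']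
            smooth_on_subset[OF F(1)]]) (blast intro: mem subU)+
    then show "smooth_on (local_rep d c' f) (local_dom d c' f)"
      unfolding d_eq by (subst smooth_on_cong[OF od[OF c'] rep[OF subU]])
    fix s assume s: "s \<in> local_dom d c' f"
    show "inj (dd (local_rep d c' f) s)"
    proof (rule injI)
      fix v w assume "dd (local_rep d c' f) s v = dd (local_rep d c' f) s w"
      then have "dd (local_rep c c' id) (F s) (dd F s v) = dd (local_rep c c' id) (F s) (dd F s w)"
        using s c' by (simp add: d_eq dd_rep)
      then have "dd F s v = dd F s w"
        using injD[OF transition_dd_bij(1)[OF c c' mem]] s unfolding d_eq by blast
      then show "v = w" using injD[OF inj[OF subU]] s unfolding d_eq by blast
    qed
  qed
  have "planelike A G E B f"
    unfolding planelike_def totally_geodesic_def tangent_to_def Let_def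
  proof (intro conjI ballI allI)
    fix d c' s assume d: "d \<in> B" and c': "c' \<in> A" and s: "s \<in> local_dom d c' f"
    have d_eq: "d = ?d" using d by (simp add: B_def)
    note s = s[unfolded d_eq]
    let ?\<tau> = "local_rep c c' id"
    have Fs: "local_rep ?d c' f s = ?\<tau> (F s)" by (rule rep[OF subU[OF s]])
    show "E c' (local_rep d c' f s) \<in> range (dd (local_rep d c' f) s)"
      unfolding d_eq Fs range_rep[OF c' s]
      using vector_field c c' mem[OF s] tan[OF subU[OF s]] by (simp add: vector_field_def Let_def)
    fix v w
    have "dd (\<lambda>t. dd (local_rep ?d c' f) t w) s = dd (\<lambda>t. dd ?\<tau> (F t) (dd F t w)) s"
      by (rule dd_cong_open[OF od[OF c'] s dd_rep[OF c']])
    also have "\<dots> = (\<lambda>v. dd (\<lambda>y. dd ?\<tau> y (dd F s w)) (F s) (dd F s v)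
        + dd ?\<tau> (F s) (dd (\<lambda>t. dd F t w) s v))"
      by (intro dd_eqI has_derivative_dd_apply[where F = F and s = s, OF open_transition_dom[OF c c'] smooth_transition[OF c c'] mem[OF s]]
          F'[OF subU[OF s]] smooth_on_has_derivative[OF smooth_on_dd[OF F(1)] subU[OF s]])
    finally have "dd (\<lambda>t. dd (local_rep ?d c' f) t w) s v
          + chris (G c' (?\<tau> (F s))) (dd (local_rep ?d c' f) s v) (dd (local_rep ?d c' f) s w)
        = dd ?\<tau> (F s) (dd (\<lambda>t. dd F t w) s v)
          + (dd (\<lambda>y. dd ?\<tau> y (dd F s w)) (F s) (dd F s v)
          + chris (G c' (?\<tau> (F s))) (dd ?\<tau> (F s) (dd F s v)) (dd ?\<tau> (F s) (dd F s w)))"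
      by (simp add: dd_rep[OF c' s])
    \<comment> \<open>The transformation law of \<open>G\<close> absorbs the second derivative of
      the transition map.\<close>
    also have "\<dots> = dd ?\<tau> (F s) (dd (\<lambda>t. dd F t w) s v) + dd ?\<tau> (F s) (chris (G c (F s)) (dd F s v) (dd F s w))"
      using affine_connection c c' mem[OF s] by (simp add: affine_connection_def Let_def)
    also have "\<dots> = dd ?\<tau> (F s) (dd (\<lambda>t. dd F t w) s v + chris (G c (F s)) (dd F s v) (dd F s w))"
      by (rule linear_add[OF smooth_on_linear_dd[OF smooth_transition[OF c c'] mem[OF s]], symmetric])
    also have "\<dots> \<in> range (dd (local_rep ?d c' f) s)"
      unfolding range_rep[OF c' s] using geo[OF subU[OF s]] by blast
    finally show "dd (\<lambda>t. dd (local_rep d c' f) t w) s v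
          + chris (G c' (local_rep d c' f s)) (dd (local_rep d c' f) s v) (dd (local_rep d c' f) s w)
        \<in> range (dd (local_rep d c' f) s)"
      unfolding d_eq Fs .
  qed
  moreover have "f 0 = p" using F(3) chart_inv[OF c p] by (simp add: f_def)
  moreover have "range (dd (local_rep ?d c f) (snd ?d 0)) = L"
  proof -
    have "dd (local_rep ?d c f) 0 = dd F 0"
      by (rule dd_cong_open[OF U(1,3)]) (simp add: local_rep_def inv_id fs)
    then show ?thesis using L' by simp
  qed
  ultimately show "\<exists>S B f. immersed_surface X A S B f \<and> planelike A G E B f \<and>
      (\<exists>d\<in>B. \<exists>q\<in>fst d. f q = p \<and> range (dd (local_rep d c f) (snd d q)) = L)"
    using im U(3) by (intro exI[of _ T] exI[of _ B] exI[of _ f] conjI bexI[of _ ?d] bexI[of _ 0])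
      (simp_all add: B_def)
qed

end

section \<open>Radiant statistical manifolds and their conjugates\<close>

lemma chris_symI: "(\<And>i j k. \<Gamma> $ i $ j $ k = \<Gamma> $ j $ i $ k) \<Longrightarrow> chris \<Gamma> u v = chris \<Gamma> v u"
  unfolding chris_def by (subst sum.swap) (simp add: vec_eq_iff mult_ac)

text \<open>The index conditions are multilinear identities tested on coordinate vectors, hence hold
  for all vectors.\<close>

lemma statistical_chart:
  assumes m: "smooth_manifold X A" and rs: "radiant_statistical A G E h" and c: "c \<in> A"
  shows "statistical_chart (cdom c) (G c) (E c) (h c)"
proof unfold_locales
  show "open (cdom c)" using m c by (simp add: smooth_manifold_def)
  show G: "smooth_on (G c) (cdom c)" using rs c by (simp add: radiant_statistical_def affine_connection_def)
  show E: "smooth_on (E c) (cdom c)" using rs c by (simp add: radiant_statistical_def vector_field_def)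
  show h: "smooth_on (h c) (cdom c)" using rs c by (simp add: radiant_statistical_def pseudo_riemannian_metric_def)
  fix x assume x: "x \<in> cdom c"
  show "transpose (h c x) = h c x" "invertible (h c x)"
    using rs c x by (simp_all add: radiant_statistical_def pseudo_riemannian_metric_def)
  show "chris (G c x) u v = chris (G c x) v u" for u v
    using rs c x by (intro chris_symI) (auto simp: radiant_statistical_def torsion_free_def)
  have lE: "linear (dd (E c) x)" and lh: "linear (dd (h c) x)"
    using smooth_on_linear_dd[OF E x] smooth_on_linear_dd[OF h x] by simp_all
  show "dd (E c) x u + chris (G c x) u (E c x) = u" for u
  proof (rule linear_eq_axis[where f = "\<lambda>u. dd (E c) x u + chris (G c x) u (E c x)"])
    show "linear (\<lambda>u. dd (E c) x u + chris (G c x) u (E c x))"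
      by (intro linear_compose_add lE linear_chris_left)
    show "linear (\<lambda>u. u)" by (rule linear_ident)
    show "dd (E c) x (axis i 1) + chris (G c x) (axis i 1) (E c x) = axis i 1" for i
    proof -
      have "nabla_vec (G c) (E c) x i j = (if i = j then 1 else 0)" for j
        using rs c x by (simp add: radiant_statistical_def)
      then show ?thesis by (auto simp: nabla_vec_eq vec_eq_iff axis_def)
    qed
  qed
  show "nm (G c) (h c) x u v w = nm (G c) (h c) x v u w" for u v w
  proof (rule trilinear_eq_axis[where f = "nm (G c) (h c) x" and g = "\<lambda>u v w. nm (G c) (h c) x v u w"])
    show "nm (G c) (h c) x (axis i 1) (axis j 1) (axis k 1) = nm (G c) (h c) x (axis j 1) (axis i 1) (axis k 1)" for i j k
      using rs c x by (simp add: radiant_statistical_def nabla_metric_eq)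
  qed (rule linear_nm[OF lh])+
  show "ip (dd (h c) x (E c x)) u v + ip (h c x) (dd (E c) x u) v + ip (h c x) u (dd (E c) x v)
      = 2 * ip (h c x) u v" for u v
  proof (rule bilinear_eq_axis[where g = "\<lambda>u v. 2 * ip (h c x) u v"])
    show "ip (dd (h c) x (E c x)) (axis i 1) (axis j 1) + ip (h c x) (dd (E c) x (axis i 1)) (axis j 1)
        + ip (h c x) (axis i 1) (dd (E c) x (axis j 1)) = 2 * ip (h c x) (axis i 1) (axis j 1)" for i j
      using rs c x lie_metric_eq[OF smooth_on_differentiable[OF h x], of "E c" i j]
      by (simp add: radiant_statistical_def ip_axis)
  qed (rule linearI; simp add: ip_linear linear_add[OF lE] linear_cmul[OF lE] algebra_simps)+
qed

lemma conjugate_chart: "conjugate h G c = conj_chart (h c) (G c)"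
  by (simp add: conjugate_def conj_chart_def fun_eq_iff)

locale radiant_statistical_manifold = manifold X A
  for X :: "'a topology" and A :: "('a, 'n::finite) chart set" +
  fixes G :: "('a, 'n) conn" and E :: "('a, 'n) vfield" and h :: "('a, 'n) metric"
  assumes radiant_statistical: "radiant_statistical A G E h"
    and E_nonsingular: "nonsingular A E"
begin

lemma statistical: "c \<in> A \<Longrightarrow> statistical_chart (cdom c) (G c) (E c) (h c)"
  by (rule statistical_chart[OF smooth_manifold radiant_statistical])

lemma dual: "c \<in> A \<Longrightarrow> dual_chart (cdom c) (G c) (conjugate h G c) (E c) (h c)"
  unfolding conjugate_chart by (rule statistical_chart.dual_chart_G'[OF statistical])

text \<open>The formula with the inverse metric hides the transformation law. Differentiating the
  invariance of \<open>h\<close> under the transition map and inserting duality in both charts gives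
  the sum of the laws of both connections, paired with \<open>h\<close>. Subtracting the law of
  \<open>G\<close> leaves that of the conjugate, because tangent maps are onto and \<open>h\<close>
  is nondegenerate.\<close>

lemma affine_connection_conjugate: "affine_connection A (conjugate h G)"
  unfolding affine_connection_def Let_def
proof (intro conjI ballI allI)
  fix c assume c: "c \<in> A"
  show "smooth_on (conjugate h G c) (cdom c)"
    using dual[OF c] by (simp add: dual_chart_def radiant_chart_def)
next
  fix c d x u v assume c: "c \<in> A" and d: "d \<in> A" and x: "x \<in> local_dom c d id"
  interpret C: dual_chart "cdom c" "G c" "conjugate h G c" "E c" "h c" by (rule dual[OF c])
  interpret D: dual_chart "cdom d" "G d" "conjugate h G d" "E d" "h d" by (rule dual[OF d])
  let ?\<tau> = "local_rep c d id"
  let ?y = "?\<tau> x" and ?T = "dd ?\<tau> x"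
  let ?D2 = "\<lambda>w. dd (\<lambda>z. dd ?\<tau> z w) x u"
  have xc: "x \<in> cdom c" using x local_dom_subset by blast
  have y: "?y \<in> cdom d" using transition_in(1)[OF c d x] local_dom_subset by blast
  note o = open_transition_dom[OF c d] and sm = smooth_transition[OF c d]
  have lin: "linear ?T" by (rule smooth_on_linear_dd[OF sm x])
  have met: "ip (h d (?\<tau> z)) (dd ?\<tau> z v) (dd ?\<tau> z w) = ip (h c z) v w" if "z \<in> local_dom c d id" for z v w
    using radiant_statistical c d that
    by (simp add: radiant_statistical_def pseudo_riemannian_metric_def Let_def ip_def)
  have aff: "?D2 w + chris (G d ?y) (?T u) (?T w) = ?T (chris (G c x) u w)" for w
    using radiant_statistical c d x by (simp add: radiant_statistical_def affine_connection_def Let_def)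
  have dtau: "(?\<tau> has_derivative ?T) (at x)" by (rule smooth_on_has_derivative[OF sm x])
  have dT: "((\<lambda>z. dd ?\<tau> z w) has_derivative dd (\<lambda>z. dd ?\<tau> z w) x) (at x)" for w
    by (rule smooth_on_has_derivative[OF smooth_on_dd[OF sm] x])
  have key: "ip (h d ?y) (?D2 v + chris (conjugate h G d ?y) (?T u) (?T v)) (?T w)
      = ip (h d ?y) (?T (chris (conjugate h G c x) u v)) (?T w)" for w
  proof -
    have d1: "((\<lambda>z. ip (h d (?\<tau> z)) (dd ?\<tau> z v) (dd ?\<tau> z w)) has_derivative
        (\<lambda>k. ip (dd (h d) ?y (?T k)) (?T v) (?T w) + ip (h d ?y) (dd (\<lambda>z. dd ?\<tau> z v) x k) (?T w)
          + ip (h d ?y) (?T v) (dd (\<lambda>z. dd ?\<tau> z w) x k))) (at x)"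
      by (intro has_derivative_ip dT has_derivative_compose[OF dtau D.has_derivative_h[OF y]])
    have d2: "dd (\<lambda>z. ip (h d (?\<tau> z)) (dd ?\<tau> z v) (dd ?\<tau> z w)) x = dd (\<lambda>z. ip (h c z) v w) x"
      by (rule dd_cong_open[OF o x met])
    have d3: "dd (\<lambda>z. ip (h c z) v w) x u = ip (dd (h c) x u) v w"
      by (rule dd_linear[OF bounded_linear_ip_form differentiableI[OF C.has_derivative_h[OF xc]]])
    have "ip (dd (h d) ?y (?T u)) (?T v) (?T w) + ip (h d ?y) (?D2 v) (?T w)
        + ip (h d ?y) (?T v) (?D2 w) = ip (dd (h c) x u) v w"
      using d3 unfolding d2[symmetric] dd_eqI[OF d1] .
    then have "ip (h d ?y) (?D2 v + chris (conjugate h G d ?y) (?T u) (?T v)) (?T w)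
        + ip (h d ?y) (?T v) (?D2 w + chris (G d ?y) (?T u) (?T w))
      = ip (h c x) (chris (conjugate h G c x) u v) w + ip (h c x) v (chris (G c x) u w)"
      by (simp add: D.dual[OF y] C.dual[OF xc] ip_linear)
    then show ?thesis unfolding aff met[OF x] by simp
  qed
  have "ip (h d ?y) (?D2 v + chris (conjugate h G d ?y) (?T u) (?T v)
      - ?T (chris (conjugate h G c x) u v)) w' = 0" for w'
  proof -
    obtain w where "w' = ?T w" using transition_dd_bij(2)[OF c d x] by (metis surjD)
    then show ?thesis using key[of w] by (simp add: ip_linear)
  qed
  from ip_nondegenerate[OF D.inv_h[OF y] D.transpose_h[OF y] this]
  show "?D2 v + chris (conjugate h G d ?y) (?T u) (?T v) = ?T (chris (conjugate h G c x) u v)" by simp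
qed

sublocale radiant_manifold X A G E
proof (intro radiant_manifold.intro radiant_manifold_axioms.intro manifold_axioms)
  show "affine_connection A G" "vector_field A E"
    using radiant_statistical by (simp_all add: radiant_statistical_def)
  show "radiant_chart (cdom c) (G c) (E c)" if "c \<in> A" for c
    using dual[OF that] by (simp add: dual_chart_def)
  show "E c x \<noteq> 0" if "c \<in> A" "x \<in> cdom c" for c x
    using E_nonsingular that by (simp add: nonsingular_def)
qed

sublocale conj: radiant_manifold X A "conjugate h G" E
proof (intro radiant_manifold.intro radiant_manifold_axioms.intro manifold_axioms)
  show "affine_connection A (conjugate h G)" by (rule affine_connection_conjugate)
  show "radiant_chart (cdom c) (conjugate h G c) (E c)" if "c \<in> A" for c
    using dual[OF that] by (simp add: dual_chart_def)
qed (rule vector_field, rule nonsingular)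

lemma conelike_imp_flat:
  assumes "CARD('n) \<noteq> 2" "conelike X A G E"
  shows "radially_flat" "conj.radially_flat"
  unfolding radially_flat_def conj.radially_flat_def
  using dual_chart.rcurv_E_eq_0[OF dual assms(1) nonsingular conelike_imp_rcurv_in_span[OF assms(2)]]
  by blast+

text \<open>On a surface that is planelike for both connections, subtracting the two conditions of
  total geodesy cancels the second derivatives of the immersion, so the difference of the
  connections maps \<open>(v,v)\<close> into the tangent plane. Conelikeness supplies such a surface
  for each plane through \<open>E\<close>.\<close>

lemma same_planelike_imp_conn_eq:
  assumes card: "CARD('n) \<noteq> 2" and cone: "conelike X A G E"
    and same: "same_planelike_surfaces X A G (conjugate h G) E" and c: "c \<in> A" and x: "x \<in> cdom c"
  shows "chris (conjugate h G c x) u v = chris (G c x) u v"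
proof (rule dual_chart.conn_diff_eq_0[OF dual[OF c] card nonsingular[OF c] _ x])
  fix x v assume x: "x \<in> cdom c"
  interpret dual_chart "cdom c" "G c" "conjugate h G c" "E c" "h c" by (rule dual[OF c])
  let ?C = "chris (G c x)" and ?C' = "chris (conjugate h G c x)"
  show "?C' v v - ?C v v \<in> span {E c x, v}"
  proof (cases "v \<in> span {E c x}")
    case True
    then obtain k where "v = k *\<^sub>R E c x" by (auto simp: span_singleton)
    \<comment> \<open>Both connections are radiant, so they agree on \<open>(E,E)\<close>.\<close>
    then have "?C' v v - ?C v v = 0"
      using A.dd_E[OF x, of "E c x"] B.dd_E[OF x, of "E c x"] by (simp add: chris_linear)
    then show ?thesis by (simp add: span_zero)
  next
    case False
    obtain T B f d q where *: "immersed_surface X A T B f" "planelike A G E B f" "d \<in> B"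
      "snd d q \<in> local_dom d c f" "local_rep d c f (snd d q) = x"
      "range (dd (local_rep d c f) (snd d q)) = span {E c x, v}"
      using conelike_surface[OF cone c x False] .
    let ?F = "local_rep d c f" and ?s = "snd d q"
    have "planelike A (conjugate h G) E B f"
      using same *(1,2) by (simp add: same_planelike_surfaces_def)
    then have "dd (\<lambda>t. dd ?F t a) ?s a + chris (conjugate h G c (?F ?s)) (dd ?F ?s a) (dd ?F ?s a)
        \<in> range (dd ?F ?s)"
      "dd (\<lambda>t. dd ?F t a) ?s a + chris (G c (?F ?s)) (dd ?F ?s a) (dd ?F ?s a) \<in> range (dd ?F ?s)" for a
      using *(2-4) c unfolding planelike_def totally_geodesic_def Let_def by blast+
    note 12 = this[unfolded *(5,6)]
    have "v \<in> range (dd ?F ?s)" unfolding *(6) by (simp add: span_base)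
    then obtain a where "v = dd ?F ?s a" by blast
    then show ?thesis using span_diff[OF 12[of a]] by simp
  qed
qed

lemma conn_eq_iff:
  "conn_eq A G (conjugate h G) \<longleftrightarrow> (\<forall>c\<in>A. \<forall>x\<in>cdom c. \<forall>u v. chris (conjugate h G c x) u v = chris (G c x) u v)"
proof -
  have "\<Gamma> = \<Gamma>'" if "\<And>u v. chris \<Gamma>' u v = chris \<Gamma> u v" for \<Gamma> \<Gamma>' :: "real^'n^'n^'n"
    using chris_axis[of \<Gamma>] chris_axis[of \<Gamma>'] that by (metis vec_eq_iff)
  then show ?thesis unfolding conn_eq_def by metis
qed

text \<open>By \<open>ip_G'\<close> the conjugate differs from \<open>G\<close> by the covariant
  derivative of \<open>h\<close>, which must then vanish.\<close>

lemma conn_eq_imp_levi_civita: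
  assumes "conn_eq A G (conjugate h G)"
  shows "levi_civita A h G"
  unfolding levi_civita_def
proof (intro conjI ballI allI)
  show "affine_connection A G" "torsion_free A G"
    using radiant_statistical by (simp_all add: radiant_statistical_def)
  fix c x i j k assume c: "c \<in> A" and x: "x \<in> cdom c"
  interpret statistical_chart "cdom c" "G c" "E c" "h c" by (rule statistical[OF c])
  have "G' x = G c x" using assms c x by (simp add: conn_eq_def conjugate_chart)
  then show "nabla_metric (G c) (h c) x i j k = 0"
    using ip_G'[OF x] by (simp add: nabla_metric_eq)
qed

lemma conn_eq_imp_same_planelike:
  assumes eq: "conn_eq A G (conjugate h G)"
  shows "same_planelike_surfaces X A G (conjugate h G) E"
  unfolding same_planelike_surfaces_def
proof (intro allI impI)
  fix T B f assume im: "immersed_surface X A T B f"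
  have "G c (local_rep d c f s) = conjugate h G c (local_rep d c f s)"
    if "d \<in> B" "c \<in> A" "s \<in> local_dom d c f" for c d s
  proof -
    have "local_rep d c f s \<in> cdom c"
      using immersed_surface_local(3)[OF smooth_manifold that(2) im that(1)] that(3) by blast
    then show ?thesis using eq that(2) by (simp add: conn_eq_def)
  qed
  then show "planelike A G E B f \<longleftrightarrow> planelike A (conjugate h G) E B f"
    by (simp add: planelike_def totally_geodesic_def Let_def)
qed

end

theorem lemma8p16:
  fixes X :: "'a topology"
    and A :: "('a, 'n::finite) chart set"
    and G :: "('a, 'n) conn"
    and E :: "('a, 'n) vfield"
    and h :: "('a, 'n) metric"
  assumes "smooth_manifold X A"
    and "CARD('n) \<noteq> 2"
    and "radiant_statistical A G E h"
    and "nonsingular A E"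
  shows "(conelike X A G E \<and> conelike X A (conjugate h G) E
            \<longleftrightarrow> invariant_conn A E G \<and> invariant_conn A E (conjugate h G))
       \<and> (invariant_conn A E G \<and> invariant_conn A E (conjugate h G)
            \<longleftrightarrow> radial_curvature_zero A E h (conjugate h G) \<and> radial_curvature_zero A E h G)
       \<and> (conelike X A G E \<and> conelike X A (conjugate h G) E \<longrightarrow>
            (same_planelike_surfaces X A G (conjugate h G) E
               \<longleftrightarrow> conn_eq A G (conjugate h G) \<and> levi_civita A h G)
          \<and> (conn_eq A G (conjugate h G) \<and> levi_civita A h G \<longrightarrow> concurrent A h E))"
proof -
  interpret radiant_statistical_manifold X A G E h by unfold_locales (rule assms)+
  have inv: "invertible (h c x)" and tr: "transpose (h c x) = h c x" if "c \<in> A" "x \<in> cdom c" for c x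
    using assms(3) that by (simp_all add: radiant_statistical_def pseudo_riemannian_metric_def)
  \<comment> \<open>Each connection, if radially flat, has its own planelike surfaces, while
    conelikeness of \<open>G\<close> gives flatness of both.\<close>
  have cone: "conelike X A G E \<and> conelike X A (conjugate h G) E \<longleftrightarrow> radially_flat \<and> conj.radially_flat"
    using conelike_imp_flat[OF assms(2)] radially_flat_imp_conelike conj.radially_flat_imp_conelike by blast
  have same: "same_planelike_surfaces X A G (conjugate h G) E
      \<longleftrightarrow> conn_eq A G (conjugate h G) \<and> levi_civita A h G" if "conelike X A G E"
    using same_planelike_imp_conn_eq[OF assms(2) that] conn_eq_iff conn_eq_imp_levi_civita
      conn_eq_imp_same_planelike by blast
  \<comment> \<open>The Levi-Civita connection is \<open>G\<close> itself, and concurrency is its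
    radiance.\<close>
  have "concurrent A h E" if "levi_civita A h G"
    unfolding concurrent_def using that assms(3) by (auto simp: radiant_statistical_def)
  then show ?thesis
    using cone same invariant_conn_iff conj.invariant_conn_iff
      radial_curvature_zero_iff[of h, OF inv tr] conj.radial_curvature_zero_iff[of h, OF inv tr] by blast
qed

end
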